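(* Let $\mathcal U,\mathcal Y,\mathcal E,\mathcal E'$ be separable Hilbert spaces, let $$\Phi=\begin{bmatrix}\Phi_{11}&\Phi_{12}\\ \Phi_{21}&\Phi_{22}\end{bmatrix}\in S(\mathcal E'\oplus\mathcal U,\ \mathcal E\oplus\mathcal Y),$$ and let $F_1,F_2\in S(\mathcal E,\mathcal E')$ with $F_1\stackrel{\infty}{\sim}F_2$. Then $\|\Phi_{11}(0)F_1(0)\|<1$ if and only if $\|\Phi_{11}(0)F_2(0)\|<1$. Moreover, if $\|\Phi_{11}(0)F_i(0)\|<1$ holds for $i=1,2$, then $\mathfrak R_\Phi[F_1]\stackrel{\infty}{\sim}\mathfrak R_\Phi[F_2]$.
   Context: Operators are bounded linear maps between Hilbert spaces; $\mathcal L_1(\mathcal H_1,\mathcal H_2)$ is the set of contractions. For a contraction $C$, $D_C=(I-C^*C)^{1/2}$ and $\mathcal D_C=\overline{\mathrm{Ran}}\,D_C$. For contractions $A,B\in\mathcal L_1(\mathcal H_1,\mathcal H_2)$, $A\prec B$ means $A-B=D_{B^*}XD_B$ for some bounded operator $X:\mathcal D_B\to\mathcal D_{B^*}$; this is a pre-order. The Schur class $S(\mathcal U,\mathcal Y)$ consists of all $\mathcal L_1(\mathcal U,\mathcal Y)$-valued analytic functions on the open unit disc $\mathbb D$. For $F\in S(\mathcal U,\mathcal Y)$, $T_F:H^2_{\mathcal U}\to H^2_{\mathcal Y}$, $(T_Fh)(\lambda)=F(\lambda)h(\lambda)$. For $F,G\in S(\mathcal U,\mathcal Y)$ write $F\stackrel{\infty}{\prec}G$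 if $T_F\prec T_G$, and $F\stackrel{\infty}{\sim}G$ if $F\stackrel{\infty}{\prec}G$ and $G\stackrel{\infty}{\prec}F$. In the block decomposition, $\Phi_{11}(\lambda):\mathcal E'\to\mathcal E$, $\Phi_{12}(\lambda):\mathcal U\to\mathcal E$, $\Phi_{21}(\lambda):\mathcal E'\to\mathcal Y$, $\Phi_{22}(\lambda):\mathcal U\to\mathcal Y$. The Redheffer map is defined for $F\in S(\mathcal E,\mathcal E')$ with $\|\Phi_{11}(0)F(0)\|<1$ by $$\mathfrak R_\Phi[F](\lambda)=\Phi_{22}(\lambda)+\Phi_{21}(\lambda)F(\lambda)(I-\Phi_{11}(\lambda)F(\lambda))^{-1}\Phi_{12}(\lambda)\quad(\lambda\in\mathbb D);$$ it is known that under this condition the inverse exists for every $\lambda\in\mathbb D$ and $\mathfrak R_\Phi[F]\in S(\mathcal U,\mathcal Y)$. *)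

theory Defs
  imports "HOL-Analysis.Analysis"
begin

section \<open>Complex Hilbert spaces\<close>

class complex_normed_vector = real_normed_vector +
  fixes scaleC :: "complex \<Rightarrow> 'a \<Rightarrow> 'a" (infixr "*\<^sub>C" 75)
  assumes scaleC_add_right: "a *\<^sub>C (x + y) = a *\<^sub>C x + a *\<^sub>C y"
    and scaleC_add_left: "(a + b) *\<^sub>C x = a *\<^sub>C x + b *\<^sub>C x"
    and scaleC_scaleC: "a *\<^sub>C (b *\<^sub>C x) = (a * b) *\<^sub>C x"
    and scaleR_scaleC: "r *\<^sub>R x = complex_of_real r *\<^sub>C x"
    and norm_scaleC: "norm (a *\<^sub>C x) = cmod a * norm x"

text \<open>The complex inner product is linear in its first argument; its real part is the real inner
  product that induces the norm.\<close>

class complex_hilbert = complex_normed_vector + real_inner + complete_space +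
  fixes cinner :: "'a \<Rightarrow> 'a \<Rightarrow> complex"
  assumes cinner_commute: "cinner x y = cnj (cinner y x)"
    and cinner_add_left: "cinner (x + y) z = cinner x z + cinner y z"
    and cinner_scaleC_left: "cinner (a *\<^sub>C x) y = a * cinner x y"
    and inner_eq_Re_cinner: "x \<bullet> y = Re (cinner x y)"

instance complex_hilbert \<subseteq> banach ..

lemma scaleC_one [simp]: "1 *\<^sub>C x = (x :: 'a :: complex_normed_vector)"
  using scaleR_scaleC[of 1 x] by simp

lemma scaleC_zero_right [simp]: "a *\<^sub>C 0 = (0 :: 'a :: complex_normed_vector)"
  using scaleC_add_right[of a 0 0] by simp

lemma scaleC_minus_right: "a *\<^sub>C (- x) = - (a *\<^sub>C (x :: 'a :: complex_normed_vector))"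
  using scaleC_add_right[of a x "- x"] by (simp add: eq_neg_iff_add_eq_0 add.commute)

lemma scaleC_diff_right: "a *\<^sub>C (x - y) = a *\<^sub>C x - a *\<^sub>C (y :: 'a :: complex_normed_vector)"
  using scaleC_add_right[of a x "- y"] by (simp add: scaleC_minus_right)

lemma scaleC_scaleR_commute:
  "a *\<^sub>C (r *\<^sub>R x) = r *\<^sub>R (a *\<^sub>C (x :: 'a :: complex_normed_vector))"
  by (simp add: scaleR_scaleC scaleC_scaleC mult.commute)

lemma bounded_linear_scaleC_right: "bounded_linear (\<lambda>x :: 'a :: complex_normed_vector. a *\<^sub>C x)"
  by (rule bounded_linear_intro[where K = "cmod a"])
    (auto simp: scaleC_add_right scaleC_scaleR_commute norm_scaleC)

lemma Im_cinner: "Im (cinner x y) = ((- \<i>) *\<^sub>C x) \<bullet> y"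
  by (simp add: inner_eq_Re_cinner cinner_scaleC_left)

lemma cinner_eq_Complex: "cinner x y = Complex (x \<bullet> y) (((- \<i>) *\<^sub>C x) \<bullet> y)"
  by (simp add: complex_eq_iff inner_eq_Re_cinner cinner_scaleC_left)

text \<open>The norm of a product type is \<open>sqrt ((norm x)\<^sup>2 + (norm y)\<^sup>2)\<close>, so that \<open>'a \<times> 'b\<close> is
  the Hilbert space direct sum.\<close>

instantiation prod :: (complex_normed_vector, complex_normed_vector) complex_normed_vector
begin

definition scaleC_prod :: "complex \<Rightarrow> 'a \<times> 'b \<Rightarrow> 'a \<times> 'b"
  where "scaleC_prod a x = (a *\<^sub>C fst x, a *\<^sub>C snd x)"

instance
proof
  fix a :: complex and x :: "'a \<times> 'b"
  have "norm (a *\<^sub>C x) = sqrt ((cmod a)\<^sup>2 * ((norm (fst x))\<^sup>2 + (norm (snd x))\<^sup>2))"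
    by (simp add: scaleC_prod_def norm_prod_def norm_scaleC power_mult_distrib distrib_left)
  then show "norm (a *\<^sub>C x) = cmod a * norm x"
    by (simp add: norm_prod_def real_sqrt_mult)
qed (auto simp: scaleC_prod_def scaleC_add_right scaleC_add_left scaleC_scaleC scaleR_prod_def
    scaleR_scaleC)

end

instantiation prod :: (complex_hilbert, complex_hilbert) complex_hilbert
begin

definition cinner_prod :: "'a \<times> 'b \<Rightarrow> 'a \<times> 'b \<Rightarrow> complex"
  where "cinner_prod x y = cinner (fst x) (fst y) + cinner (snd x) (snd y)"

instance
proof
  fix x y :: "'a \<times> 'b"
  show "cinner x y = cnj (cinner y x)"
    unfolding cinner_prod_def complex_cnj_add
    by (simp flip: cinner_commute)
qed (auto simp: cinner_prod_def scaleC_prod_def cinner_add_left cinner_scaleC_left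
    inner_prod_def inner_eq_Re_cinner algebra_simps)

end

section \<open>Operators\<close>

typedef (overloaded) ('a, 'b) cblinfun (\<open>(_ \<Rightarrow>\<^sub>C\<^sub>L /_)\<close> [19, 18] 18) =
  "{f :: 'a::complex_normed_vector \<Rightarrow> 'b::complex_normed_vector.
      bounded_linear f \<and> (\<forall>c x. f (c *\<^sub>C x) = c *\<^sub>C f x)}"
  morphisms cblinfun_apply CBlinfun
  by (rule exI[of _ "\<lambda>_. 0"]) (simp add: bounded_linear_zero)

setup_lifting type_definition_cblinfun

declare [[coercion
    "cblinfun_apply :: ('a::complex_normed_vector \<Rightarrow>\<^sub>C\<^sub>L 'b::complex_normed_vector) \<Rightarrow> 'a \<Rightarrow> 'b"]]

instantiation cblinfun :: (complex_normed_vector, complex_normed_vector) complex_normed_vector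
begin

lift_definition norm_cblinfun :: "'a \<Rightarrow>\<^sub>C\<^sub>L 'b \<Rightarrow> real" is onorm .

lift_definition zero_cblinfun :: "'a \<Rightarrow>\<^sub>C\<^sub>L 'b" is "\<lambda>_. 0"
  by (simp add: bounded_linear_zero)

lift_definition plus_cblinfun :: "'a \<Rightarrow>\<^sub>C\<^sub>L 'b \<Rightarrow> 'a \<Rightarrow>\<^sub>C\<^sub>L 'b \<Rightarrow> 'a \<Rightarrow>\<^sub>C\<^sub>L 'b" is "\<lambda>f g x. f x + g x"
  by (simp add: bounded_linear_add scaleC_add_right)

lift_definition uminus_cblinfun :: "'a \<Rightarrow>\<^sub>C\<^sub>L 'b \<Rightarrow> 'a \<Rightarrow>\<^sub>C\<^sub>L 'b" is "\<lambda>f x. - f x"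
  by (simp add: bounded_linear_minus scaleC_minus_right)

lift_definition minus_cblinfun :: "'a \<Rightarrow>\<^sub>C\<^sub>L 'b \<Rightarrow> 'a \<Rightarrow>\<^sub>C\<^sub>L 'b \<Rightarrow> 'a \<Rightarrow>\<^sub>C\<^sub>L 'b" is "\<lambda>f g x. f x - g x"
  by (simp add: bounded_linear_sub scaleC_diff_right)

lift_definition scaleR_cblinfun :: "real \<Rightarrow> 'a \<Rightarrow>\<^sub>C\<^sub>L 'b \<Rightarrow> 'a \<Rightarrow>\<^sub>C\<^sub>L 'b" is "\<lambda>r f x. r *\<^sub>R f x"
  by (simp add: bounded_linear_const_scaleR scaleC_scaleR_commute)

lift_definition scaleC_cblinfun :: "complex \<Rightarrow> 'a \<Rightarrow>\<^sub>C\<^sub>L 'b \<Rightarrow> 'a \<Rightarrow>\<^sub>C\<^sub>L 'b" is "\<lambda>a f x. a *\<^sub>C f x"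
  by (simp add: bounded_linear_compose[OF bounded_linear_scaleC_right] scaleC_scaleC mult.commute)

definition dist_cblinfun :: "'a \<Rightarrow>\<^sub>C\<^sub>L 'b \<Rightarrow> 'a \<Rightarrow>\<^sub>C\<^sub>L 'b \<Rightarrow> real"
  where "dist_cblinfun f g = norm (f - g)"

definition sgn_cblinfun :: "'a \<Rightarrow>\<^sub>C\<^sub>L 'b \<Rightarrow> 'a \<Rightarrow>\<^sub>C\<^sub>L 'b"
  where "sgn_cblinfun f = inverse (norm f) *\<^sub>R f"

definition uniformity_cblinfun :: "(('a \<Rightarrow>\<^sub>C\<^sub>L 'b) \<times> ('a \<Rightarrow>\<^sub>C\<^sub>L 'b)) filter"
  where "uniformity_cblinfun = (INF e\<in>{0<..}. principal {(f, g). dist f g < e})"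

definition open_cblinfun :: "('a \<Rightarrow>\<^sub>C\<^sub>L 'b) set \<Rightarrow> bool"
  where "open_cblinfun S \<longleftrightarrow> (\<forall>f\<in>S. \<forall>\<^sub>F (f', g) in uniformity. f' = f \<longrightarrow> g \<in> S)"

instance
proof
  fix a :: complex and r :: real and f g :: "'a \<Rightarrow>\<^sub>C\<^sub>L 'b"
  show "(norm f = 0) = (f = 0)"
    by transfer (auto simp: onorm_eq_0)
  show "norm (f + g) \<le> norm f + norm g"
    by transfer (auto simp: onorm_triangle)
  show "norm (r *\<^sub>R f) = \<bar>r\<bar> * norm f"
    by transfer (auto simp: onorm_scaleR)
  have le: "onorm (\<lambda>x. a *\<^sub>C f x) \<le> cmod a * onorm f"
    if "bounded_linear f" for a and f :: "'a \<Rightarrow> 'b"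
    using that
    by (intro onorm_bound)
      (auto simp: norm_scaleC onorm_pos_le mult.assoc intro!: mult_left_mono onorm)
  have "onorm (\<lambda>x. a *\<^sub>C f x) = cmod a * onorm f"
    if f: "bounded_linear f" for f :: "'a \<Rightarrow> 'b"
  proof (cases "a = 0")
    case True
    then show ?thesis
      using le[OF f, of a] onorm_pos_le[OF bounded_linear_compose[OF bounded_linear_scaleC_right f]]
      by (simp add: antisym)
  next
    case False
    have "onorm f = onorm (\<lambda>x. inverse a *\<^sub>C (a *\<^sub>C f x))"
      using False by (simp add: scaleC_scaleC)
    also have "\<dots> \<le> cmod (inverse a) * onorm (\<lambda>x. a *\<^sub>C f x)"
      by (rule le) (rule bounded_linear_compose[OF bounded_linear_scaleC_right f])
    finally have "cmod a * onorm f \<le> onorm (\<lambda>x. a *\<^sub>C f x)"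
      using False by (simp add: norm_divide field_simps)
    then show ?thesis using le[OF f, of a] by simp
  qed
  then show "norm (a *\<^sub>C f) = cmod a * norm f"
    by transfer auto
qed (transfer; auto simp: dist_cblinfun_def sgn_cblinfun_def uniformity_cblinfun_def
    open_cblinfun_def algebra_simps scaleC_add_right scaleC_add_left scaleC_scaleC scaleR_scaleC
    scaleR_add_right scaleR_add_left)+

end

lift_definition cblinfun_id :: "'a::complex_normed_vector \<Rightarrow>\<^sub>C\<^sub>L 'a" is "\<lambda>x. x"
  by simp

lift_definition cblinfun_compose ::
  "'b::complex_normed_vector \<Rightarrow>\<^sub>C\<^sub>L 'c::complex_normed_vector \<Rightarrow>
     'a::complex_normed_vector \<Rightarrow>\<^sub>C\<^sub>L 'b \<Rightarrow> 'a \<Rightarrow>\<^sub>C\<^sub>L 'c" (infixl "o\<^sub>C" 75)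
  is "\<lambda>f g x. f (g x)"
  by (auto intro: bounded_linear_compose)

definition cadjoint :: "'a::complex_hilbert \<Rightarrow>\<^sub>C\<^sub>L 'b::complex_hilbert \<Rightarrow> 'b \<Rightarrow>\<^sub>C\<^sub>L 'a"
  where "cadjoint A = (THE B :: 'b \<Rightarrow>\<^sub>C\<^sub>L 'a. \<forall>x y. cinner (A x) y = cinner x (B y))"

definition cinverse :: "'a::complex_normed_vector \<Rightarrow>\<^sub>C\<^sub>L 'a \<Rightarrow> 'a \<Rightarrow>\<^sub>C\<^sub>L 'a"
  where "cinverse A = (THE B. A o\<^sub>C B = cblinfun_id \<and> B o\<^sub>C A = cblinfun_id)"

definition positive_op :: "'a::complex_hilbert \<Rightarrow>\<^sub>C\<^sub>L 'a \<Rightarrow> bool"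
  where "positive_op A \<longleftrightarrow> (\<forall>x. cinner (A x) x \<in> \<real> \<and> 0 \<le> Re (cinner (A x) x))"

definition op_sqrt :: "'a::complex_hilbert \<Rightarrow>\<^sub>C\<^sub>L 'a \<Rightarrow> 'a \<Rightarrow>\<^sub>C\<^sub>L 'a"
  where "op_sqrt A = (THE S. positive_op S \<and> S o\<^sub>C S = A)"

definition contraction :: "'a::complex_normed_vector \<Rightarrow>\<^sub>C\<^sub>L 'b::complex_normed_vector \<Rightarrow> bool"
  where "contraction A \<longleftrightarrow> norm A \<le> 1"

definition defect :: "'a::complex_hilbert \<Rightarrow>\<^sub>C\<^sub>L 'b::complex_hilbert \<Rightarrow> 'a \<Rightarrow>\<^sub>C\<^sub>L 'a"
  where "defect C = op_sqrt (cblinfun_id - cadjoint C o\<^sub>C C)"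

definition defect_space :: "'a::complex_hilbert \<Rightarrow>\<^sub>C\<^sub>L 'b::complex_hilbert \<Rightarrow> 'a set"
  where "defect_space C = closure (range (defect C))"

text \<open>Bounded operators between closed subspaces \<open>V\<close> and \<open>W\<close>; the values outside \<open>V\<close> are
  irrelevant.\<close>

definition bounded_clinear_on ::
  "'a::complex_hilbert set \<Rightarrow> 'b::complex_hilbert set \<Rightarrow> ('a \<Rightarrow> 'b) \<Rightarrow> bool"
  where "bounded_clinear_on V W X \<longleftrightarrow>
    (\<forall>x\<in>V. X x \<in> W) \<and>
    (\<forall>x\<in>V. \<forall>y\<in>V. X (x + y) = X x + X y) \<and>
    (\<forall>c. \<forall>x\<in>V. X (c *\<^sub>C x) = c *\<^sub>C X x) \<and>
    (\<exists>K. \<forall>x\<in>V. norm (X x) \<le> K * norm x)"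

text \<open>A relation on contractions: membership of both operators is part of it.\<close>

definition op_prec :: "'a::complex_hilbert \<Rightarrow>\<^sub>C\<^sub>L 'b::complex_hilbert \<Rightarrow> 'a \<Rightarrow>\<^sub>C\<^sub>L 'b \<Rightarrow> bool"
    (infix "\<prec>" 50)
  where "A \<prec> B \<longleftrightarrow> contraction A \<and> contraction B \<and>
    (\<exists>X. bounded_clinear_on (defect_space B) (defect_space (cadjoint B)) X \<and>
      (\<forall>u. (A - B) u = defect (cadjoint B) (X (defect B u))))"

text \<open>The block entries of an operator \<open>'a \<oplus> 'b \<rightarrow> 'c \<oplus> 'd\<close>.\<close>

lemma bounded_linear_inl: "bounded_linear (\<lambda>x. (x, 0))"
  by (intro bounded_linear_Pair bounded_linear_ident bounded_linear_zero)

lemma bounded_linear_inr: "bounded_linear (\<lambda>x. (0, x))"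
  by (intro bounded_linear_Pair bounded_linear_ident bounded_linear_zero)

lift_definition cbl_inl :: "'a::complex_normed_vector \<Rightarrow>\<^sub>C\<^sub>L 'a \<times> 'b::complex_normed_vector"
  is "\<lambda>x. (x, 0)"
  by (simp add: bounded_linear_inl scaleC_prod_def)

lift_definition cbl_inr :: "'b::complex_normed_vector \<Rightarrow>\<^sub>C\<^sub>L 'a::complex_normed_vector \<times> 'b"
  is "\<lambda>x. (0, x)"
  by (simp add: bounded_linear_inr scaleC_prod_def)

lift_definition cbl_fst :: "'a::complex_normed_vector \<times> 'b::complex_normed_vector \<Rightarrow>\<^sub>C\<^sub>L 'a"
  is fst
  by (simp add: bounded_linear_fst scaleC_prod_def)

lift_definition cbl_snd :: "'a::complex_normed_vector \<times> 'b::complex_normed_vector \<Rightarrow>\<^sub>C\<^sub>L 'b"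
  is snd
  by (simp add: bounded_linear_snd scaleC_prod_def)

definition block11 ::
  "'a::complex_normed_vector \<times> 'b::complex_normed_vector \<Rightarrow>\<^sub>C\<^sub>L
     'c::complex_normed_vector \<times> 'd::complex_normed_vector \<Rightarrow> 'a \<Rightarrow>\<^sub>C\<^sub>L 'c"
  where "block11 A = cbl_fst o\<^sub>C A o\<^sub>C cbl_inl"

definition block12 ::
  "'a::complex_normed_vector \<times> 'b::complex_normed_vector \<Rightarrow>\<^sub>C\<^sub>L
     'c::complex_normed_vector \<times> 'd::complex_normed_vector \<Rightarrow> 'b \<Rightarrow>\<^sub>C\<^sub>L 'c"
  where "block12 A = cbl_fst o\<^sub>C A o\<^sub>C cbl_inr"

definition block21 ::
  "'a::complex_normed_vector \<times> 'b::complex_normed_vector \<Rightarrow>\<^sub>C\<^sub>L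
     'c::complex_normed_vector \<times> 'd::complex_normed_vector \<Rightarrow> 'a \<Rightarrow>\<^sub>C\<^sub>L 'd"
  where "block21 A = cbl_snd o\<^sub>C A o\<^sub>C cbl_inl"

definition block22 ::
  "'a::complex_normed_vector \<times> 'b::complex_normed_vector \<Rightarrow>\<^sub>C\<^sub>L
     'c::complex_normed_vector \<times> 'd::complex_normed_vector \<Rightarrow> 'b \<Rightarrow>\<^sub>C\<^sub>L 'd"
  where "block22 A = cbl_snd o\<^sub>C A o\<^sub>C cbl_inr"

section \<open>The Hardy space\<close>

abbreviation unit_disc :: "complex set" (\<open>\<bbbD>\<close>)
  where "\<bbbD> \<equiv> ball 0 1"

definition has_taylor_coeffs ::
  "(complex \<Rightarrow> 'a::complex_normed_vector) \<Rightarrow> (nat \<Rightarrow> 'a) \<Rightarrow> bool"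
  where "has_taylor_coeffs h c \<longleftrightarrow> (\<forall>z\<in>\<bbbD>. (\<lambda>n. z ^ n *\<^sub>C c n) sums h z)"

definition square_summable :: "(nat \<Rightarrow> 'a::real_normed_vector) \<Rightarrow> bool"
  where "square_summable c \<longleftrightarrow> summable (\<lambda>n. (norm (c n))\<^sup>2)"

text \<open>\<open>H\<^sup>2\<close>: the functions on the disc whose Taylor coefficients are square summable.  They are
  extended by zero to the whole plane, so that equality in the type is equality on the disc.\<close>

typedef (overloaded) 'a hardy =
  "{h :: complex \<Rightarrow> 'a::complex_hilbert.
      (\<exists>c. square_summable c \<and> has_taylor_coeffs h c) \<and> (\<forall>z. z \<notin> \<bbbD> \<longrightarrow> h z = 0)}"
  morphisms hardy_fun Hardy
  by (rule exI[of _ "\<lambda>_. 0"])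
    (auto simp: square_summable_def has_taylor_coeffs_def intro!: exI[of _ "\<lambda>_. 0"])

setup_lifting type_definition_hardy

lemma square_summable_zero: "square_summable (\<lambda>_. 0)"
  by (simp add: square_summable_def)

lemma square_summable_scaleC:
  "square_summable c \<Longrightarrow> square_summable (\<lambda>n. a *\<^sub>C (c n :: 'a :: complex_normed_vector))"
  by (simp add: square_summable_def norm_scaleC power_mult_distrib summable_mult)

lemma norm_add_square_le:
  "(norm (x + y))\<^sup>2 \<le> 2 * (norm x)\<^sup>2 + 2 * (norm (y :: 'a :: real_normed_vector))\<^sup>2"
proof -
  have "(norm (x + y))\<^sup>2 \<le> (norm x + norm y)\<^sup>2"
    by (intro power_mono norm_triangle_ineq norm_ge_zero)
  also have "\<dots> \<le> 2 * (norm x)\<^sup>2 + 2 * (norm y)\<^sup>2"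
    using zero_le_power2[of "norm x - norm y"] by (simp add: power2_eq_square algebra_simps)
  finally show ?thesis .
qed

lemma square_summable_add:
  assumes "square_summable c" "square_summable d"
  shows "square_summable (\<lambda>n. c n + d n :: 'a :: real_normed_vector)"
  unfolding square_summable_def
proof (rule summable_comparison_test')
  show "summable (\<lambda>n. 2 * (norm (c n))\<^sup>2 + 2 * (norm (d n))\<^sup>2)"
    using assms by (intro summable_add summable_mult) (auto simp: square_summable_def)
  show "norm ((norm (c n + d n))\<^sup>2) \<le> 2 * (norm (c n))\<^sup>2 + 2 * (norm (d n))\<^sup>2" for n
    using norm_add_square_le by simp
qed

lemma taylor_zero: "has_taylor_coeffs (\<lambda>_. 0) (\<lambda>_. 0)"
  by (simp add: has_taylor_coeffs_def)

lemma taylor_scaleC: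
  "has_taylor_coeffs h c \<Longrightarrow> has_taylor_coeffs (\<lambda>z. a *\<^sub>C h z) (\<lambda>n. a *\<^sub>C c n)"
  unfolding has_taylor_coeffs_def
proof
  fix z assume "\<forall>z\<in>\<bbbD>. (\<lambda>n. z ^ n *\<^sub>C c n) sums h z" "z \<in> \<bbbD>"
  then have "(\<lambda>n. a *\<^sub>C z ^ n *\<^sub>C c n) sums (a *\<^sub>C h z)"
    by (intro bounded_linear.sums[OF bounded_linear_scaleC_right]) auto
  then show "(\<lambda>n. z ^ n *\<^sub>C a *\<^sub>C c n) sums (a *\<^sub>C h z)"
    by (simp add: scaleC_scaleC mult.commute)
qed

lemma taylor_add:
  "has_taylor_coeffs h c \<Longrightarrow> has_taylor_coeffs k d \<Longrightarrow>
    has_taylor_coeffs (\<lambda>z. h z + k z) (\<lambda>n. c n + d n)"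
  by (auto simp: has_taylor_coeffs_def scaleC_add_right intro: sums_add)

lemma scaleC_minus_one: "(- 1) *\<^sub>C x = - (x :: 'a :: complex_normed_vector)"
  using scaleR_scaleC[of "- 1" x] by simp

lemma square_summable_minus:
  "square_summable c \<Longrightarrow> square_summable (\<lambda>n. - c n :: 'a :: complex_normed_vector)"
  by (simp add: square_summable_def)

lemma taylor_minus:
  "has_taylor_coeffs h c \<Longrightarrow> has_taylor_coeffs (\<lambda>z. - h z) (\<lambda>n. - c n)"
  using taylor_scaleC[of h c "- 1"] by (simp add: scaleC_minus_one)

lemma norm_cinner_le: "cmod (cinner x y) \<le> 2 * (norm x * norm y)"
proof -
  have "\<bar>Re (cinner x y)\<bar> \<le> norm x * norm y"
    using Cauchy_Schwarz_ineq2[of x y] by (simp add: inner_eq_Re_cinner)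
  moreover have "\<bar>Im (cinner x y)\<bar> \<le> norm x * norm y"
    using Cauchy_Schwarz_ineq2[of "(- \<i>) *\<^sub>C x" y] by (simp add: Im_cinner norm_scaleC)
  ultimately show ?thesis
    using cmod_le[of "cinner x y"] by simp
qed

lemma bounded_linear_cinner_left: "bounded_linear (\<lambda>x. cinner x y)"
  by (rule bounded_linear_intro[where K = "2 * norm y"])
    (use norm_cinner_le in \<open>auto simp: cinner_add_left scaleR_scaleC cinner_scaleC_left
      scaleR_conv_of_real algebra_simps\<close>)

lemma complex_powser_unique:
  fixes f g :: "nat \<Rightarrow> complex"
  assumes f: "\<And>z. cmod z < 1 \<Longrightarrow> (\<lambda>n. f n * z ^ n) sums s z"
    and g: "\<And>z. cmod z < 1 \<Longrightarrow> (\<lambda>n. g n * z ^ n) sums s z"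
  shows "f = g"
proof -
  have rad: "fps_conv_radius (Abs_fps a) > 0"
    if "\<And>z. cmod z < 1 \<Longrightarrow> (\<lambda>n. a n * z ^ n) sums s z" for a :: "nat \<Rightarrow> complex"
  proof -
    have "summable (\<lambda>n. a n * (1/2) ^ n)"
      using that[of "1/2"] by (auto simp: norm_divide sums_iff)
    then have "conv_radius a \<ge> norm (1/2 :: complex)"
      by (rule conv_radius_geI)
    moreover have "(0 :: ereal) < ereal (norm (1/2 :: complex))"
      by simp
    ultimately show ?thesis
      unfolding fps_conv_radius_def fps_nth_Abs_fps by (rule less_le_trans[rotated])
  qed
  have "Abs_fps f = Abs_fps g"
  proof (rule eval_fps_eqD)
    have "\<forall>\<^sub>F z in nhds (0 :: complex). z \<in> \<bbbD>"
      by (rule eventually_nhds_in_open) auto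
    then show "\<forall>\<^sub>F z in nhds 0. eval_fps (Abs_fps f) z = eval_fps (Abs_fps g) z"
      by eventually_elim (use f g in \<open>auto simp: eval_fps_def sums_iff\<close>)
  qed (use rad f g in auto)
  then show ?thesis
    by (metis fps_nth_Abs_fps ext)
qed

lemma taylor_unique:
  fixes h :: "complex \<Rightarrow> 'a :: complex_hilbert"
  assumes "has_taylor_coeffs h c" "has_taylor_coeffs h d"
  shows "c = d"
proof
  fix n
  have *: "(\<lambda>n. cinner (a n) y * z ^ n) sums cinner (h z) y"
    if "has_taylor_coeffs h a" "cmod z < 1" for a y z
    using bounded_linear.sums[OF bounded_linear_cinner_left, of "\<lambda>n. z ^ n *\<^sub>C a n" "h z" y] that
    by (simp add: has_taylor_coeffs_def cinner_scaleC_left mult.commute)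
  have "cinner (c n) y = cinner (d n) y" for y
    using complex_powser_unique[OF *[OF assms(1), of _ y] *[OF assms(2), of _ y]] by metis
  then have "(c n - d n) \<bullet> (c n - d n) = 0"
    unfolding inner_diff_left by (simp add: inner_eq_Re_cinner)
  then show "c n = d n"
    by simp
qed

definition hardy_coeff :: "'a::complex_hilbert hardy \<Rightarrow> nat \<Rightarrow> 'a"
  where "hardy_coeff h = (THE c. has_taylor_coeffs (hardy_fun h) c)"

lemma hardy_coeff_eqI: "has_taylor_coeffs (hardy_fun h) c \<Longrightarrow> hardy_coeff h = c"
  unfolding hardy_coeff_def using taylor_unique by blast

lemma hardy_coeff:
  "square_summable (hardy_coeff h)" "has_taylor_coeffs (hardy_fun h) (hardy_coeff h)"
  using hardy_fun[of h] hardy_coeff_eqI[of h] by auto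

lemma hardy_coeff_inject: "hardy_coeff h = hardy_coeff k \<longleftrightarrow> h = k"
proof
  assume eq: "hardy_coeff h = hardy_coeff k"
  have "hardy_fun h z = hardy_fun k z" for z
  proof (cases "z \<in> \<bbbD>")
    case True
    then show ?thesis
      using hardy_coeff(2)[of h] hardy_coeff(2)[of k] eq sums_unique2
      unfolding has_taylor_coeffs_def by metis
  next
    case False
    then show ?thesis using hardy_fun[of h] hardy_fun[of k] by simp
  qed
  then show "h = k" by (simp add: hardy_fun_inject[symmetric] fun_eq_iff)
qed simp

lemma hardy_coeff_exists:
  assumes "square_summable c"
  shows "\<exists>h :: 'a::complex_hilbert hardy. hardy_coeff h = c"
proof -
  define f where "f z = (if z \<in> \<bbbD> then (\<Sum>n. z ^ n *\<^sub>C c n) else 0)" for z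
  have "has_taylor_coeffs f c"
    unfolding has_taylor_coeffs_def
  proof
    fix z :: complex assume z: "z \<in> \<bbbD>"
    have "(\<lambda>n. (norm (c n))\<^sup>2) \<longlonglongrightarrow> 0"
      using assms unfolding square_summable_def by (rule summable_LIMSEQ_zero)
    then have "Bseq (\<lambda>n. (norm (c n))\<^sup>2)"
      by (intro convergent_imp_Bseq convergentI)
    then obtain K where K: "\<And>n. (norm (c n))\<^sup>2 \<le> K"
      by (auto simp: Bseq_def)
    have le: "norm (c n) \<le> sqrt K" for n
      using K[of n] by (simp add: real_le_rsqrt)
    have "summable (\<lambda>n. z ^ n *\<^sub>C c n)"
    proof (rule summable_comparison_test')
      show "summable (\<lambda>n. sqrt K * cmod z ^ n)"
        using z by (intro summable_mult summable_geometric) simp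
      show "norm (z ^ n *\<^sub>C c n) \<le> sqrt K * cmod z ^ n" for n
        using mult_right_mono[OF le[of n], of "cmod z ^ n"]
        by (simp add: norm_scaleC norm_power mult.commute)
    qed
    then show "(\<lambda>n. z ^ n *\<^sub>C c n) sums f z"
      using z by (simp add: f_def summable_sums)
  qed
  then have "hardy_fun (Hardy f) = f"
    using assms by (intro Hardy_inverse) (auto simp: f_def)
  then show ?thesis
    using hardy_coeff_eqI[of "Hardy f" c] \<open>has_taylor_coeffs f c\<close> by auto
qed

instantiation hardy :: (complex_hilbert) real_inner
begin

lift_definition zero_hardy :: "'a hardy" is "\<lambda>_. 0"
  using square_summable_zero taylor_zero by blast

lift_definition plus_hardy :: "'a hardy \<Rightarrow> 'a hardy \<Rightarrow> 'a hardy" is "\<lambda>h k z. h z + k z"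
  using square_summable_add taylor_add by fastforce

lift_definition uminus_hardy :: "'a hardy \<Rightarrow> 'a hardy" is "\<lambda>h z. - h z"
  using square_summable_minus taylor_minus by fastforce

lift_definition minus_hardy :: "'a hardy \<Rightarrow> 'a hardy \<Rightarrow> 'a hardy" is "\<lambda>h k z. h z - k z"
proof -
  fix h k :: "complex \<Rightarrow> 'a"
  assume *: "(\<exists>c. square_summable c \<and> has_taylor_coeffs h c) \<and> (\<forall>z. z \<notin> \<bbbD> \<longrightarrow> h z = 0)"
    "(\<exists>c. square_summable c \<and> has_taylor_coeffs k c) \<and> (\<forall>z. z \<notin> \<bbbD> \<longrightarrow> k z = 0)"
  then obtain c d where "square_summable c" "has_taylor_coeffs h c"
    "square_summable d" "has_taylor_coeffs k d" by blast
  then show "(\<exists>c. square_summable c \<and> has_taylor_coeffs (\<lambda>z. h z - k z) c) \<and>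
      (\<forall>z. z \<notin> \<bbbD> \<longrightarrow> h z - k z = 0)"
    using square_summable_add[OF _ square_summable_minus, of c d]
      taylor_add[OF _ taylor_minus, of h c k d] * by auto
qed

lift_definition scaleR_hardy :: "real \<Rightarrow> 'a hardy \<Rightarrow> 'a hardy" is "\<lambda>r h z. r *\<^sub>R h z"
  using square_summable_scaleC taylor_scaleC by (fastforce simp: scaleR_scaleC)

definition inner_hardy :: "'a hardy \<Rightarrow> 'a hardy \<Rightarrow> real"
  where "inner_hardy h k = (\<Sum>n. hardy_coeff h n \<bullet> hardy_coeff k n)"

definition norm_hardy :: "'a hardy \<Rightarrow> real"
  where "norm_hardy h = sqrt (h \<bullet> h)"

definition dist_hardy :: "'a hardy \<Rightarrow> 'a hardy \<Rightarrow> real"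
  where "dist_hardy h k = norm (h - k)"

definition sgn_hardy :: "'a hardy \<Rightarrow> 'a hardy"
  where "sgn_hardy h = inverse (norm h) *\<^sub>R h"

definition uniformity_hardy :: "('a hardy \<times> 'a hardy) filter"
  where "uniformity_hardy = (INF e\<in>{0<..}. principal {(h, k). dist h k < e})"

definition open_hardy :: "'a hardy set \<Rightarrow> bool"
  where "open_hardy S \<longleftrightarrow> (\<forall>h\<in>S. \<forall>\<^sub>F (h', k) in uniformity. h' = h \<longrightarrow> k \<in> S)"

lemma hardy_coeff_zero: "hardy_coeff (0 :: 'a hardy) = (\<lambda>_. 0)"
  by (rule hardy_coeff_eqI) (simp add: zero_hardy.rep_eq taylor_zero)

lemma hardy_coeff_add: "hardy_coeff (h + k :: 'a hardy) = (\<lambda>n. hardy_coeff h n + hardy_coeff k n)"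
  by (rule hardy_coeff_eqI) (simp add: plus_hardy.rep_eq taylor_add hardy_coeff)

lemma hardy_coeff_minus: "hardy_coeff (- h :: 'a hardy) = (\<lambda>n. - hardy_coeff h n)"
  by (rule hardy_coeff_eqI) (simp add: uminus_hardy.rep_eq taylor_minus hardy_coeff)

lemma hardy_coeff_scaleR: "hardy_coeff (r *\<^sub>R h :: 'a hardy) = (\<lambda>n. r *\<^sub>R hardy_coeff h n)"
  by (rule hardy_coeff_eqI) (simp add: scaleR_hardy.rep_eq scaleR_scaleC taylor_scaleC hardy_coeff)

lemma hardy_diff_conv_add: "h - k = h + - (k :: 'a hardy)"
  by transfer simp

lemma hardy_coeff_diff: "hardy_coeff (h - k :: 'a hardy) = (\<lambda>n. hardy_coeff h n - hardy_coeff k n)"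
  by (simp add: hardy_diff_conv_add hardy_coeff_add hardy_coeff_minus)

lemma cinner_summable: "summable (\<lambda>n. cinner (hardy_coeff h n) (hardy_coeff (k :: 'a hardy) n))"
proof (rule summable_comparison_test')
  show "summable (\<lambda>n. (norm (hardy_coeff h n))\<^sup>2 + (norm (hardy_coeff k n))\<^sup>2)"
    using hardy_coeff(1)[of h] hardy_coeff(1)[of k]
    by (intro summable_add) (auto simp: square_summable_def)
  show "norm (cinner (hardy_coeff h n) (hardy_coeff k n))
      \<le> (norm (hardy_coeff h n))\<^sup>2 + (norm (hardy_coeff k n))\<^sup>2" for n
    using norm_cinner_le[of "hardy_coeff h n" "hardy_coeff k n"]
      zero_le_power2[of "norm (hardy_coeff h n) - norm (hardy_coeff k n)"]
    by (simp add: power2_eq_square algebra_simps)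
qed

lemma inner_summable: "summable (\<lambda>n. hardy_coeff h n \<bullet> hardy_coeff (k :: 'a hardy) n)"
  using cinner_summable[of h k] by (simp add: inner_eq_Re_cinner summable_Re)

instance
proof
  fix r s :: real and h k l :: "'a hardy"
  note inject = hardy_coeff_inject[symmetric]
  note coeff = hardy_coeff_add hardy_coeff_minus hardy_coeff_diff hardy_coeff_scaleR hardy_coeff_zero
  show "h + k + l = h + (k + l)" "h + k = k + h" "0 + h = h" "- h + h = 0" "h - k = h + - k"
    by (simp_all add: inject coeff algebra_simps)
  show "r *\<^sub>R (h + k) = r *\<^sub>R h + r *\<^sub>R k" "(r + s) *\<^sub>R h = r *\<^sub>R h + s *\<^sub>R h"
    "r *\<^sub>R s *\<^sub>R h = (r * s) *\<^sub>R h" "1 *\<^sub>R h = h"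
    by (simp_all add: inject coeff algebra_simps)
  show "h \<bullet> k = k \<bullet> h"
    by (simp add: inner_hardy_def inner_commute)
  show "(h + k) \<bullet> l = h \<bullet> l + k \<bullet> l"
    by (simp add: inner_hardy_def coeff inner_add_left suminf_add inner_summable)
  show "r *\<^sub>R h \<bullet> k = r * (h \<bullet> k)"
    by (simp add: inner_hardy_def coeff suminf_mult inner_summable)
  show "0 \<le> h \<bullet> h"
    unfolding inner_hardy_def by (intro suminf_nonneg inner_summable) simp
  show "(h \<bullet> h = 0) = (h = 0)"
    unfolding inner_hardy_def
    by (subst suminf_eq_zero_iff) (auto simp: inner_summable inject coeff fun_eq_iff)
qed (auto simp: dist_hardy_def sgn_hardy_def uniformity_hardy_def open_hardy_def norm_hardy_def)

end

lemma norm_hardy_square: "(norm (h :: 'a::complex_hilbert hardy))\<^sup>2 = (\<Sum>n. (norm (hardy_coeff h n))\<^sup>2)"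
  by (simp add: power2_norm_eq_inner inner_hardy_def)

lemma norm_hardy_coeff_summable:
  "summable (\<lambda>n. (norm (hardy_coeff (h :: 'a::complex_hilbert hardy) n))\<^sup>2)"
  using hardy_coeff(1)[of h] by (simp add: square_summable_def)

lemma sum_norm_hardy_coeff_le:
  "(\<Sum>n<N. (norm (hardy_coeff (h :: 'a::complex_hilbert hardy) n))\<^sup>2) \<le> (norm h)\<^sup>2"
  unfolding norm_hardy_square by (intro sum_le_suminf norm_hardy_coeff_summable) auto

lemma norm_hardy_coeff_le: "norm (hardy_coeff (h :: 'a::complex_hilbert hardy) n) \<le> norm h"
proof -
  have "(norm (hardy_coeff h n))\<^sup>2 \<le> (\<Sum>m<Suc n. (norm (hardy_coeff h m))\<^sup>2)"
    by (simp add: sum_nonneg)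
  also have "\<dots> \<le> (norm h)\<^sup>2"
    by (rule sum_norm_hardy_coeff_le)
  finally show ?thesis
    by (rule power2_le_imp_le) simp
qed

lemma Cauchy_hardy_convergent:
  fixes X :: "nat \<Rightarrow> 'a::complex_hilbert hardy"
  assumes "Cauchy X"
  shows "convergent X"
proof -
  have "Cauchy (\<lambda>k. hardy_coeff (X k) n)" for n
    unfolding Cauchy_def
  proof (intro allI impI)
    fix e :: real assume "e > 0"
    then obtain M where M: "\<And>k m. k \<ge> M \<Longrightarrow> m \<ge> M \<Longrightarrow> dist (X k) (X m) < e"
      using assms unfolding Cauchy_def by blast
    have "dist (hardy_coeff (X k) n) (hardy_coeff (X m) n) \<le> dist (X k) (X m)" for k m
      using norm_hardy_coeff_le[of "X k - X m" n] by (simp add: dist_norm hardy_coeff_diff)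
    with M show "\<exists>M. \<forall>m\<ge>M. \<forall>k\<ge>M. dist (hardy_coeff (X m) n) (hardy_coeff (X k) n) < e"
      by (meson le_less_trans)
  qed
  then have "\<exists>l. (\<lambda>k. hardy_coeff (X k) n) \<longlonglongrightarrow> l" for n
    using Cauchy_convergent convergent_def by blast
  then obtain c where c: "\<And>n. (\<lambda>k. hardy_coeff (X k) n) \<longlonglongrightarrow> c n"
    by metis
  have tail: "\<exists>M. \<forall>k\<ge>M. \<forall>N. (\<Sum>n<N. (norm (hardy_coeff (X k) n - c n))\<^sup>2) \<le> e\<^sup>2"
    if e: "e > 0" for e :: real
  proof -
    obtain M where M: "\<And>k m. k \<ge> M \<Longrightarrow> m \<ge> M \<Longrightarrow> norm (X k - X m) < e"
      using assms e unfolding Cauchy_def dist_norm by blast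
    have "(\<Sum>n<N. (norm (hardy_coeff (X k) n - c n))\<^sup>2) \<le> e\<^sup>2" if k: "k \<ge> M" for k N
    proof (rule LIMSEQ_le_const2)
      show "(\<lambda>m. \<Sum>n<N. (norm (hardy_coeff (X k) n - hardy_coeff (X m) n))\<^sup>2)
          \<longlonglongrightarrow> (\<Sum>n<N. (norm (hardy_coeff (X k) n - c n))\<^sup>2)"
        by (intro tendsto_intros c)
      have "(\<Sum>n<N. (norm (hardy_coeff (X k) n - hardy_coeff (X m) n))\<^sup>2) \<le> e\<^sup>2" if "m \<ge> M" for m
      proof -
        have "(\<Sum>n<N. (norm (hardy_coeff (X k) n - hardy_coeff (X m) n))\<^sup>2) \<le> (norm (X k - X m))\<^sup>2"
          using sum_norm_hardy_coeff_le[where h = "X k - X m"] by (simp add: hardy_coeff_diff)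
        also have "\<dots> \<le> e\<^sup>2"
          using M[OF k that] by (intro power_mono) auto
        finally show ?thesis .
      qed
      then show "\<exists>M. \<forall>m\<ge>M. (\<Sum>n<N. (norm (hardy_coeff (X k) n - hardy_coeff (X m) n))\<^sup>2) \<le> e\<^sup>2"
        by blast
    qed
    then show ?thesis by blast
  qed
  have diff: "square_summable (\<lambda>n. hardy_coeff (X k) n - c n)"
    if "\<forall>N. (\<Sum>n<N. (norm (hardy_coeff (X k) n - c n))\<^sup>2) \<le> e" for k e
    unfolding square_summable_def
    by (rule bounded_imp_summable[where B = e]) (use that[rule_format, of "Suc _"] in \<open>auto simp: lessThan_Suc_atMost\<close>)
  obtain k where "square_summable (\<lambda>n. hardy_coeff (X k) n - c n)"
    using tail[of 1] diff by fastforce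
  from square_summable_add[OF hardy_coeff(1)[of "X k"] square_summable_minus[OF this]]
  have "square_summable c" by simp
  then obtain h :: "'a hardy" where h: "hardy_coeff h = c"
    using hardy_coeff_exists by blast
  have "X \<longlonglongrightarrow> h"
    unfolding LIMSEQ_def
  proof (intro allI impI)
    fix r :: real assume r: "r > 0"
    obtain M where M: "\<forall>k\<ge>M. \<forall>N. (\<Sum>n<N. (norm (hardy_coeff (X k) n - c n))\<^sup>2) \<le> (r / 2)\<^sup>2"
      using tail[of "r / 2"] r by auto
    have "dist (X k) h < r" if "k \<ge> M" for k
    proof -
      have "(norm (X k - h))\<^sup>2 \<le> (r / 2)\<^sup>2"
        unfolding norm_hardy_square
        by (rule suminf_le_const[OF norm_hardy_coeff_summable])
          (use M that in \<open>simp add: hardy_coeff_diff h\<close>)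
      then have "norm (X k - h) \<le> r / 2"
        by (rule power2_le_imp_le) (use r in simp)
      then show ?thesis using r by (simp add: dist_norm)
    qed
    then show "\<exists>M. \<forall>k\<ge>M. dist (X k) h < r" by blast
  qed
  then show ?thesis by (rule convergentI)
qed

instantiation hardy :: (complex_hilbert) complex_normed_vector
begin

lift_definition scaleC_hardy :: "complex \<Rightarrow> 'a hardy \<Rightarrow> 'a hardy" is "\<lambda>a h z. a *\<^sub>C h z"
  using square_summable_scaleC taylor_scaleC by fastforce

lemma hardy_coeff_scaleC: "hardy_coeff (a *\<^sub>C h :: 'a hardy) = (\<lambda>n. a *\<^sub>C hardy_coeff h n)"
  by (rule hardy_coeff_eqI) (simp add: scaleC_hardy.rep_eq taylor_scaleC hardy_coeff)

instance
proof
  fix a b :: complex and r :: real and h k :: "'a hardy"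
  show "a *\<^sub>C (h + k) = a *\<^sub>C h + a *\<^sub>C k" "(a + b) *\<^sub>C h = a *\<^sub>C h + b *\<^sub>C h"
    "a *\<^sub>C b *\<^sub>C h = (a * b) *\<^sub>C h" "r *\<^sub>R h = complex_of_real r *\<^sub>C h"
    by (simp_all add: hardy_coeff_inject[symmetric] hardy_coeff_add hardy_coeff_scaleC
        hardy_coeff_scaleR scaleR_scaleC scaleC_add_right scaleC_add_left scaleC_scaleC)
  show "norm (a *\<^sub>C h) = cmod a * norm h"
  proof (rule power2_eq_imp_eq)
    show "(norm (a *\<^sub>C h))\<^sup>2 = (cmod a * norm h)\<^sup>2"
      by (simp add: norm_hardy_square hardy_coeff_scaleC norm_scaleC power_mult_distrib suminf_mult
          norm_hardy_coeff_summable)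
  qed auto
qed

end

instantiation hardy :: (complex_hilbert) complex_hilbert
begin

definition cinner_hardy :: "'a hardy \<Rightarrow> 'a hardy \<Rightarrow> complex"
  where "cinner_hardy h k = (\<Sum>n. cinner (hardy_coeff h n) (hardy_coeff k n))"

instance
proof
  fix a :: complex and h k l :: "'a hardy" and X :: "nat \<Rightarrow> 'a hardy"
  show "cinner h k = cnj (cinner k h)"
  proof -
    have "(\<lambda>n. cnj (cinner (hardy_coeff k n) (hardy_coeff h n))) sums cnj (cinner k h)"
      unfolding cinner_hardy_def sums_cnj using cinner_summable[of k h] by (rule summable_sums)
    then show ?thesis
      by (simp add: cinner_hardy_def sums_iff flip: cinner_commute)
  qed
  show "cinner (h + k) l = cinner h l + cinner k l"
    by (simp add: cinner_hardy_def hardy_coeff_add cinner_add_left suminf_add cinner_summable)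
  show "cinner (a *\<^sub>C h) k = a * cinner h k"
    by (simp add: cinner_hardy_def hardy_coeff_scaleC cinner_scaleC_left suminf_mult cinner_summable)
  show "h \<bullet> k = Re (cinner h k)"
    using cinner_summable[of h k]
    by (simp add: inner_hardy_def cinner_hardy_def inner_eq_Re_cinner Re_suminf)
  show "Cauchy X \<Longrightarrow> convergent X"
    by (rule Cauchy_hardy_convergent)
qed

end

section \<open>The Schur class\<close>

text \<open>Only the values on the disc matter.  Analyticity is complex differentiability with respect to
  the operator norm.\<close>

definition schur :: "(complex \<Rightarrow> 'a::complex_hilbert \<Rightarrow>\<^sub>C\<^sub>L 'b::complex_hilbert) \<Rightarrow> bool"
  where "schur F \<longleftrightarrow>
    (\<forall>z\<in>\<bbbD>. contraction (F z)) \<and>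
    (\<forall>z\<in>\<bbbD>. \<exists>F'. (F has_derivative (\<lambda>w. w *\<^sub>C F')) (at z))"

text \<open>For a Schur function \<open>F\<close>, multiplication by \<open>F\<close> is a contraction from \<open>H\<^sup>2\<close> to \<open>H\<^sup>2\<close>, so
  that \<open>Hardy\<close> and \<open>CBlinfun\<close> are applied to elements of the defining sets of their types.\<close>

definition mult_op ::
  "(complex \<Rightarrow> 'a::complex_hilbert \<Rightarrow>\<^sub>C\<^sub>L 'b::complex_hilbert) \<Rightarrow> 'a hardy \<Rightarrow>\<^sub>C\<^sub>L 'b hardy"
  where "mult_op F =
    CBlinfun (\<lambda>h. Hardy (\<lambda>z. if z \<in> \<bbbD> then F z (hardy_fun h z) else 0))"

text \<open>A relation on the Schur class: membership of both functions is part of it.\<close>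

definition schur_prec ::
  "(complex \<Rightarrow> 'a::complex_hilbert \<Rightarrow>\<^sub>C\<^sub>L 'b::complex_hilbert) \<Rightarrow> (complex \<Rightarrow> 'a \<Rightarrow>\<^sub>C\<^sub>L 'b) \<Rightarrow> bool"
    (infix "\<prec>\<^sub>\<infinity>" 50)
  where "F \<prec>\<^sub>\<infinity> G \<longleftrightarrow> schur F \<and> schur G \<and> mult_op F \<prec> mult_op G"

definition schur_equiv ::
  "(complex \<Rightarrow> 'a::complex_hilbert \<Rightarrow>\<^sub>C\<^sub>L 'b::complex_hilbert) \<Rightarrow> (complex \<Rightarrow> 'a \<Rightarrow>\<^sub>C\<^sub>L 'b) \<Rightarrow> bool"
    (infix "\<sim>\<^sub>\<infinity>" 50)
  where "F \<sim>\<^sub>\<infinity> G \<longleftrightarrow> F \<prec>\<^sub>\<infinity> G \<and> G \<prec>\<^sub>\<infinity> F"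

text \<open>For Schur functions \<open>\<Phi>\<close> and \<open>F\<close> the inverse exists at every point of the disc if
  \<open>norm (block11 (\<Phi> 0) o\<^sub>C F 0) < 1\<close>; the Redheffer map is only considered under this condition.\<close>

definition redheffer ::
  "(complex \<Rightarrow> 'f::complex_hilbert \<times> 'u::complex_hilbert \<Rightarrow>\<^sub>C\<^sub>L 'e::complex_hilbert \<times> 'y::complex_hilbert) \<Rightarrow>
    (complex \<Rightarrow> 'e \<Rightarrow>\<^sub>C\<^sub>L 'f) \<Rightarrow> complex \<Rightarrow> 'u \<Rightarrow>\<^sub>C\<^sub>L 'y"
  where "redheffer \<Phi> F z =
    block22 (\<Phi> z) +
    block21 (\<Phi> z) o\<^sub>C F z o\<^sub>C cinverse (cblinfun_id - block11 (\<Phi> z) o\<^sub>C F z) o\<^sub>C block12 (\<Phi> z)"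

end

theory Submission
  imports Defs "HOL-Complex_Analysis.Complex_Analysis"
begin

text \<open>Write \<open>d(C, u) = norm u\<^sup>2 - norm (C u)\<^sup>2\<close> for the squared norm of the defect operator of a
  contraction \<open>C\<close> at \<open>u\<close>. By Douglas' factorization lemma \<open>A \<prec> B\<close> means that the square of the pairing
  of \<open>(A - B) u\<close> with \<open>v\<close> is at most a constant times \<open>d(B, u) d(B\<^sup>*, v)\<close> (\<open>op_prec_iff\<close>). If also
  \<open>B \<prec> A\<close>, all defects of \<open>A\<close> and \<open>B\<close> are comparable, and the two relations together are equivalent
  to a condition on \<open>a = A\<^sup>*\<close> and \<open>b = B\<^sup>*\<close> alone: with a constant \<open>K\<close>,
  \<open>norm ((a - b) f + b w)\<^sup>2 \<le> norm w\<^sup>2 + K d(a, f)\<close> for all \<open>f\<close> and \<open>w\<close>, and the same with \<open>a\<close> and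
  \<open>b\<close> exchanged (\<open>defect_dominated\<close>, \<open>op_prec_imp_defect_dominated\<close>, \<open>op_prec_of_defect_dominated\<close>).

  This form of the equivalence suits the Redheffer map. Although \<open>I - \<Phi>\<^sub>1\<^sub>1(z) F(z)\<close> is invertible at
  every point \<open>z\<close> of the disc, its inverse need not be bounded there, so that the feedback equation behind
  \<open>R = redheffer \<Phi> F\<close> cannot be solved in \<open>H\<^sup>2\<close>. The adjoint equation can be solved for the elements \<open>v\<close>
  of a dense subspace: the adjoint of a multiplication operator maps the kernel function at \<open>w\<close> with
  coefficient \<open>y\<close> to the kernel function at \<open>w\<close> with coefficient \<open>F(w)\<^sup>* y\<close>, and hence on kernel functions
  everything happens at one point. So for \<open>v\<close> in the span of the kernel functions there is an \<open>f\<close> such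
  that the adjoint of the multiplication operator of \<open>\<Phi>\<close> maps \<open>(T\<^sub>F\<^sup>* f, v)\<close> to \<open>(f, T\<^sub>R\<^sup>* v)\<close>
  (\<open>redheffer_solution\<close>). This adjoint is a contraction, and a linear combination of three such equations
  shows that the domination of \<open>T\<^sub>F\<^sup>*\<close> and \<open>T\<^sub>G\<^sup>*\<close> is inherited by the Redheffer transforms with the
  same constant (\<open>defect_dominated_redheffer\<close>).

  The condition at the origin is decided by the constant functions, on which the comparison of defects
  becomes one of the defects of \<open>F\<^sub>1(0)\<^sup>*\<close> and \<open>F\<^sub>2(0)\<^sup>*\<close> (\<open>schur_equiv_strict\<close>). That it implies
  invertibility at all points of the disc is a Schwarz-Pick type statement, for which the contractivity of
  multiplication operators is tested on two kernel functions (\<open>schur_strict_contraction\<close>). This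
  contractivity is obtained by comparing mean values over roots of unity
  (\<open>discrete_Parseval\<close>, \<open>taylor_coeffs_norm_mono\<close>).\<close>

section \<open>Bounded operators\<close>

lemma cinner_scaleC_right: "cinner x (c *\<^sub>C y) = cnj c * cinner x (y :: 'a::complex_hilbert)"
  by (metis cinner_commute cinner_scaleC_left complex_cnj_mult)

lemma inner_scaleC_left: "(c *\<^sub>C x) \<bullet> y = x \<bullet> (cnj c *\<^sub>C (y :: 'a::complex_hilbert))"
  by (simp add: inner_eq_Re_cinner cinner_scaleC_left cinner_scaleC_right)

lemma eq_if_inner_eq: "(\<And>z. x \<bullet> z = y \<bullet> (z :: 'a::real_inner)) \<Longrightarrow> x = y"
  by (metis inner_diff_left inner_eq_zero_iff right_minus_eq)

lemma cblinfun_bounded_linear: "bounded_linear (cblinfun_apply A)"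
  using cblinfun_apply[of A] by simp

lemma cblinfun_linear: "linear (cblinfun_apply A)"
  using cblinfun_bounded_linear by (rule bounded_linear.linear)

lemmas cblinfun_add = linear_add[OF cblinfun_linear]
  and cblinfun_diff = linear_diff[OF cblinfun_linear]
  and cblinfun_minus = linear_neg[OF cblinfun_linear]
  and cblinfun_zero = linear_0[OF cblinfun_linear]
  and cblinfun_scaleR = linear_scale[OF cblinfun_linear]

lemma cblinfun_scaleC: "cblinfun_apply A (c *\<^sub>C x) = c *\<^sub>C cblinfun_apply A x"
  using cblinfun_apply[of A] by simp

lemma cblinfun_continuous_on: "continuous_on S (cblinfun_apply A)"
  by (rule linear_continuous_on[OF cblinfun_bounded_linear])

lemma norm_cblinfun: "norm (cblinfun_apply A x) \<le> norm A * norm x"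
  unfolding norm_cblinfun.rep_eq by (rule onorm[OF cblinfun_bounded_linear])

lemma norm_cblinfun_bound:
  assumes "0 \<le> b" and "\<And>x. norm (cblinfun_apply A x) \<le> b * norm x"
  shows "norm A \<le> b"
  unfolding norm_cblinfun.rep_eq by (rule onorm_bound[OF assms])

lemma norm_cblinfun_bound_sqrt:
  assumes "0 \<le> c" and le: "\<And>x. (norm (cblinfun_apply A x))\<^sup>2 \<le> c * (norm x)\<^sup>2"
  shows "norm A \<le> sqrt c"
proof (rule norm_cblinfun_bound)
  fix x
  show "norm (A x) \<le> sqrt c * norm x"
    using real_sqrt_le_mono[OF le[of x]] by (simp add: real_sqrt_mult)
qed (use assms in simp)

lemma cblinfun_eqI: "(\<And>x. cblinfun_apply A x = cblinfun_apply B x) \<Longrightarrow> A = B"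
  by (simp add: cblinfun_apply_inject[symmetric] fun_eq_iff)

lemmas cblinfun_evals = plus_cblinfun.rep_eq minus_cblinfun.rep_eq uminus_cblinfun.rep_eq
  zero_cblinfun.rep_eq scaleR_cblinfun.rep_eq scaleC_cblinfun.rep_eq cblinfun_id.rep_eq
  cblinfun_compose.rep_eq

lemma contraction_iff: "contraction A \<longleftrightarrow> (\<forall>x. norm (cblinfun_apply A x) \<le> norm x)"
proof
  show "\<forall>x. norm (A x) \<le> norm x" if "contraction A"
    using that norm_cblinfun[of A] unfolding contraction_def
    by (metis mult_left_le_one_le mult.commute norm_ge_zero order_trans)
qed (auto simp: contraction_def intro: norm_cblinfun_bound)

lemma contraction_compose:
  assumes "contraction A" "contraction B"
  shows "contraction (A o\<^sub>C B)"
  unfolding contraction_iff cblinfun_compose.rep_eq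
proof
  fix x
  have "norm (A (B x)) \<le> norm (B x)" "norm (B x) \<le> norm x"
    using assms by (simp_all add: contraction_iff)
  then show "norm (A (B x)) \<le> norm x"
    by (rule order_trans)
qed

lemma contraction_block_maps:
  "contraction cbl_inl" "contraction cbl_inr" "contraction cbl_fst" "contraction cbl_snd"
  by (auto simp: contraction_iff cbl_inl.rep_eq cbl_inr.rep_eq cbl_fst.rep_eq cbl_snd.rep_eq
      norm_Pair1 norm_Pair2 norm_fst_le norm_snd_le)

lemma block_apply:
  "cblinfun_apply A (x, u) = (block11 A x + block12 A u, block21 A x + block22 A u)"
proof -
  have "cblinfun_apply A (x, u) = A (x, 0) + A (0, u)"
    by (simp flip: cblinfun_add)
  then show ?thesis
    by (simp add: block11_def block12_def block21_def block22_def cblinfun_evals cbl_inl.rep_eq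
        cbl_inr.rep_eq cbl_fst.rep_eq cbl_snd.rep_eq plus_prod_def)
qed

lemma norm_cblinfun_compose: "norm (A o\<^sub>C B) \<le> norm A * norm B"
proof (rule norm_cblinfun_bound)
  fix x
  have "norm (A (B x)) \<le> norm A * norm (B x)"
    by (rule norm_cblinfun)
  also have "\<dots> \<le> norm A * (norm B * norm x)"
    by (intro mult_left_mono norm_cblinfun) auto
  finally show "norm ((A o\<^sub>C B) x) \<le> norm A * norm B * norm x"
    by (simp add: cblinfun_evals mult.assoc)
qed simp

lemma bounded_bilinear_compose: "bounded_bilinear (o\<^sub>C)"
proof
  show "\<exists>K. \<forall>A B. norm (A o\<^sub>C B) \<le> norm A * norm B * K"
    by (intro exI[of _ 1]) (simp add: norm_cblinfun_compose)
qed (auto intro!: cblinfun_eqI simp: cblinfun_evals cblinfun_add cblinfun_scaleR)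

lemma bounded_linear_eval: "bounded_linear (\<lambda>A. cblinfun_apply A x)"
  by (rule bounded_linear_intro[where K = "norm x"])
    (simp_all add: cblinfun_evals norm_cblinfun)

lemmas tendsto_eval = bounded_linear.tendsto[OF bounded_linear_eval]

section \<open>Riesz representation and factorization\<close>

lemma quadratic_nonneg_imp_zero:
  fixes a \<delta> :: real
  assumes nonneg: "\<And>t. 0 \<le> t\<^sup>2 * a + 2 * t * \<delta>" and a: "0 \<le> a"
  shows "\<delta> = 0"
proof -
  have "(- \<delta> / (a + 1))\<^sup>2 * a + 2 * (- \<delta> / (a + 1)) * \<delta> = - (\<delta>\<^sup>2 * (a + 2)) / (a + 1)\<^sup>2"
    using a by (simp add: divide_simps power2_eq_square) (simp add: algebra_simps)
  with nonneg[of "- \<delta> / (a + 1)"] have "\<delta>\<^sup>2 * (a + 2) / (a + 1)\<^sup>2 \<le> 0"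
    by simp
  then have "\<delta>\<^sup>2 * (a + 2) \<le> 0"
    using a by (simp add: divide_le_0_iff)
  then show ?thesis
    using a by (simp add: mult_le_0_iff)
qed

lemma norm_add_scaleR_square:
  "(norm (x + t *\<^sub>R y))\<^sup>2 = (norm x)\<^sup>2 + t\<^sup>2 * (norm y)\<^sup>2 + 2 * t * (y \<bullet> (x :: 'a::real_inner))"
  unfolding power2_norm_eq_inner by (simp add: inner_simps inner_commute power2_eq_square)

text \<open>The Riesz representation theorem for a functional that is controlled by a linear map \<open>T\<close> on a
  subspace. For \<open>T\<close> the identity it is the usual theorem, and it gives the density of a subspace with
  trivial orthogonal complement; for a general \<open>T\<close> it is the source of all operator factorizations below.\<close>

lemma Riesz_factored:
  fixes T :: "'w::real_vector \<Rightarrow> 'h::{real_inner, complete_space}" and \<phi> :: "'w \<Rightarrow> real"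
  assumes V: "subspace V" and T: "linear T" and \<phi>: "linear \<phi>"
    and bound: "\<And>w. w \<in> V \<Longrightarrow> \<bar>\<phi> w\<bar> \<le> C * norm (T w)" and C: "0 \<le> C"
  obtains x where "x \<in> closure (T ` V)" "\<And>w. w \<in> V \<Longrightarrow> \<phi> w = T w \<bullet> x" "norm x \<le> C"
proof -
  \<comment> \<open>The quadratic functional whose minimiser over the range of \<open>T\<close> represents \<open>\<phi>\<close>.\<close>
  define J where "J w = (norm (T w))\<^sup>2 - 2 * \<phi> w" for w
  have "- (C\<^sup>2) \<le> J w" if "w \<in> V" for w
  proof -
    have "0 \<le> (norm (T w) - C)\<^sup>2" by simp
    then show ?thesis
      using bound[OF that] unfolding J_def power2_diff by (simp add: mult.commute)
  qed
  then have bdd: "bdd_below (J ` V)"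
    by (rule bdd_belowI2)
  define m where "m = (INF w\<in>V. J w)"
  have m_le: "m \<le> J w" if "w \<in> V" for w
    unfolding m_def by (rule cINF_lower[OF bdd that])
  have "V \<noteq> {}"
    using subspace_0[OF V] by blast
  have "\<exists>w\<in>V. J w < m + inverse (real (Suc n))" for n
  proof -
    have "(INF w\<in>V. J w) < m + inverse (real (Suc n))"
      unfolding m_def by simp
    then show ?thesis
      using cINF_less_iff[OF \<open>V \<noteq> {}\<close> bdd] by blast
  qed
  then obtain w where wV: "\<And>n. w n \<in> V" and w: "\<And>n. J (w n) < m + inverse (real (Suc n))"
    by metis
  have parallelogram: "(norm (T a - T b))\<^sup>2 \<le> 2 * (J a - m) + 2 * (J b - m)"
    if "a \<in> V" "b \<in> V" for a b
  proof -
    have "J ((1 / 2) *\<^sub>R (a + b)) = (norm (T a + T b))\<^sup>2 / 4 - (\<phi> a + \<phi> b)"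
      unfolding J_def linear_scale[OF T] linear_scale[OF \<phi>] linear_add[OF T] linear_add[OF \<phi>]
      by (simp add: power_divide) (simp add: field_simps)
    then have "4 * m \<le> (norm (T a + T b))\<^sup>2 - 4 * (\<phi> a + \<phi> b)"
      using m_le[OF subspace_scale[OF V subspace_add[OF V that]], of "1 / 2"] by simp
    moreover have "(norm (T a - T b))\<^sup>2 = 2 * (norm (T a))\<^sup>2 + 2 * (norm (T b))\<^sup>2 - (norm (T a + T b))\<^sup>2"
      by (simp add: power2_norm_eq_inner inner_simps inner_commute)
    ultimately show ?thesis
      unfolding J_def by simp
  qed
  have "Cauchy (\<lambda>n. T (w n))"
    unfolding Cauchy_def
  proof (intro allI impI)
    fix e :: real assume e: "e > 0"
    obtain M where M: "inverse (real (Suc M)) < e\<^sup>2 / 4"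
      using reals_Archimedean[of "e\<^sup>2 / 4"] e by auto
    have "dist (T (w a)) (T (w b)) < e" if "M \<le> a" "M \<le> b" for a b
    proof -
      have "inverse (real (Suc a)) \<le> inverse (real (Suc M))" "inverse (real (Suc b)) \<le> inverse (real (Suc M))"
        using that by simp_all
      then have "J (w a) - m < e\<^sup>2 / 4" "J (w b) - m < e\<^sup>2 / 4"
        using w[of a] w[of b] M by linarith+
      then have "2 * (J (w a) - m) + 2 * (J (w b) - m) < e\<^sup>2"
        by simp
      then have "(norm (T (w a) - T (w b)))\<^sup>2 < e\<^sup>2"
        by (rule order.strict_trans1[OF parallelogram[OF wV wV]])
      then show ?thesis
        unfolding dist_norm using e by (simp add: power2_less_imp_less)
    qed
    then show "\<exists>M. \<forall>a\<ge>M. \<forall>b\<ge>M. dist (T (w a)) (T (w b)) < e"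
      by blast
  qed
  then obtain x where x: "(\<lambda>n. T (w n)) \<longlonglongrightarrow> x"
    using Cauchy_convergent convergent_def by blast
  have in_closure: "x \<in> closure (T ` V)"
    unfolding closure_sequential by (intro exI[of _ "\<lambda>n. T (w n)"] conjI x) (simp add: wV)
  have eq: "\<phi> v = T v \<bullet> x" if v: "v \<in> V" for v
  proof -
    define \<delta> where "\<delta> = T v \<bullet> x - \<phi> v"
    \<comment> \<open>First variation of \<open>J\<close> at the limit of the minimising sequence.\<close>
    have variation: "0 \<le> t\<^sup>2 * (norm (T v))\<^sup>2 + 2 * t * \<delta>" for t
    proof (rule LIMSEQ_le_const)
      show "(\<lambda>n. inverse (real (Suc n)) + (t\<^sup>2 * (norm (T v))\<^sup>2 + 2 * t * (T v \<bullet> T (w n) - \<phi> v)))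
          \<longlonglongrightarrow> t\<^sup>2 * (norm (T v))\<^sup>2 + 2 * t * \<delta>"
        unfolding \<delta>_def
        by (rule tendsto_eq_intros LIMSEQ_inverse_real_of_nat x refl)+ simp
      have "0 \<le> inverse (real (Suc n)) + (t\<^sup>2 * (norm (T v))\<^sup>2 + 2 * t * (T v \<bullet> T (w n) - \<phi> v))" for n
      proof -
        have "J (w n + t *\<^sub>R v) = J (w n) + (t\<^sup>2 * (norm (T v))\<^sup>2 + 2 * t * (T v \<bullet> T (w n) - \<phi> v))"
          unfolding J_def linear_scale[OF T] linear_scale[OF \<phi>] linear_add[OF T] linear_add[OF \<phi>]
          by (simp add: norm_add_scaleR_square algebra_simps)
        then show ?thesis
          using m_le[OF subspace_add[OF V wV[of n] subspace_scale[OF V v, of t]]] w[of n] by linarith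
      qed
      then show "\<exists>N. \<forall>n\<ge>N. 0 \<le> inverse (real (Suc n)) + (t\<^sup>2 * (norm (T v))\<^sup>2 + 2 * t * (T v \<bullet> T (w n) - \<phi> v))"
        by blast
    qed
    have "\<delta> = 0"
      by (rule quadratic_nonneg_imp_zero[OF variation]) simp
    then show ?thesis by (simp add: \<delta>_def)
  qed
  have "closure (T ` V) \<subseteq> {p. \<bar>p \<bullet> x\<bar> \<le> C * norm p}"
  proof (rule closure_minimal)
    show "T ` V \<subseteq> {p. \<bar>p \<bullet> x\<bar> \<le> C * norm p}"
      using bound by (auto simp flip: eq)
    show "closed {p. \<bar>p \<bullet> x\<bar> \<le> C * norm p}"
      by (intro closed_Collect_le continuous_intros)
  qed
  then have "norm x * norm x \<le> C * norm x"
    using in_closure by (auto simp: norm_eq_sqrt_inner)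
  then have "norm x \<le> C"
    using C by (cases "x = 0") auto
  with in_closure eq show thesis by (rule that)
qed

lemma subspace_closure:
  fixes S :: "'a::real_normed_vector set"
  assumes S: "subspace S"
  shows "subspace (closure S)"
  unfolding subspace_def
proof (intro conjI ballI allI)
  show "0 \<in> closure S"
    using subspace_0[OF S] closure_subset by blast
  fix x assume x: "x \<in> closure S"
  then obtain f where f: "\<And>n. f n \<in> S" "f \<longlonglongrightarrow> x"
    unfolding closure_sequential by blast
  show "c *\<^sub>R x \<in> closure S" for c
    unfolding closure_sequential
    by (intro exI[of _ "\<lambda>n. c *\<^sub>R f n"] conjI allI subspace_scale[OF S] f tendsto_intros)
  fix y assume "y \<in> closure S"
  then obtain g where g: "\<And>n. g n \<in> S" "g \<longlonglongrightarrow> y"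
    unfolding closure_sequential by blast
  show "x + y \<in> closure S"
    unfolding closure_sequential
    by (intro exI[of _ "\<lambda>n. f n + g n"] conjI allI subspace_add[OF S] f g tendsto_intros)
qed

lemma closure_range_eqI:
  fixes T :: "'a::complex_normed_vector \<Rightarrow>\<^sub>C\<^sub>L 'c::complex_hilbert"
  assumes "x \<in> closure (range T)" "y \<in> closure (range T)" and eq: "\<And>v. x \<bullet> T v = y \<bullet> T v"
  shows "x = y"
proof -
  have "subspace (range T)"
    using linear_subspace_image[OF cblinfun_linear subspace_UNIV] .
  then have "x - y \<in> closure (range T)"
    using assms(1,2) by (intro subspace_diff subspace_closure)
  moreover have "closure (range T) \<subseteq> {p. (x - y) \<bullet> p = 0}"
    by (rule closure_minimal)
      (auto simp: inner_diff_left eq intro!: closed_Collect_eq continuous_intros)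
  ultimately have "(x - y) \<bullet> (x - y) = 0" by blast
  then show ?thesis by simp
qed

text \<open>Douglas' factorization lemma for forms. The Riesz vectors of the functionals \<open>\<beta> u\<close> can be chosen
  in the closure of the range of \<open>T\<close>, where they are unique; uniqueness makes them depend linearly on
  \<open>u\<close>. The form is real valued, and its compatibility with complex scalars is the hypothesis that
  replaces sesquilinearity.\<close>

lemma sesquilinear_factor:
  fixes \<beta> :: "'a::complex_hilbert \<Rightarrow> 'b::complex_hilbert \<Rightarrow> real"
    and T :: "'b \<Rightarrow>\<^sub>C\<^sub>L 'c::complex_hilbert"
  assumes linear: "\<And>u. linear (\<beta> u)" and add: "\<And>u u' v. \<beta> (u + u') v = \<beta> u v + \<beta> u' v"
    and scaleC: "\<And>c u v. \<beta> (c *\<^sub>C u) v = \<beta> u (cnj c *\<^sub>C v)"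
    and bound: "\<And>u v. \<bar>\<beta> u v\<bar> \<le> C u * norm (T v)" and C: "\<And>u. 0 \<le> C u" "\<And>u. C u \<le> K * norm u"
  obtains Y :: "'a \<Rightarrow>\<^sub>C\<^sub>L 'c"
  where "\<And>u. Y u \<in> closure (range T)" "\<And>u. norm (Y u) \<le> C u" "\<And>u v. \<beta> u v = Y u \<bullet> T v"
proof -
  have "\<exists>y. y \<in> closure (range T) \<and> (\<forall>v. \<beta> u v = y \<bullet> T v) \<and> norm y \<le> C u" for u
    using Riesz_factored[OF subspace_UNIV cblinfun_linear[of T] linear bound C(1), of u] by (metis UNIV_I inner_commute)
  then obtain Y where Y: "\<And>u. Y u \<in> closure (range T)" "\<And>u v. \<beta> u v = Y u \<bullet> T v"
    "\<And>u. norm (Y u) \<le> C u" by metis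
  have sub: "subspace (closure (range T))"
    using linear_subspace_image[OF cblinfun_linear subspace_UNIV] by (rule subspace_closure)
  have scaleC_closure: "c *\<^sub>C p \<in> closure (range T)" if "p \<in> closure (range T)" for c p
  proof -
    have "(\<lambda>p. c *\<^sub>C p) ` closure (range T) \<subseteq> closure (range T)"
      by (rule image_closure_subset)
        (auto simp: linear_continuous_on[OF bounded_linear_scaleC_right]
          simp flip: cblinfun_scaleC intro: subsetD[OF closure_subset])
    then show ?thesis using that by blast
  qed
  have Y_add: "Y (u + u') = Y u + Y u'" for u u'
    by (rule closure_range_eqI[of _ T]) (auto simp: Y(1) subspace_add[OF sub] inner_add_left add simp flip: Y(2))
  have Y_scaleC: "Y (c *\<^sub>C u) = c *\<^sub>C Y u" for c u
    by (rule closure_range_eqI[of _ T])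
      (auto simp: Y(1) scaleC_closure inner_scaleC_left scaleC simp flip: Y(2) cblinfun_scaleC)
  have "bounded_linear Y"
    by (rule bounded_linear_intro[where K = K])
      (auto simp: Y_add Y_scaleC scaleR_scaleC mult.commute[of _ K] intro: order_trans[OF Y(3) C(2)])
  then have "cblinfun_apply (CBlinfun Y) = Y"
    by (simp add: CBlinfun_inverse Y_scaleC)
  then show thesis
    using that[of "CBlinfun Y"] Y by simp
qed

section \<open>Adjoints\<close>

text \<open>Complex linearity turns an adjoint for the real inner product into one for the complex inner
  product, so that from here on the real inner product suffices.\<close>

lemma cinner_adjointI:
  fixes A :: "'a::complex_hilbert \<Rightarrow>\<^sub>C\<^sub>L 'b::complex_hilbert"
  assumes "\<And>x y. A x \<bullet> y = x \<bullet> cblinfun_apply B y"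
  shows "cinner (A x) y = cinner x (cblinfun_apply B y)"
  by (simp add: cinner_eq_Complex assms flip: cblinfun_scaleC)

lemma cadjoint_inner:
  fixes A :: "'a::complex_hilbert \<Rightarrow>\<^sub>C\<^sub>L 'b::complex_hilbert"
  shows "A x \<bullet> y = x \<bullet> cadjoint A y"
proof -
  have bound: "\<bar>y \<bullet> A x\<bar> \<le> (norm A * norm y) * norm (cblinfun_id x)" for x y
  proof -
    have "\<bar>y \<bullet> A x\<bar> \<le> norm y * norm (A x)" by (rule Cauchy_Schwarz_ineq2)
    also have "\<dots> \<le> norm y * (norm A * norm x)"
      by (intro mult_left_mono norm_cblinfun) auto
    finally show ?thesis by (simp add: cblinfun_evals algebra_simps)
  qed
  have linear: "linear (\<lambda>x. y \<bullet> A x)" for y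
    by (intro linearI) (auto simp: cblinfun_add cblinfun_scaleR inner_simps)
  obtain B where B: "\<And>y x. y \<bullet> A x = cblinfun_apply B y \<bullet> cblinfun_id x"
  proof (rule sesquilinear_factor[OF linear _ _ bound])
    show "(c *\<^sub>C y) \<bullet> A x = y \<bullet> A (cnj c *\<^sub>C x)" for c y x
      by (simp add: inner_scaleC_left cblinfun_scaleC)
  qed (auto simp: inner_add_left)
  have "cinner (A x) y = cinner x (B y)" for x y
    by (rule cinner_adjointI) (metis B cblinfun_id.rep_eq inner_commute)
  moreover have "B' = B" if "\<forall>x y. cinner (A x) y = cinner x (cblinfun_apply B' y)" for B'
  proof (rule cblinfun_eqI)
    fix y
    have "(B' y - B y) \<bullet> (B' y - B y) = 0"
      unfolding inner_diff_right
      by (simp add: inner_eq_Re_cinner flip: calculation that[rule_format])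
    then show "B' y = B y" by simp
  qed
  ultimately have "cadjoint A = B"
    unfolding cadjoint_def by (intro the_equality) auto
  then show ?thesis
    by (metis B cblinfun_id.rep_eq inner_commute)
qed

lemma cadjoint_inner': "x \<bullet> (A :: 'a::complex_hilbert \<Rightarrow>\<^sub>C\<^sub>L 'b::complex_hilbert) y = cadjoint A x \<bullet> y"
  by (metis cadjoint_inner inner_commute)

lemma cadjoint_cadjoint: "cadjoint (cadjoint A) = A"
  by (rule cblinfun_eqI, rule eq_if_inner_eq) (metis cadjoint_inner cadjoint_inner')

lemma norm_cadjoint_le:
  fixes A :: "'a::complex_hilbert \<Rightarrow>\<^sub>C\<^sub>L 'b::complex_hilbert"
  shows "norm (cadjoint A) \<le> norm A"
proof (rule norm_cblinfun_bound)
  fix y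
  have "(norm (cadjoint A y))\<^sup>2 = A (cadjoint A y) \<bullet> y"
    by (simp add: cadjoint_inner power2_norm_eq_inner)
  also have "\<dots> \<le> norm (A (cadjoint A y)) * norm y"
    by (rule norm_cauchy_schwarz)
  also have "\<dots> \<le> norm A * norm (cadjoint A y) * norm y"
    by (intro mult_right_mono norm_cblinfun) auto
  finally show "norm (cadjoint A y) \<le> norm A * norm y"
    by (cases "cadjoint A y = 0") (auto simp: power2_eq_square algebra_simps)
qed simp

lemma norm_cadjoint: "norm (cadjoint A) = norm (A :: 'a::complex_hilbert \<Rightarrow>\<^sub>C\<^sub>L 'b::complex_hilbert)"
  using norm_cadjoint_le[of A] norm_cadjoint_le[of "cadjoint A"] by (simp add: cadjoint_cadjoint)

lemma contraction_cadjoint: "contraction (cadjoint A) \<longleftrightarrow> contraction A"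
  by (simp add: contraction_def norm_cadjoint)

lemma cadjoint_compose: "cadjoint (A o\<^sub>C B) y = cadjoint B (cadjoint A y)"
  for A :: "'b::complex_hilbert \<Rightarrow>\<^sub>C\<^sub>L 'c::complex_hilbert" and B :: "'a::complex_hilbert \<Rightarrow>\<^sub>C\<^sub>L 'b"
proof (rule eq_if_inner_eq)
  fix x
  have "x \<bullet> cadjoint (A o\<^sub>C B) y = x \<bullet> cadjoint B (cadjoint A y)"
    unfolding cadjoint_inner[symmetric] cblinfun_compose.rep_eq ..
  then show "cadjoint (A o\<^sub>C B) y \<bullet> x = cadjoint B (cadjoint A y) \<bullet> x"
    by (simp only: inner_commute[of _ x])
qed

section \<open>Square roots of positive operators\<close>

text \<open>Completeness is inherited from the real linear bounded maps, since complex linearity passes to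
  limits.\<close>

instance cblinfun :: (complex_normed_vector, complex_hilbert) banach
proof
  fix X :: "nat \<Rightarrow> 'a \<Rightarrow>\<^sub>C\<^sub>L 'b"
  assume X: "Cauchy X"
  define B where "B n = Blinfun (cblinfun_apply (X n))" for n
  have B: "blinfun_apply (B n) = cblinfun_apply (X n)" for n
    unfolding B_def by (rule bounded_linear_Blinfun_apply[OF cblinfun_bounded_linear])
  have "dist (B m) (B n) = dist (X m) (X n)" for m n
    by (simp add: dist_norm norm_blinfun.rep_eq norm_cblinfun.rep_eq minus_blinfun.rep_eq
        minus_cblinfun.rep_eq B)
  with X have "Cauchy B"
    by (simp add: Cauchy_def)
  then obtain L where L: "B \<longlonglongrightarrow> L"
    using Cauchy_convergent convergent_def by blast
  have pointwise: "(\<lambda>n. cblinfun_apply (X n) x) \<longlonglongrightarrow> blinfun_apply L x" for x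
    using bounded_linear.tendsto[OF blinfun.bounded_linear_left L] by (simp add: B)
  have "blinfun_apply L (c *\<^sub>C x) = c *\<^sub>C blinfun_apply L x" for c x
    using pointwise[of "c *\<^sub>C x"]
      bounded_linear.tendsto[OF bounded_linear_scaleC_right pointwise[of x], of c]
    unfolding cblinfun_scaleC by (rule LIMSEQ_unique)
  then have apply_L: "cblinfun_apply (CBlinfun (blinfun_apply L)) = blinfun_apply L"
    by (simp add: CBlinfun_inverse blinfun.bounded_linear_right)
  have "dist (X n) (CBlinfun (blinfun_apply L)) = dist (B n) L" for n
    by (simp add: dist_norm norm_blinfun.rep_eq norm_cblinfun.rep_eq minus_blinfun.rep_eq
        minus_cblinfun.rep_eq B apply_L)
  with L[unfolded tendsto_dist_iff[of B]] have "X \<longlonglongrightarrow> CBlinfun (blinfun_apply L)"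
    by (subst tendsto_dist_iff) simp
  then show "convergent X"
    by (rule convergentI)
qed

interpretation compose: bounded_bilinear cblinfun_compose
  by (rule bounded_bilinear_compose)

lemma cblinfun_compose_assoc: "(A o\<^sub>C B) o\<^sub>C C = A o\<^sub>C (B o\<^sub>C C)"
  by (rule cblinfun_eqI) (simp add: cblinfun_evals)

lemma cblinfun_compose_eqD: "A o\<^sub>C B = C o\<^sub>C D \<Longrightarrow> A (cblinfun_apply B x) = C (cblinfun_apply D x)"
  by (metis cblinfun_compose.rep_eq)

lemma compose_id: "A o\<^sub>C cblinfun_id = A" "cblinfun_id o\<^sub>C A = A"
  by (rule cblinfun_eqI; simp add: cblinfun_evals)+

text \<open>Over the complex numbers a real quadratic form comes from a self-adjoint operator, by polarization.\<close>

lemma positive_op_selfadjoint: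
  assumes "positive_op T"
  shows "T x \<bullet> y = x \<bullet> T y"
proof -
  have real: "Im (cinner (T x) x) = 0" for x
    using assms by (simp add: positive_op_def complex_is_Real_iff)
  have skew: "Im (cinner (T x) y) + Im (cinner (T y) x) = 0" for x y
    using real[of "x + y"] real[of x] real[of y] cinner_commute[of "T x" "x + y"]
      cinner_commute[of "T y" "x + y"]
    by (simp add: cblinfun_add cinner_add_left cinner_commute[of "T x"] cinner_commute[of "T y"])
  show ?thesis
    using skew[of "\<i> *\<^sub>C x" y]
    by (simp add: cblinfun_scaleC cinner_scaleC_left cinner_scaleC_right inner_commute[of x]
        flip: inner_eq_Re_cinner)
qed

text \<open>The Cauchy-Schwarz inequality for the form of \<open>T\<close>, in its variational form.\<close>

lemma positive_op_kernel:
  assumes T: "positive_op T" and zero: "T x \<bullet> x = 0"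
  shows "T x = 0"
proof -
  have nonneg: "0 \<le> T y \<bullet> y" for y
    using T by (simp add: positive_op_def inner_eq_Re_cinner)
  have "T x \<bullet> T x = 0"
  proof (rule quadratic_nonneg_imp_zero)
    fix t
    have "T (x + t *\<^sub>R T x) \<bullet> (x + t *\<^sub>R T x) = t\<^sup>2 * (T (T x) \<bullet> T x) + 2 * t * (T x \<bullet> T x)"
      using zero positive_op_selfadjoint[OF T, of "T x" x]
      by (simp add: cblinfun_add cblinfun_scaleR inner_simps power2_eq_square algebra_simps)
    then show "0 \<le> t\<^sup>2 * (T (T x) \<bullet> T x) + 2 * t * (T x \<bullet> T x)"
      using nonneg[of "x + t *\<^sub>R T x"] by simp
  qed (rule nonneg)
  then show ?thesis by simp
qed

text \<open>The square root is a norm limit of polynomials in \<open>R\<close>, so it commutes with all operators that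
  commute with \<open>R\<close>; this is what its uniqueness rests on.\<close>

lemma square_root_exists:
  fixes R :: "'a::complex_hilbert \<Rightarrow>\<^sub>C\<^sub>L 'a"
  assumes selfadjoint: "\<And>x y. R x \<bullet> y = x \<bullet> R y" and R: "norm R \<le> 1"
  obtains S where "positive_op S" "S o\<^sub>C S = cblinfun_id - R" "\<And>T. T o\<^sub>C R = R o\<^sub>C T \<Longrightarrow> T o\<^sub>C S = S o\<^sub>C T"
proof -
  \<comment> \<open>The fixed point \<open>L\<close> of \<open>Y \<mapsto> (R + Y\<^sup>2) / 2\<close> satisfies \<open>(I - L)\<^sup>2 = I - R\<close>. The scalar
    iteration \<open>s\<close>, which is the same with \<open>1\<close> for \<open>R\<close>, majorises norms and increments.\<close>
  define Y where "Y = rec_nat 0 (\<lambda>_ Y. (1 / 2) *\<^sub>R (R + Y o\<^sub>C Y))"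
  define s where "s = rec_nat 0 (\<lambda>_ s. (1 + s\<^sup>2) / 2 :: real)"
  have Y: "Y 0 = 0" "Y (Suc n) = (1 / 2) *\<^sub>R (R + Y n o\<^sub>C Y n)" for n
    by (simp_all add: Y_def)
  have s: "s 0 = 0" "s (Suc n) = (1 + (s n)\<^sup>2) / 2" for n
    by (simp_all add: s_def)
  have commute: "T o\<^sub>C Y n = Y n o\<^sub>C T" if "T o\<^sub>C R = R o\<^sub>C T" for T n
  proof (induction n)
    case (Suc n)
    have "T o\<^sub>C (Y n o\<^sub>C Y n) = Y n o\<^sub>C Y n o\<^sub>C T"
      by (metis Suc cblinfun_compose_assoc)
    then show ?case
      by (simp add: Y compose.add_left compose.add_right compose.scaleR_left compose.scaleR_right that)
  qed (simp add: Y compose.zero_left compose.zero_right)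
  have commute': "Y m o\<^sub>C Y n = Y n o\<^sub>C Y m" for m n
    by (rule commute) (rule commute[symmetric], rule refl)
  have s_bounds: "0 \<le> s n \<and> s n \<le> 1" for n
    by (induction n) (auto simp: s power_le_one)
  have Y_le: "norm (Y n) \<le> s n" for n
  proof (induction n)
    case (Suc n)
    have "norm (R + Y n o\<^sub>C Y n) \<le> norm R + norm (Y n) * norm (Y n)"
      by (rule order_trans[OF norm_triangle_ineq]) (simp add: norm_cblinfun_compose)
    also have "\<dots> \<le> 1 + (s n)\<^sup>2"
      unfolding power2_eq_square using Suc s_bounds by (intro add_mono R mult_mono) auto
    finally show ?case by (simp add: Y s)
  qed (simp add: Y s)
  have step: "norm (Y (Suc n) - Y n) \<le> s (Suc n) - s n" for n
  proof (induction n)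
    case 0
    show ?case using R by (simp add: Y s compose.zero_left)
  next
    case (Suc n)
    have "Y (Suc (Suc n)) - Y (Suc n) = (1 / 2) *\<^sub>R (Y (Suc n) o\<^sub>C Y (Suc n) - Y n o\<^sub>C Y n)"
      by (rule trans[OF arg_cong2[where f = minus, OF Y(2)[of "Suc n"] Y(2)[of n]]])
        (simp flip: scaleR_diff_right)
    also have "Y (Suc n) o\<^sub>C Y (Suc n) - Y n o\<^sub>C Y n = (Y (Suc n) + Y n) o\<^sub>C (Y (Suc n) - Y n)"
      using commute'[of "Suc n" n] by (simp add: compose.add_left compose.diff_right)
    finally have step_eq: "Y (Suc (Suc n)) - Y (Suc n)
        = (1 / 2) *\<^sub>R ((Y (Suc n) + Y n) o\<^sub>C (Y (Suc n) - Y n))" .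
    have "norm (Y (Suc (Suc n)) - Y (Suc n)) \<le> norm (Y (Suc n) + Y n) * norm (Y (Suc n) - Y n) / 2"
      unfolding step_eq by (simp add: norm_cblinfun_compose)
    also have "\<dots> \<le> (s (Suc n) + s n) * (s (Suc n) - s n) / 2"
    proof (intro divide_right_mono mult_mono)
      show "norm (Y (Suc n) + Y n) \<le> s (Suc n) + s n"
        using norm_triangle_ineq[of "Y (Suc n)" "Y n"] Y_le[of n] Y_le[of "Suc n"] by linarith
    qed (use Suc s_bounds in auto)
    also have "\<dots> = s (Suc (Suc n)) - s (Suc n)"
      by (simp add: s(2)[of "Suc n"]) (simp add: s(2)[of n] power2_eq_square field_simps)
    finally show ?case .
  qed
  have dist_le: "norm (Y (n + k) - Y n) \<le> s (n + k) - s n" for n k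
  proof (induction k)
    case (Suc k)
    then show ?case
      using step[of "n + k"] norm_triangle_ineq[of "Y (Suc (n + k)) - Y (n + k)" "Y (n + k) - Y n"]
      by simp
  qed simp
  have "incseq s"
  proof (rule incseq_SucI)
    show "s n \<le> s (Suc n)" for n
      using order_trans[OF norm_ge_zero step[of n]] by simp
  qed
  then have "Cauchy s"
    by (rule incseq_convergent[of s 1, THEN exE]) (use s_bounds in \<open>auto intro: LIMSEQ_imp_Cauchy\<close>)
  have "Cauchy Y"
  proof (rule metric_CauchyI)
    fix e :: real assume "e > 0"
    then obtain M where M: "\<And>m n. m \<ge> M \<Longrightarrow> n \<ge> M \<Longrightarrow> dist (s m) (s n) < e"
      using \<open>Cauchy s\<close> unfolding Cauchy_def by blast
    have less: "dist (Y m) (Y n) < e" if "n \<ge> M" "m \<ge> n" for m n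
      using dist_le[of n "m - n"] M[of m n] that by (simp add: dist_norm)
    have "dist (Y m) (Y n) < e" if "m \<ge> M" "n \<ge> M" for m n
      using less[of m n] less[of n m] that by (cases "m \<ge> n") (auto simp: dist_commute)
    then show "\<exists>M. \<forall>m\<ge>M. \<forall>n\<ge>M. dist (Y m) (Y n) < e"
      by blast
  qed
  then obtain L where L: "Y \<longlonglongrightarrow> L"
    using Cauchy_convergent convergent_def by blast
  have "(\<lambda>n. Y (Suc n)) \<longlonglongrightarrow> (1 / 2) *\<^sub>R (R + L o\<^sub>C L)"
    unfolding Y by (intro tendsto_intros compose.tendsto L)
  from LIMSEQ_unique[OF LIMSEQ_Suc[OF L] this] have fixed: "L = (1 / 2) *\<^sub>R (R + L o\<^sub>C L)" .
  have L_le: "norm L \<le> 1"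
  proof (rule LIMSEQ_le_const2[OF tendsto_norm[OF L]])
    have "norm (Y n) \<le> 1" for n
      using Y_le[of n] s_bounds[of n] by linarith
    then show "\<exists>N. \<forall>n\<ge>N. norm (Y n) \<le> 1"
      by blast
  qed
  have Y_selfadjoint: "Y n x \<bullet> y = x \<bullet> Y n y" for n x y
    by (induction n arbitrary: x y) (auto simp: Y cblinfun_evals inner_simps selfadjoint)
  have L_selfadjoint: "L x \<bullet> y = x \<bullet> L y" for x y
  proof (rule LIMSEQ_unique)
    show "(\<lambda>n. Y n x \<bullet> y) \<longlonglongrightarrow> L x \<bullet> y"
      by (intro tendsto_inner tendsto_eval[OF L] tendsto_const)
    show "(\<lambda>n. Y n x \<bullet> y) \<longlonglongrightarrow> x \<bullet> L y"
      unfolding Y_selfadjoint by (intro tendsto_inner tendsto_eval[OF L] tendsto_const)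
  qed
  define S where "S = cblinfun_id - L"
  have S_selfadjoint: "S x \<bullet> y = x \<bullet> S y" for x y
    by (simp add: S_def cblinfun_evals inner_simps L_selfadjoint)
  show thesis
  proof (rule that)
    show "positive_op S"
      unfolding positive_op_def
    proof
      fix x
      have real: "cinner (S x) x \<in> \<real>"
        by (metis Reals_cnj_iff cinner_adjointI[OF S_selfadjoint] cinner_commute)
      have "norm (L x) * norm x \<le> norm x * norm x"
        using L_le by (intro mult_right_mono) (auto simp: contraction_iff[symmetric] contraction_def
          intro: contraction_iff[THEN iffD1, rule_format])
      then have "L x \<bullet> x \<le> x \<bullet> x"
        using norm_cauchy_schwarz[of "L x" x] by (simp add: power2_norm_eq_inner[symmetric] power2_eq_square)
      then have "0 \<le> S x \<bullet> x"
        by (simp add: S_def cblinfun_evals inner_simps)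
      with real show "cinner (S x) x \<in> \<real> \<and> 0 \<le> Re (cinner (S x) x)"
        by (simp add: inner_eq_Re_cinner)
    qed
    have "2 *\<^sub>R L = 2 *\<^sub>R ((1 / 2) *\<^sub>R (R + L o\<^sub>C L))"
      by (rule arg_cong[OF fixed])
    also have "\<dots> = R + L o\<^sub>C L"
      by simp
    finally have R_eq: "R = L + L - L o\<^sub>C L"
      by (simp only: scaleR_2 eq_diff_eq)
    show "S o\<^sub>C S = cblinfun_id - R"
      unfolding R_eq S_def by (simp add: compose.diff_left compose.diff_right compose_id)
    show "T o\<^sub>C S = S o\<^sub>C T" if "T o\<^sub>C R = R o\<^sub>C T" for T
    proof -
      have "(\<lambda>n. T o\<^sub>C Y n) \<longlonglongrightarrow> T o\<^sub>C L" "(\<lambda>n. T o\<^sub>C Y n) \<longlonglongrightarrow> L o\<^sub>C T"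
        using compose.tendsto[OF tendsto_const L, of T] compose.tendsto[OF L tendsto_const, of T]
        by (simp_all add: commute[OF that])
      then have "T o\<^sub>C L = L o\<^sub>C T"
        by (rule LIMSEQ_unique)
      then show ?thesis
        by (simp add: S_def compose.diff_left compose.diff_right compose_id)
    qed
  qed
qed

text \<open>A second positive root \<open>T\<close> commutes with \<open>T\<^sup>2 = I - R\<close>, hence with the root constructed above.\<close>

lemma op_sqrt_id_minus:
  fixes R :: "'a::complex_hilbert \<Rightarrow>\<^sub>C\<^sub>L 'a"
  assumes selfadjoint: "\<And>x y. R x \<bullet> y = x \<bullet> R y" and R: "norm R \<le> 1"
  shows "positive_op (op_sqrt (cblinfun_id - R))"
    and "op_sqrt (cblinfun_id - R) o\<^sub>C op_sqrt (cblinfun_id - R) = cblinfun_id - R"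
proof -
  obtain S where S: "positive_op S" "S o\<^sub>C S = cblinfun_id - R"
    and commute: "\<And>T. T o\<^sub>C R = R o\<^sub>C T \<Longrightarrow> T o\<^sub>C S = S o\<^sub>C T"
    by (rule square_root_exists[OF assms]) (rule that; assumption)
  have unique: "T = S" if T: "positive_op T" "T o\<^sub>C T = cblinfun_id - R" for T
  proof (rule cblinfun_eqI)
    fix x
    have R_eq: "R = cblinfun_id - T o\<^sub>C T"
      using T by simp
    have "T o\<^sub>C R = R o\<^sub>C T"
      unfolding R_eq by (simp add: compose.diff_left compose.diff_right compose_id cblinfun_compose_assoc)
    then have TS: "T (S y) = S (T y)" for y
      by (rule cblinfun_compose_eqD[OF commute])
    have square: "T (T y) = S (S y)" for y
      by (rule cblinfun_compose_eqD) (simp add: S(2) T(2))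
    \<comment> \<open>\<open>S + T\<close> kills the range of \<open>S - T\<close>, so the two nonnegative forms add up to zero there.\<close>
    define u where "u = S x - T x"
    have "S u + T u = 0"
      by (simp add: u_def cblinfun_diff TS square)
    then have "S u \<bullet> u + T u \<bullet> u = 0"
      by (simp flip: inner_add_left)
    moreover have "0 \<le> S u \<bullet> u" "0 \<le> T u \<bullet> u"
      using S(1) T(1) by (auto simp: positive_op_def inner_eq_Re_cinner)
    ultimately have "S u = 0" "T u = 0"
      using positive_op_kernel[OF S(1)] positive_op_kernel[OF T(1)] by auto
    then have "u \<bullet> u = 0"
      using positive_op_selfadjoint[OF S(1), of x u] positive_op_selfadjoint[OF T(1), of x u]
      by (simp add: u_def inner_diff_left)
    then show "T x = S x"
      by (simp add: u_def)
  qed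
  have sqrt: "op_sqrt (cblinfun_id - R) = S"
    unfolding op_sqrt_def
  proof (rule the_equality)
    show "positive_op S \<and> S o\<^sub>C S = cblinfun_id - R"
      using S by (rule conjI)
    show "T = S" if "positive_op T \<and> T o\<^sub>C T = cblinfun_id - R" for T
      using that by (elim conjE) (rule unique)
  qed
  show "positive_op (op_sqrt (cblinfun_id - R))"
    and "op_sqrt (cblinfun_id - R) o\<^sub>C op_sqrt (cblinfun_id - R) = cblinfun_id - R"
    unfolding sqrt by (fact S)+
qed

section \<open>Defects and the pre-order\<close>

text \<open>For a contraction \<open>C\<close> this is the square of the norm of the defect operator at \<open>u\<close>. Once the
  pre-order is expressed through it, operator square roots disappear from the argument.\<close>

definition defect_sq :: "'a::complex_hilbert \<Rightarrow>\<^sub>C\<^sub>L 'b::complex_hilbert \<Rightarrow> 'a \<Rightarrow> real"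
  where "defect_sq C u = (norm u)\<^sup>2 - (norm (C u))\<^sup>2"

lemma defect_sq_nonneg: "contraction C \<Longrightarrow> 0 \<le> defect_sq C u"
  by (simp add: defect_sq_def contraction_iff)

lemma defect_operator:
  assumes "contraction C"
  shows defect_selfadjoint: "defect C u \<bullet> v = u \<bullet> defect C v"
    and norm_defect: "(norm (defect C u))\<^sup>2 = defect_sq C u"
proof -
  define R where "R = cadjoint C o\<^sub>C C"
  have selfadjoint: "R x \<bullet> y = x \<bullet> R y" for x y
    by (simp add: R_def cblinfun_evals cadjoint_inner cadjoint_cadjoint)
  have "norm R \<le> 1 * 1"
    unfolding R_def using assms contraction_cadjoint[of C]
    by (intro order_trans[OF norm_cblinfun_compose] mult_mono) (auto simp: contraction_def)
  then have sqrt: "positive_op (defect C)" "defect C o\<^sub>C defect C = cblinfun_id - R"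
    using op_sqrt_id_minus[OF selfadjoint] by (simp_all add: defect_def R_def)
  show sa: "defect C u \<bullet> v = u \<bullet> defect C v" for u v
    by (rule positive_op_selfadjoint[OF sqrt(1)])
  have "(norm (defect C u))\<^sup>2 = u \<bullet> (defect C o\<^sub>C defect C) u"
    by (simp add: power2_norm_eq_inner cblinfun_evals) (simp add: sa)
  also have "\<dots> = defect_sq C u"
    unfolding sqrt(2) R_def
    by (simp add: cblinfun_evals inner_diff_right defect_sq_def power2_norm_eq_inner flip: cadjoint_inner)
  finally show "(norm (defect C u))\<^sup>2 = defect_sq C u" .
qed

text \<open>The pre-order as a bound on a sesquilinear form. A bounded factor \<open>X\<close> gives the bound at once.
  Conversely the bound lets both defect operators be factored out by Douglas' lemma.\<close>

lemma op_prec_iff_defect_bound: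
  fixes A B :: "'a::complex_hilbert \<Rightarrow>\<^sub>C\<^sub>L 'b::complex_hilbert"
  assumes A: "contraction A" and B: "contraction B"
  shows "A \<prec> B \<longleftrightarrow>
    (\<exists>K\<ge>0. \<forall>u v. \<bar>(A u - B u) \<bullet> v\<bar> \<le> K * norm (defect B u) * norm (defect (cadjoint B) v))"
    (is "_ \<longleftrightarrow> ?rhs")
proof
  assume "A \<prec> B"
  then obtain X where X: "bounded_clinear_on (defect_space B) (defect_space (cadjoint B)) X"
    and AB: "\<And>u. (A - B) u = defect (cadjoint B) (X (defect B u))"
    unfolding op_prec_def by blast
  obtain K where K: "\<And>x. x \<in> defect_space B \<Longrightarrow> norm (X x) \<le> K * norm x"
    using X unfolding bounded_clinear_on_def by blast
  have "\<bar>(A u - B u) \<bullet> v\<bar> \<le> \<bar>K\<bar> * norm (defect B u) * norm (defect (cadjoint B) v)" for u v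
  proof -
    have "defect B u \<in> defect_space B"
      unfolding defect_space_def by (intro subsetD[OF closure_subset]) simp
    then have "norm (X (defect B u)) \<le> \<bar>K\<bar> * norm (defect B u)"
      using K by (meson abs_ge_self mult_right_mono norm_ge_zero order_trans)
    moreover have "(A u - B u) \<bullet> v = X (defect B u) \<bullet> defect (cadjoint B) v"
      using AB[of u] defect_selfadjoint[of "cadjoint B"] B
      by (simp add: cblinfun_evals contraction_cadjoint)
    moreover have "\<bar>X (defect B u) \<bullet> defect (cadjoint B) v\<bar>
        \<le> norm (X (defect B u)) * norm (defect (cadjoint B) v)"
      by (rule Cauchy_Schwarz_ineq2)
    ultimately show ?thesis
      using mult_right_mono[OF _ norm_ge_zero] order_trans by (metis (no_types))
  qed
  then show ?rhs using abs_ge_zero by blast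
next
  assume ?rhs
  then obtain K where "K \<ge> 0"
    and K: "\<And>u v. \<bar>(A u - B u) \<bullet> v\<bar> \<le> (K * norm (defect B u)) * norm (defect (cadjoint B) v)"
    by blast
  define S where "S = defect B"
  define T where "T = defect (cadjoint B)"
  have S_le: "norm (S u) \<le> norm u" for u
  proof (rule power2_le_imp_le)
    show "(norm (S u))\<^sup>2 \<le> (norm u)\<^sup>2"
      by (simp add: S_def norm_defect[OF B] defect_sq_def)
  qed simp
  have linear: "linear (\<lambda>v. (A u - B u) \<bullet> v)" for u
    by (rule bounded_linear.linear) (rule bounded_linear_inner_right)
  \<comment> \<open>Factor out the right defect operator, then the left one from the adjoint of the result.\<close>
  obtain Y :: "'a \<Rightarrow>\<^sub>C\<^sub>L 'b" where Y_closure: "\<And>u. Y u \<in> closure (range T)"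
    and Y_le: "\<And>u. norm (Y u) \<le> K * norm (S u)"
    and Y: "\<And>u v. (A u - B u) \<bullet> v = Y u \<bullet> T v"
  proof (rule sesquilinear_factor[OF linear _ _ K])
    show "(A (u + u') - B (u + u')) \<bullet> v = (A u - B u) \<bullet> v + (A u' - B u') \<bullet> v" for u u' v
      by (simp add: cblinfun_add inner_simps)
    show "(A (c *\<^sub>C u) - B (c *\<^sub>C u)) \<bullet> v = (A u - B u) \<bullet> (cnj c *\<^sub>C v)" for c u v
      by (simp add: cblinfun_scaleC inner_scaleC_left flip: scaleC_diff_right)
    show "K * norm (defect B u) \<le> K * norm u" for u
      using S_le \<open>K \<ge> 0\<close> by (simp add: S_def mult_left_mono)
  qed (use \<open>K \<ge> 0\<close> in \<open>auto simp: S_def T_def\<close>)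
  have linear': "linear (\<lambda>u. p \<bullet> Y u)" for p
    by (intro linearI) (auto simp: cblinfun_add cblinfun_scaleR inner_simps)
  have bound': "\<bar>p \<bullet> Y u\<bar> \<le> (K * norm p) * norm (S u)" for p u
  proof -
    have "\<bar>p \<bullet> Y u\<bar> \<le> norm p * (K * norm (S u))"
      by (rule order_trans[OF Cauchy_Schwarz_ineq2]) (intro mult_left_mono Y_le norm_ge_zero)
    then show ?thesis by (simp add: algebra_simps)
  qed
  obtain Z :: "'b \<Rightarrow>\<^sub>C\<^sub>L 'a" where Z: "\<And>p u. p \<bullet> Y u = Z p \<bullet> S u"
  proof (rule sesquilinear_factor[OF linear' _ _ bound'])
    show "(c *\<^sub>C p) \<bullet> Y u = p \<bullet> Y (cnj c *\<^sub>C u)" for c p u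
      by (simp add: cblinfun_scaleC inner_scaleC_left)
    show "K * norm p \<le> K * norm p" for p :: 'b ..
  qed (use \<open>K \<ge> 0\<close> in \<open>auto simp: inner_simps\<close>)
  define X where "X = cadjoint Z"
  have XS: "X (S u) = Y u" for u
    by (rule eq_if_inner_eq) (metis X_def Z cadjoint_inner inner_commute)
  have "cblinfun_apply X ` closure (range S) \<subseteq> closure (range T)"
    by (rule image_closure_subset) (auto simp: cblinfun_continuous_on XS Y_closure)
  then have "bounded_clinear_on (defect_space B) (defect_space (cadjoint B)) X"
    unfolding bounded_clinear_on_def defect_space_def S_def T_def
    by (auto simp: cblinfun_add cblinfun_scaleC intro: norm_cblinfun)
  moreover have "(A - B) u = defect (cadjoint B) (X (defect B u))" for u
  proof (rule eq_if_inner_eq)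
    fix v
    have "contraction (cadjoint B)"
      using B by (simp add: contraction_cadjoint)
    then show "(A - B) u \<bullet> v = defect (cadjoint B) (X (defect B u)) \<bullet> v"
      using Y[of u v] XS[of u] by (simp only: S_def T_def cblinfun_evals defect_selfadjoint)
  qed
  ultimately show "A \<prec> B"
    unfolding op_prec_def using A B by blast
qed

lemma op_prec_iff:
  fixes A B :: "'a::complex_hilbert \<Rightarrow>\<^sub>C\<^sub>L 'b::complex_hilbert"
  assumes A: "contraction A" and B: "contraction B"
  shows "A \<prec> B \<longleftrightarrow>
    (\<exists>K\<ge>0. \<forall>u v. ((A u - B u) \<bullet> v)\<^sup>2 \<le> K * defect_sq B u * defect_sq (cadjoint B) v)"
    (is "_ \<longleftrightarrow> (\<exists>K\<ge>0. ?P K)")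
proof -
  have B': "contraction (cadjoint B)"
    using B by (simp add: contraction_cadjoint)
  have iff: "\<bar>(A u - B u) \<bullet> v\<bar> \<le> K * norm (defect B u) * norm (defect (cadjoint B) v) \<longleftrightarrow>
      ((A u - B u) \<bullet> v)\<^sup>2 \<le> K\<^sup>2 * defect_sq B u * defect_sq (cadjoint B) v" if "K \<ge> 0" for K u v
  proof -
    have "\<bar>(A u - B u) \<bullet> v\<bar> \<le> K * norm (defect B u) * norm (defect (cadjoint B) v) \<longleftrightarrow>
        \<bar>(A u - B u) \<bullet> v\<bar>\<^sup>2 \<le> (K * norm (defect B u) * norm (defect (cadjoint B) v))\<^sup>2"
      using that by (simp add: power2_le_iff_abs_le)
    then show ?thesis
      by (simp add: power_mult_distrib norm_defect B B')
  qed
  show ?thesis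
    unfolding op_prec_iff_defect_bound[OF assms]
  proof
    assume "\<exists>K\<ge>0. \<forall>u v. \<bar>(A u - B u) \<bullet> v\<bar> \<le> K * norm (defect B u) * norm (defect (cadjoint B) v)"
    then obtain K where "K \<ge> 0" "?P (K\<^sup>2)"
      using iff by blast
    then show "\<exists>K\<ge>0. ?P K"
      by (intro exI[of _ "K\<^sup>2"]) simp
  next
    assume "\<exists>K\<ge>0. ?P K"
    then obtain K where K: "K \<ge> 0" "?P K"
      by blast
    then have "?P ((sqrt K)\<^sup>2)"
      by simp
    then have "\<forall>u v. \<bar>(A u - B u) \<bullet> v\<bar> \<le> sqrt K * norm (defect B u) * norm (defect (cadjoint B) v)"
      using iff[of "sqrt K"] K(1) by simp
    then show "\<exists>K\<ge>0. \<forall>u v. \<bar>(A u - B u) \<bullet> v\<bar> \<le> K * norm (defect B u) * norm (defect (cadjoint B) v)"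
      using K(1) real_sqrt_ge_zero by blast
  qed
qed

section \<open>Equivalence as mutual domination\<close>

lemma defect_sq_cadjoint_apply:
  fixes C :: "'a::complex_hilbert \<Rightarrow>\<^sub>C\<^sub>L 'b::complex_hilbert"
  shows "defect_sq (cadjoint C) (C u) \<le> defect_sq C u"
proof -
  have "(norm (C u))\<^sup>2 = u \<bullet> cadjoint C (C u)"
    by (simp add: power2_norm_eq_inner cadjoint_inner)
  also have "\<dots> \<le> norm u * norm (cadjoint C (C u))"
    by (rule norm_cauchy_schwarz)
  finally show ?thesis
    using zero_le_power2[of "norm u - norm (cadjoint C (C u))"]
    by (simp add: defect_sq_def power2_diff)
qed

text \<open>\<open>A \<prec> B\<close> bounds the defects of \<open>A\<close> by those of \<open>B\<close>.\<close>

lemma defect_sq_le_of_prec: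
  fixes A B :: "'a::complex_hilbert \<Rightarrow>\<^sub>C\<^sub>L 'b::complex_hilbert"
  assumes B: "contraction B" and K: "K \<ge> 0"
    and bound: "\<And>u v. ((A u - B u) \<bullet> v)\<^sup>2 \<le> K * defect_sq B u * defect_sq (cadjoint B) v"
  shows "defect_sq A u \<le> (1 + 2 * sqrt K) * defect_sq B u"
proof -
  have nonneg: "0 \<le> defect_sq B u"
    by (rule defect_sq_nonneg[OF B])
  \<comment> \<open>The test vector \<open>v = B u\<close> is the one for which \<open>B\<^sup>*\<close> has a small defect.\<close>
  have "((A u - B u) \<bullet> B u)\<^sup>2 \<le> K * defect_sq B u * defect_sq B u"
    using bound[of u "B u"] mult_left_mono[OF defect_sq_cadjoint_apply[of B u], of "K * defect_sq B u"]
      K nonneg by simp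
  also have "\<dots> = (sqrt K * defect_sq B u)\<^sup>2"
    using K by (simp add: power_mult_distrib power2_eq_square)
  finally have "\<bar>(A u - B u) \<bullet> B u\<bar> \<le> sqrt K * defect_sq B u"
    using K nonneg by (simp add: power2_le_iff_abs_le)
  moreover have "defect_sq A u - defect_sq B u = - 2 * ((A u - B u) \<bullet> B u) - (norm (A u - B u))\<^sup>2"
    unfolding defect_sq_def power2_norm_eq_inner by (simp add: inner_simps inner_commute)
  ultimately show ?thesis
    using zero_le_power2[of "norm (A u - B u)"] unfolding distrib_right mult_1_left mult.assoc
    by linarith
qed

text \<open>The same conclusion when the bound involves the defect of \<open>A\<^sup>*\<close> in place of that of \<open>B\<^sup>*\<close>. This is how
  the mixed bounds that survive the passage through the Redheffer map are turned back into the pre-order.\<close>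

lemma defect_sq_le_of_mixed:
  fixes A B :: "'a::complex_hilbert \<Rightarrow>\<^sub>C\<^sub>L 'b::complex_hilbert"
  assumes A: "contraction A" and B: "contraction B" and K: "K \<ge> 0"
    and bound: "\<And>u v. ((A u - B u) \<bullet> v)\<^sup>2 \<le> K * defect_sq B u * defect_sq (cadjoint A) v"
  shows "defect_sq A u \<le> (2 + 6 * K) * defect_sq B u"
proof -
  define a b d where "a = defect_sq A u" and "b = defect_sq B u" and "d = A u - B u"
  have nonneg: "0 \<le> a" "0 \<le> b"
    using A B by (simp_all add: a_def b_def defect_sq_nonneg)
  \<comment> \<open>Both test vectors \<open>v = A u\<close> and \<open>v = d\<close> are needed; the term \<open>a\<close> that reappears on the
    right is absorbed by the inequality between the arithmetic and the geometric mean.\<close>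
  have "(d \<bullet> A u)\<^sup>2 \<le> K * b * a"
    using bound[of u "A u"] mult_left_mono[OF defect_sq_cadjoint_apply[of A u], of "K * b"] K nonneg
    by (simp add: a_def b_def d_def)
  also have "\<dots> \<le> (K * b + a / 4)\<^sup>2"
    using zero_le_power2[of "K * b - a / 4"] by (simp add: power2_eq_square algebra_simps)
  finally have pairing: "\<bar>d \<bullet> A u\<bar> \<le> K * b + a / 4"
    using K nonneg by (simp add: power2_le_iff_abs_le)
  have "((norm d)\<^sup>2)\<^sup>2 \<le> (K * b) * (norm d)\<^sup>2"
  proof -
    have "((norm d)\<^sup>2)\<^sup>2 \<le> K * b * defect_sq (cadjoint A) d"
      using bound[of u d] by (simp add: b_def d_def power2_norm_eq_inner)
    also have "\<dots> \<le> K * b * (norm d)\<^sup>2"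
      using K nonneg by (intro mult_left_mono) (auto simp: defect_sq_def)
    finally show ?thesis .
  qed
  then have norm_d: "(norm d)\<^sup>2 \<le> K * b"
    using K nonneg by (cases "d = 0") (auto simp: power2_eq_square)
  have "a - b = - 2 * (d \<bullet> A u) + (norm d)\<^sup>2"
    unfolding a_def b_def d_def defect_sq_def power2_norm_eq_inner
    by (simp add: inner_simps inner_commute)
  with pairing norm_d have "a \<le> b + 3 * (K * b) + a / 2"
    by linarith
  then show ?thesis
    by (simp add: algebra_simps flip: a_def b_def)
qed

text \<open>Two descriptions of the norm of \<open>k\<close> in the complementary (de Branges-Rovnyak) space of \<open>b\<close>: as a
  functional that is bounded by the defect of \<open>b\<^sup>*\<close>, and as the supremum of \<open>norm (k + b w)\<^sup>2 - norm w\<^sup>2\<close>.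
  The second one does not mention \<open>b\<^sup>*\<close>, so it can be checked on a dense set of \<open>w\<close>.\<close>

lemma defect_pairing_iff:
  fixes b :: "'b::complex_hilbert \<Rightarrow>\<^sub>C\<^sub>L 'a::complex_hilbert"
  assumes b: "contraction b" and M: "M \<ge> 0"
  shows "(\<forall>w. (norm (k + b w))\<^sup>2 \<le> (norm w)\<^sup>2 + M) \<longleftrightarrow> (\<forall>u. (k \<bullet> u)\<^sup>2 \<le> M * defect_sq (cadjoint b) u)"
proof
  assume le: "\<forall>w. (norm (k + b w))\<^sup>2 \<le> (norm w)\<^sup>2 + M"
  show "\<forall>u. (k \<bullet> u)\<^sup>2 \<le> M * defect_sq (cadjoint b) u"
  proof
    fix u
    define p q \<alpha> where "p = (norm u)\<^sup>2" and "q = (norm (cadjoint b u))\<^sup>2" and "\<alpha> = k \<bullet> u"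
    have q: "0 \<le> q" "q \<le> p"
      using b contraction_cadjoint[of b] by (simp_all add: p_def q_def contraction_iff)
    \<comment> \<open>The hypothesis for \<open>w = t b\<^sup>* u\<close>; the optimal choice is \<open>t = \<alpha> / (p - q)\<close>.\<close>
    have quadratic: "\<alpha>\<^sup>2 \<le> t\<^sup>2 * (q * (p - q)) + p * M - 2 * t * (\<alpha> * q)" for t
    proof -
      define w where "w = t *\<^sub>R cadjoint b u"
      have "\<alpha> + t * q = (k + b w) \<bullet> u"
        by (simp add: \<alpha>_def q_def w_def inner_simps cblinfun_scaleR power2_norm_eq_inner cadjoint_inner)
      then have "(\<alpha> + t * q)\<^sup>2 \<le> (norm (k + b w))\<^sup>2 * p"
        using Cauchy_Schwarz_ineq[of "k + b w" u] by (simp add: p_def power2_norm_eq_inner)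
      also have "\<dots> \<le> ((norm w)\<^sup>2 + M) * p"
        by (intro mult_right_mono le[rule_format]) (simp add: p_def)
      also have "(norm w)\<^sup>2 = t\<^sup>2 * q"
        by (simp add: w_def q_def power_mult_distrib)
      finally show ?thesis
        by (simp add: power2_eq_square algebra_simps)
    qed
    have "\<alpha>\<^sup>2 \<le> M * (p - q)"
    proof (cases "p = q")
      case True
      have "\<alpha> * q = 0"
      proof (rule ccontr)
        assume nz: "\<alpha> * q \<noteq> 0"
        \<comment> \<open>If \<open>p = q\<close> the bound is affine in \<open>t\<close>, and this \<open>t\<close> makes its right-hand side equal to \<open>- 1\<close>.\<close>
        define t where "t = (p * M + 1) / (2 * (\<alpha> * q))"
        have "2 * t * (\<alpha> * q) = p * M + 1"
          using nz by (simp add: t_def)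
        then show False
          using quadratic[of t] True zero_le_power2[of \<alpha>] by simp
      qed
      then have "\<alpha> = 0"
        using True by (auto simp: p_def \<alpha>_def)
      then show ?thesis using True by simp
    next
      case False
      with q have pos: "p - q > 0" "p > 0" by auto
      have complete: "(\<alpha> / e)\<^sup>2 * (q * e) + p * M - 2 * (\<alpha> / e) * (\<alpha> * q) = p * M - \<alpha>\<^sup>2 * q / e"
        if "e > 0" for e
        using that by (simp add: field_simps power2_eq_square)
      have "\<alpha>\<^sup>2 + \<alpha>\<^sup>2 * q / (p - q) \<le> p * M"
        using quadratic[of "\<alpha> / (p - q)"] complete[OF pos(1)] by linarith
      moreover have "\<alpha>\<^sup>2 + \<alpha>\<^sup>2 * q / (p - q) = p * (\<alpha>\<^sup>2 / (p - q))"
        using pos by (simp add: field_simps)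
      ultimately have "p * (\<alpha>\<^sup>2 / (p - q)) \<le> p * M"
        by simp
      then have "\<alpha>\<^sup>2 / (p - q) \<le> M"
        by (rule mult_left_le_imp_le) (rule pos)
      then show ?thesis
        using pos by (simp add: divide_le_eq)
    qed
    then show "(k \<bullet> u)\<^sup>2 \<le> M * defect_sq (cadjoint b) u"
      by (simp add: \<alpha>_def p_def q_def defect_sq_def)
  qed
next
  assume le: "\<forall>u. (k \<bullet> u)\<^sup>2 \<le> M * defect_sq (cadjoint b) u"
  show "\<forall>w. (norm (k + b w))\<^sup>2 \<le> (norm w)\<^sup>2 + M"
  proof
    fix w
    \<comment> \<open>Pair \<open>u = k + b w\<close> with itself and apply the Cauchy-Schwarz inequality in the plane.\<close>
    define u where "u = k + b w"
    have "contraction (cadjoint b)"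
      using b by (simp add: contraction_cadjoint)
    define s where "s = sqrt (defect_sq (cadjoint b) u)"
    define n where "n = norm (cadjoint b u)"
    have s: "s\<^sup>2 + n\<^sup>2 = (norm u)\<^sup>2"
      using defect_sq_nonneg[OF \<open>contraction (cadjoint b)\<close>, of u] by (simp add: s_def n_def defect_sq_def)
    have s0: "0 \<le> s"
      using defect_sq_nonneg[OF \<open>contraction (cadjoint b)\<close>, of u] by (simp add: s_def)
    have "(k \<bullet> u)\<^sup>2 \<le> (sqrt M * s)\<^sup>2"
      using le defect_sq_nonneg[OF \<open>contraction (cadjoint b)\<close>, of u] M by (simp add: s_def power_mult_distrib)
    then have "k \<bullet> u \<le> sqrt M * s"
      by (rule power2_le_imp_le) (simp add: M s0)
    moreover have "b w \<bullet> u \<le> norm w * n"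
      unfolding cadjoint_inner n_def by (rule norm_cauchy_schwarz)
    ultimately have "(norm u)\<^sup>2 \<le> sqrt M * s + norm w * n"
      unfolding power2_norm_eq_inner by (subst (1) u_def) (simp add: inner_add_left)
    then have "((norm u)\<^sup>2)\<^sup>2 \<le> (sqrt M * s + norm w * n)\<^sup>2"
      by (intro power_mono) auto
    also have "\<dots> \<le> ((sqrt M)\<^sup>2 + (norm w)\<^sup>2) * (s\<^sup>2 + n\<^sup>2)"
      using zero_le_power2[of "sqrt M * n - norm w * s"] by (simp add: power2_eq_square algebra_simps)
    also have "\<dots> = ((norm w)\<^sup>2 + M) * (norm u)\<^sup>2"
      by (simp only: s real_sqrt_pow2[OF M]) (simp only: add.commute)
    finally have square: "(norm u)\<^sup>2 * (norm u)\<^sup>2 \<le> ((norm w)\<^sup>2 + M) * (norm u)\<^sup>2"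
      unfolding power2_eq_square[of "(norm u)\<^sup>2"] .
    have "(norm u)\<^sup>2 \<le> (norm w)\<^sup>2 + M"
    proof (cases "u = 0")
      case False
      show ?thesis
        by (rule mult_right_le_imp_le[OF square]) (use False in simp)
    qed (use M in simp)
    then show "(norm (k + b w))\<^sup>2 \<le> (norm w)\<^sup>2 + M"
      by (simp add: u_def)
  qed
qed

text \<open>By the preceding lemma: for each \<open>f\<close>, the vector \<open>(a - b) f\<close> lies in the complementary space of \<open>b\<close>
  with squared norm at most \<open>K\<close> times the squared defect of \<open>a\<close> at \<open>f\<close>.\<close>

definition defect_dominated ::
  "real \<Rightarrow> 'b::complex_hilbert \<Rightarrow>\<^sub>C\<^sub>L 'a::complex_hilbert \<Rightarrow> 'b \<Rightarrow>\<^sub>C\<^sub>L 'a \<Rightarrow> bool"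
  where "defect_dominated K a b \<longleftrightarrow>
    (\<forall>f w. (norm (a f - b f + b w))\<^sup>2 \<le> (norm w)\<^sup>2 + K * defect_sq a f)"

lemma defect_dominated_iff:
  assumes "contraction a" "contraction b" "K \<ge> 0"
  shows "defect_dominated K a b \<longleftrightarrow>
    (\<forall>f u. ((a f - b f) \<bullet> u)\<^sup>2 \<le> K * defect_sq a f * defect_sq (cadjoint b) u)"
  unfolding defect_dominated_def using assms
  by (subst defect_pairing_iff[symmetric]) (auto simp: defect_sq_nonneg)

lemma defect_sq_le_of_dominated:
  assumes "contraction a" "contraction b" "K \<ge> 0" "defect_dominated K a b"
  shows "defect_sq b f \<le> (2 + 6 * K) * defect_sq a f"
proof (rule defect_sq_le_of_mixed[OF assms(2,1,3)])
  show "((b f - a f) \<bullet> u)\<^sup>2 \<le> K * defect_sq a f * defect_sq (cadjoint b) u" for f u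
    using assms(4)[unfolded defect_dominated_iff[OF assms(1-3)], rule_format, of f u]
    by (simp add: inner_diff_left power2_commute)
qed

lemma defect_dominated_mono:
  assumes "contraction a" "K \<le> L" "defect_dominated K a b"
  shows "defect_dominated L a b"
  unfolding defect_dominated_def
proof (intro allI)
  fix f w
  have "(norm (a f - b f + b w))\<^sup>2 \<le> (norm w)\<^sup>2 + K * defect_sq a f"
    using assms(3) by (simp add: defect_dominated_def)
  also have "\<dots> \<le> (norm w)\<^sup>2 + L * defect_sq a f"
    using assms(1,2) by (intro add_left_mono mult_right_mono defect_sq_nonneg)
  finally show "(norm (a f - b f + b w))\<^sup>2 \<le> (norm w)\<^sup>2 + L * defect_sq a f" .
qed

lemma cadjoint_diff_inner: "(cadjoint A v - cadjoint B v) \<bullet> u = (A u - B u) \<bullet> v"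
  for A B :: "'a::complex_hilbert \<Rightarrow>\<^sub>C\<^sub>L 'b::complex_hilbert"
  by (simp add: inner_diff_left cadjoint_inner inner_commute[of u])

text \<open>Here both halves of the equivalence enter: \<open>A \<prec> B\<close> bounds the form, and \<open>B \<prec> A\<close> allows the
  defect of \<open>B\<^sup>*\<close> in that bound to be replaced by the defect of \<open>A\<^sup>*\<close>.\<close>

lemma op_prec_imp_defect_dominated:
  fixes A B :: "'a::complex_hilbert \<Rightarrow>\<^sub>C\<^sub>L 'b::complex_hilbert"
  assumes AB: "A \<prec> B" and BA: "B \<prec> A"
  obtains K where "K \<ge> 0" "defect_dominated K (cadjoint A) (cadjoint B)"
proof -
  have A: "contraction A" and B: "contraction B"
    using AB by (auto simp: op_prec_def)
  then have A': "contraction (cadjoint A)" and B': "contraction (cadjoint B)"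
    by (simp_all add: contraction_cadjoint)
  obtain K where K: "K \<ge> 0"
    and le: "\<And>u v. ((A u - B u) \<bullet> v)\<^sup>2 \<le> K * defect_sq B u * defect_sq (cadjoint B) v"
    using AB op_prec_iff[OF A B] by blast
  obtain L where L: "L \<ge> 0"
    and le': "\<And>u v. ((B u - A u) \<bullet> v)\<^sup>2 \<le> L * defect_sq A u * defect_sq (cadjoint A) v"
    using BA op_prec_iff[OF B A] by blast
  have compare: "defect_sq (cadjoint B) v \<le> (1 + 2 * sqrt L) * defect_sq (cadjoint A) v" for v
    by (rule defect_sq_le_of_prec[OF A' L])
      (use le' in \<open>simp add: cadjoint_diff_inner cadjoint_cadjoint mult_ac\<close>)
  define M where "M = K * (1 + 2 * sqrt L)"
  have "M \<ge> 0"
    using K L by (simp add: M_def)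
  moreover have "defect_dominated M (cadjoint A) (cadjoint B)"
    unfolding defect_dominated_iff[OF A' B' \<open>M \<ge> 0\<close>]
  proof (intro allI)
    fix f u
    have "((cadjoint A f - cadjoint B f) \<bullet> u)\<^sup>2 \<le> (K * defect_sq B u) * defect_sq (cadjoint B) f"
      using le[of u f] by (simp add: cadjoint_diff_inner)
    also have "\<dots> \<le> (K * defect_sq B u) * ((1 + 2 * sqrt L) * defect_sq (cadjoint A) f)"
      using K defect_sq_nonneg[OF B] by (intro mult_left_mono compare) auto
    finally show "((cadjoint A f - cadjoint B f) \<bullet> u)\<^sup>2
        \<le> M * defect_sq (cadjoint A) f * defect_sq (cadjoint (cadjoint B)) u"
      by (simp add: M_def cadjoint_cadjoint mult_ac)
  qed
  ultimately show thesis by (rule that)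
qed

text \<open>The first domination is a mixed bound; the second one compares the defects of \<open>A\<^sup>*\<close> and \<open>B\<^sup>*\<close>,
  which turns it into the bound that defines the pre-order.\<close>

lemma op_prec_of_defect_dominated:
  fixes A B :: "'a::complex_hilbert \<Rightarrow>\<^sub>C\<^sub>L 'b::complex_hilbert"
  assumes A: "contraction A" and B: "contraction B" and K: "K \<ge> 0"
    and AB: "defect_dominated K (cadjoint A) (cadjoint B)"
    and BA: "defect_dominated K (cadjoint B) (cadjoint A)"
  shows "A \<prec> B"
proof -
  have A': "contraction (cadjoint A)" and B': "contraction (cadjoint B)"
    using A B by (simp_all add: contraction_cadjoint)
  have compare: "defect_sq (cadjoint A) v \<le> (2 + 6 * K) * defect_sq (cadjoint B) v" for v
    by (rule defect_sq_le_of_dominated[OF B' A' K BA])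
  have "((A u - B u) \<bullet> v)\<^sup>2 \<le> (K * (2 + 6 * K)) * defect_sq B u * defect_sq (cadjoint B) v" for u v
  proof -
    have "((A u - B u) \<bullet> v)\<^sup>2 \<le> (K * defect_sq B u) * defect_sq (cadjoint A) v"
      using AB[unfolded defect_dominated_iff[OF A' B' K], rule_format, of v u]
      by (simp add: cadjoint_diff_inner cadjoint_cadjoint mult_ac)
    also have "\<dots> \<le> (K * defect_sq B u) * ((2 + 6 * K) * defect_sq (cadjoint B) v)"
      using K defect_sq_nonneg[OF B] by (intro mult_left_mono compare) auto
    finally show ?thesis by (simp add: mult_ac)
  qed
  moreover have "0 \<le> K * (2 + 6 * K)"
    using K by simp
  ultimately show ?thesis
    using op_prec_iff[OF A B] by blast
qed

section \<open>Power series with vectors as coefficients\<close>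

lemma cinner_zero_left [simp]: "cinner 0 (y :: 'a::complex_hilbert) = 0"
  using cinner_add_left[of 0 0 y] by simp

lemma cinner_add_right: "cinner (x :: 'a::complex_hilbert) (y + z) = cinner x y + cinner x z"
  by (metis cinner_add_left cinner_commute complex_cnj_add)

lemma cinner_zero_right [simp]: "cinner (x :: 'a::complex_hilbert) 0 = 0"
  using cinner_add_right[of x 0 0] by simp

lemma cinner_sum_left: "cinner (\<Sum>i\<in>I. f i) (y :: 'a::complex_hilbert) = (\<Sum>i\<in>I. cinner (f i) y)"
  by (induction I rule: infinite_finite_induct) (auto simp: cinner_add_left)

lemma cinner_sum_right: "cinner (x :: 'a::complex_hilbert) (\<Sum>i\<in>I. f i) = (\<Sum>i\<in>I. cinner x (f i))"
  by (induction I rule: infinite_finite_induct) (auto simp: cinner_add_right)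

lemma cinner_self: "cinner x x = of_real ((norm (x :: 'a::complex_hilbert))\<^sup>2)"
proof -
  have "cinner x x \<in> \<real>"
    by (metis Reals_cnj_iff cinner_commute)
  then show ?thesis
    by (simp add: power2_norm_eq_inner inner_eq_Re_cinner of_real_Re)
qed

lemma eq_if_cinner_eq: "(\<And>y. cinner x y = cinner z y) \<Longrightarrow> x = (z :: 'a::complex_hilbert)"
  by (rule eq_if_inner_eq) (simp add: inner_eq_Re_cinner)

lemma taylor_coeffs_geometric_bound:
  fixes h :: "complex \<Rightarrow> 'a::complex_hilbert"
  assumes "has_taylor_coeffs h c" "0 < s" "s < 1"
  obtains C where "\<And>n. norm (c n) * s ^ n \<le> C"
proof -
  have "summable (\<lambda>n. of_real s ^ n *\<^sub>C c n)"
    using assms unfolding has_taylor_coeffs_def by (intro sums_summable) auto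
  then have "Bseq (\<lambda>n. of_real s ^ n *\<^sub>C c n)"
    by (intro convergent_imp_Bseq convergentI[OF summable_LIMSEQ_zero])
  then obtain C where "\<And>n. norm (of_real s ^ n *\<^sub>C c n) \<le> C"
    by (auto simp: Bseq_def)
  then show thesis
    using assms(2) by (intro that[of C]) (simp add: norm_scaleC norm_power mult.commute)
qed

lemma taylor_uniform_limit:
  fixes h :: "complex \<Rightarrow> 'a::complex_hilbert"
  assumes h: "has_taylor_coeffs h c" and r: "0 < r" "r < 1"
  shows "uniform_limit (cball 0 r) (\<lambda>N z. \<Sum>n<N. z ^ n *\<^sub>C c n) h sequentially"
proof -
  obtain s where s: "r < s" "s < 1"
    using dense r by blast
  obtain C where C: "\<And>n. norm (c n) * s ^ n \<le> C"
    using taylor_coeffs_geometric_bound[OF h, of s] s r by auto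
  have "norm (z ^ n *\<^sub>C c n) \<le> C * (r / s) ^ n" if "z \<in> cball 0 r" for z n
  proof -
    have "norm (z ^ n *\<^sub>C c n) \<le> r ^ n * norm (c n)"
      using that by (auto simp: norm_scaleC norm_power intro!: mult_right_mono power_mono)
    also have "\<dots> = (norm (c n) * s ^ n) * (r / s) ^ n"
      using s r by (simp add: power_divide)
    also have "\<dots> \<le> C * (r / s) ^ n"
      using s r by (intro mult_right_mono C) auto
    finally show ?thesis .
  qed
  moreover have "summable (\<lambda>n. C * (r / s) ^ n)"
    using s r by (intro summable_mult summable_geometric) auto
  ultimately have "uniform_limit (cball 0 r) (\<lambda>N z. \<Sum>n<N. z ^ n *\<^sub>C c n) (\<lambda>z. \<Sum>n. z ^ n *\<^sub>C c n) sequentially"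
    by (rule Weierstrass_m_test)
  then show ?thesis
  proof (rule uniform_limit_cong'[THEN iffD1, rotated -1])
    show "(\<Sum>n. z ^ n *\<^sub>C c n) = h z" if "z \<in> cball 0 r" for z
      using h that r unfolding has_taylor_coeffs_def by (intro sums_unique[symmetric]) auto
  qed auto
qed

lemma taylor_bounded:
  fixes h :: "complex \<Rightarrow> 'a::complex_hilbert"
  assumes h: "has_taylor_coeffs h c" and r: "0 < r" "r < 1"
  obtains B where "\<And>z. cmod z \<le> r \<Longrightarrow> norm (h z) \<le> B"
proof -
  have "\<forall>\<^sub>F N in sequentially. \<forall>z\<in>cball 0 r. dist (\<Sum>n<N. z ^ n *\<^sub>C c n) (h z) < 1"
    using uniform_limitD[OF taylor_uniform_limit[OF assms], of 1] by simp
  then obtain N where N: "\<And>z. cmod z \<le> r \<Longrightarrow> dist (\<Sum>n<N. z ^ n *\<^sub>C c n) (h z) < 1"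
    unfolding eventually_sequentially by (metis dist_0_norm mem_cball order_refl)
  have "norm (h z) \<le> (\<Sum>n<N. norm (c n)) + 1" if z: "cmod z \<le> r" for z
  proof -
    have "norm (\<Sum>n<N. z ^ n *\<^sub>C c n) \<le> (\<Sum>n<N. norm (c n))"
      by (rule sum_norm_le) (use z r in \<open>auto simp: norm_scaleC norm_power intro!: mult_left_le_one_le power_le_one\<close>)
    then show ?thesis
      using N[OF z] norm_triangle_sub[of "h z" "\<Sum>n<N. z ^ n *\<^sub>C c n"]
      by (simp add: dist_norm norm_minus_commute)
  qed
  then show thesis by (rule that)
qed

text \<open>Weak holomorphy and local boundedness already give a convergent power series. Weak holomorphy is
  what is easy to check for a product of an operator function and a vector function.\<close>

lemma weakly_holomorphic_taylor:
  fixes g :: "complex \<Rightarrow> 'a::complex_hilbert"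
  assumes hol: "\<And>y. (\<lambda>z. cinner (g z) y) holomorphic_on \<bbbD>"
    and bounded: "\<And>r. 0 < r \<Longrightarrow> r < 1 \<Longrightarrow> \<exists>B. \<forall>z. cmod z \<le> r \<longrightarrow> norm (g z) \<le> B"
  obtains c where "has_taylor_coeffs g c"
proof -
  \<comment> \<open>The coefficient functionals are antilinear in \<open>y\<close> and bounded by the Cauchy estimates, so that
    they are represented by vectors.\<close>
  define a where "a n y = (deriv ^^ n) (\<lambda>z. cinner (g z) y) 0 / fact n" for n y
  have a_add: "a n (x + y) = a n x + a n y" for n x y
    unfolding a_def cinner_add_right
    by (subst higher_deriv_add[OF hol hol]) (auto simp: add_divide_distrib)
  have a_scale: "a n (k *\<^sub>C y) = cnj k * a n y" for n k y
    unfolding a_def cinner_scaleC_right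
    by (subst higher_deriv_cmult[OF hol]) auto
  have a_bound: "\<exists>B\<ge>0. \<forall>n y. cmod (a n y) \<le> B / r ^ n * norm y" if r: "0 < r" "r < 1" for r
  proof -
    obtain B where B: "\<And>z. cmod z \<le> r \<Longrightarrow> norm (g z) \<le> B"
      using bounded[OF r] by blast
    have "0 \<le> B"
      using B[of 0] r order_trans[OF norm_ge_zero] by auto
    have "cmod (a n y) \<le> (2 * B) / r ^ n * norm y" for n y
    proof -
      have hol': "(\<lambda>z. cinner (g z) y) holomorphic_on cball 0 r"
        by (rule holomorphic_on_subset[OF hol]) (use r in auto)
      have "cmod ((deriv ^^ n) (\<lambda>z. cinner (g z) y) 0) \<le> fact n * (2 * B * norm y) / r ^ n"
      proof (rule Cauchy_inequality)
        show "(\<lambda>z. cinner (g z) y) holomorphic_on ball 0 r"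
          by (rule holomorphic_on_subset[OF hol']) auto
        show "continuous_on (cball 0 r) (\<lambda>z. cinner (g z) y)"
          using hol' by (rule holomorphic_on_imp_continuous_on)
        show "cmod (cinner (g x) y) \<le> 2 * B * norm y" if "cmod (0 - x) = r" for x
          using norm_cinner_le[of "g x" y] mult_right_mono[OF B, of x "norm y"] that by simp
      qed (use r in auto)
      then show ?thesis
        by (simp add: a_def norm_divide divide_le_eq mult_ac)
    qed
    then show ?thesis
      using \<open>0 \<le> B\<close> by (intro exI[of _ "2 * B"]) auto
  qed
  have "\<exists>c. \<forall>y. a n y = cinner c y" for n
  proof -
    obtain B where B: "0 \<le> B" "\<And>y. cmod (a n y) \<le> B / (1 / 2) ^ n * norm y"
      using a_bound[of "1 / 2"] by auto
    have linear: "linear (\<lambda>y. Re (a n y))"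
      by (rule linearI) (auto simp: a_add scaleR_scaleC a_scale)
    have "\<bar>Re (a n y)\<bar> \<le> (B / (1 / 2) ^ n) * norm (cblinfun_id y)" for y
      using order_trans[OF abs_Re_le_cmod B(2)] by (simp add: cblinfun_evals)
    from Riesz_factored[OF subspace_UNIV cblinfun_linear linear this] B(1)
    obtain c where c: "\<And>y. Re (a n y) = c \<bullet> y"
      by (auto simp: cblinfun_evals inner_commute)
    have "a n y = cinner c y" for y
    proof (rule complex_eqI)
      show "Re (a n y) = Re (cinner c y)"
        using c by (simp add: inner_eq_Re_cinner)
      show "Im (a n y) = Im (cinner c y)"
        using c[of "\<i> *\<^sub>C y"] by (simp add: a_scale inner_eq_Re_cinner cinner_scaleC_right)
    qed
    then show ?thesis by blast
  qed
  then obtain c where c: "\<And>n y. a n y = cinner (c n) y"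
    by metis
  have "(\<lambda>n. z ^ n *\<^sub>C c n) sums g z" if z: "z \<in> \<bbbD>" for z
  proof -
    obtain r where r: "cmod z < r" "r < 1"
      using z dense by auto
    then have r0: "0 < r"
      using norm_ge_zero[of z] by linarith
    obtain B where B: "0 \<le> B" "\<And>n y. cmod (a n y) \<le> B / r ^ n * norm y"
      using a_bound[OF r0 r(2)] by blast
    have c_le: "norm (c n) \<le> B / r ^ n" for n
    proof -
      have "norm (c n) * norm (c n) \<le> B / r ^ n * norm (c n)"
        using B(2)[of n "c n"] by (simp add: c cinner_self norm_power power2_eq_square norm_mult)
      then show ?thesis
        using B(1) r0 by (cases "c n = 0") (simp_all del: times_divide_eq_left)
    qed
    have "summable (\<lambda>n. z ^ n *\<^sub>C c n)"
    proof (rule summable_comparison_test')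
      show "summable (\<lambda>n. B * (cmod z / r) ^ n)"
        using r r0 by (intro summable_mult summable_geometric) auto
      show "norm (z ^ n *\<^sub>C c n) \<le> B * (cmod z / r) ^ n" for n
        using mult_left_mono[OF c_le[of n], of "cmod z ^ n"]
        by (simp add: norm_scaleC norm_power power_divide mult_ac)
    qed
    then obtain s where s: "(\<lambda>n. z ^ n *\<^sub>C c n) sums s"
      by blast
    have "s = g z"
    proof (rule eq_if_cinner_eq)
      fix y
      have "(\<lambda>n. z ^ n * cinner (c n) y) sums cinner s y"
        using bounded_linear.sums[OF bounded_linear_cinner_left s, of y] by (simp add: cinner_scaleC_left)
      moreover have "(\<lambda>n. z ^ n * cinner (c n) y) sums cinner (g z) y"
        using holomorphic_power_series[OF hol z, of y] by (simp add: mult.commute flip: c a_def)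
      ultimately show "cinner s y = cinner (g z) y"
        by (rule sums_unique2)
    qed
    with s show ?thesis by simp
  qed
  then show thesis
    by (intro that[of c]) (simp add: has_taylor_coeffs_def)
qed

lemma roots_of_unity_orthogonal:
  fixes n m N :: nat
  assumes "n < N" "m < N"
  defines "\<omega> \<equiv> exp (2 * of_real pi * \<i> / of_nat N)"
  shows "(\<Sum>k<N. (\<omega> ^ k) ^ n * cnj ((\<omega> ^ k) ^ m)) = (if n = m then of_nat N else 0)"
proof -
  have N: "1 \<le> N" using assms by simp
  have norm: "cmod \<omega> = 1"
    by (simp add: \<omega>_def)
  have power: "\<omega> ^ j = exp (2 * of_real pi * \<i> * of_nat j / of_nat N)" for j
    by (simp add: \<omega>_def exp_of_nat_mult[symmetric] mult_ac)
  define z where "z = \<omega> ^ n * cnj (\<omega> ^ m)"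
  have cancel: "\<omega> ^ m * cnj (\<omega> ^ m) = 1"
    by (simp add: complex_norm_square[symmetric] norm norm_power flip: complex_cnj_power)
  have terms: "(\<omega> ^ k) ^ n * cnj ((\<omega> ^ k) ^ m) = z ^ k" for k
    by (simp add: z_def power_mult_distrib mult.commute flip: power_mult)
  show ?thesis
    unfolding terms
  proof (cases "n = m")
    case True
    then have "z = 1" unfolding z_def by (simp only: cancel)
    then show "(\<Sum>k<N. z ^ k) = (if n = m then of_nat N else 0)"
      using True by simp
  next
    case False
    have "z \<noteq> 1"
    proof
      assume "z = 1"
      have "\<omega> ^ n = \<omega> ^ n * (\<omega> ^ m * cnj (\<omega> ^ m))"
        by (simp only: cancel mult_1_right)
      also have "\<dots> = \<omega> ^ m"
        using \<open>z = 1\<close> by (simp add: z_def mult_ac)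
      finally have "n mod N = m mod N"
        unfolding power using complex_root_unity_eq[OF N] by blast
      then show False using assms False by simp
    qed
    moreover have "\<omega> ^ N = 1"
      using complex_root_unity_eq_1[OF N, of N] by (simp add: power)
    then have "\<omega> ^ N = 1" "cnj \<omega> ^ N = 1"
      by (simp_all flip: complex_cnj_power)
    then have "z ^ N = 1"
      by (simp add: z_def power_mult_distrib power_mult[symmetric] mult.commute[of _ N])
        (simp add: power_mult)
    ultimately show "(\<Sum>k<N. z ^ k) = (if n = m then of_nat N else 0)"
      using False by (simp add: sum_gp_strict)
  qed
qed

text \<open>The Fourier transform on the cyclic group of order \<open>N\<close>, a discrete substitute for the integral of
  \<open>norm\<^sup>2\<close> over a circle.\<close>

lemma discrete_Parseval:
  fixes a :: "nat \<Rightarrow> 'a::complex_hilbert"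
  defines "\<omega> N \<equiv> exp (2 * of_real pi * \<i> / of_nat N)"
  shows "(\<Sum>k<N. (norm (\<Sum>n<N. (\<omega> N ^ k) ^ n *\<^sub>C a n))\<^sup>2) = N * (\<Sum>n<N. (norm (a n))\<^sup>2)"
proof -
  have "(\<Sum>k<N. cinner (\<Sum>n<N. (\<omega> N ^ k) ^ n *\<^sub>C a n) (\<Sum>m<N. (\<omega> N ^ k) ^ m *\<^sub>C a m))
      = (\<Sum>k<N. \<Sum>n<N. \<Sum>m<N. ((\<omega> N ^ k) ^ n * cnj ((\<omega> N ^ k) ^ m)) * cinner (a n) (a m))"
    unfolding cinner_sum_left cinner_sum_right cinner_scaleC_left cinner_scaleC_right
    by (rule sum.cong[OF refl], subst sum.swap) (simp only: mult_ac sum_distrib_left)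
  also have "\<dots> = (\<Sum>n<N. \<Sum>m<N. (\<Sum>k<N. (\<omega> N ^ k) ^ n * cnj ((\<omega> N ^ k) ^ m)) * cinner (a n) (a m))"
    unfolding sum_distrib_right by (subst sum.swap, rule sum.cong[OF refl], subst sum.swap) simp
  also have "\<dots> = (\<Sum>n<N. \<Sum>m<N. (if n = m then of_nat N else 0) * cinner (a n) (a m))"
    unfolding \<omega>_def
    by (intro sum.cong refl arg_cong2[where f = "(*)"] roots_of_unity_orthogonal) auto
  also have "\<dots> = (\<Sum>n<N. of_nat N * cinner (a n) (a n))"
    by (intro sum.cong refl) (simp add: if_distrib[where f = "\<lambda>x. x * _"] cong: if_cong)
  finally have "complex_of_real (\<Sum>k<N. (norm (\<Sum>n<N. (\<omega> N ^ k) ^ n *\<^sub>C a n))\<^sup>2)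
      = complex_of_real (N * (\<Sum>n<N. (norm (a n))\<^sup>2))"
    by (simp add: cinner_self sum_distrib_left)
  then show ?thesis
    unfolding of_real_eq_iff .
qed

text \<open>The Hardy norm is monotone in the pointwise norm. On a circle of radius \<open>r < 1\<close> both series converge
  uniformly, and the discrete Parseval identity compares the quadratic means of the polynomials.\<close>

lemma taylor_coeffs_norm_mono:
  fixes g :: "complex \<Rightarrow> 'a::complex_hilbert" and h :: "complex \<Rightarrow> 'b::complex_hilbert"
  assumes g: "has_taylor_coeffs g c" and h: "has_taylor_coeffs h d"
    and le: "\<And>z. z \<in> \<bbbD> \<Longrightarrow> norm (g z) \<le> norm (h z)"
    and D: "\<And>N. (\<Sum>n<N. (norm (d n))\<^sup>2) \<le> D\<^sup>2" and "0 \<le> D"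
  shows "(\<Sum>n<M. (norm (c n))\<^sup>2) \<le> D\<^sup>2"
proof -
  have radius: "L2_set (\<lambda>n. norm (of_real r ^ n *\<^sub>C c n)) {..<M} \<le> D" if r: "0 < r" "r < 1" for r :: real
  proof (rule field_le_epsilon)
    fix e :: real assume e: "e > 0"
    \<comment> \<open>On the circle of radius \<open>r\<close> the functions are replaced by Taylor polynomials of degree below
      \<open>N\<close>, for which sampling at \<open>N\<close> points computes the coefficient norm exactly.\<close>
    define p where "p N z = (\<Sum>n<N. z ^ n *\<^sub>C d n)" for N z
    define q where "q N z = (\<Sum>n<N. z ^ n *\<^sub>C c n)" for N z
    have "\<forall>\<^sub>F N in sequentially. \<forall>z\<in>cball 0 r. dist (p N z) (h z) < e / 2"
      "\<forall>\<^sub>F N in sequentially. \<forall>z\<in>cball 0 r. dist (q N z) (g z) < e / 2"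
      using uniform_limitD[OF taylor_uniform_limit[OF h r], of "e / 2"]
        uniform_limitD[OF taylor_uniform_limit[OF g r], of "e / 2"] e
      by (simp_all add: p_def q_def)
    moreover have "\<forall>\<^sub>F N in sequentially. Suc M \<le> N"
      by (rule eventually_ge_at_top)
    ultimately have "\<forall>\<^sub>F N in sequentially. (\<forall>z\<in>cball 0 r. dist (p N z) (h z) < e / 2) \<and>
        (\<forall>z\<in>cball 0 r. dist (q N z) (g z) < e / 2) \<and> Suc M \<le> N"
      by eventually_elim blast
    then obtain N where N: "Suc M \<le> N"
      and near: "\<And>z. cmod z \<le> r \<Longrightarrow> dist (p N z) (h z) < e / 2" "\<And>z. cmod z \<le> r \<Longrightarrow> dist (q N z) (g z) < e / 2"
      by (auto simp: eventually_sequentially)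
    define \<zeta> where "\<zeta> k = of_real r * exp (2 * of_real pi * \<i> / of_nat N) ^ k" for k
    have \<zeta>: "cmod (\<zeta> k) = r" for k
      using r by (simp add: \<zeta>_def norm_mult norm_power)
    have samples: "L2_set (\<lambda>k. norm (\<Sum>n<N. \<zeta> k ^ n *\<^sub>C b n)) {..<N}
        = sqrt N * L2_set (\<lambda>n. norm (of_real r ^ n *\<^sub>C b n)) {..<N}" for b :: "nat \<Rightarrow> 'x::complex_hilbert"
    proof -
      have "\<zeta> k ^ n *\<^sub>C b n = (exp (2 * of_real pi * \<i> / of_nat N) ^ k) ^ n *\<^sub>C (of_real r ^ n *\<^sub>C b n)" for k n
        by (simp add: \<zeta>_def power_mult_distrib scaleC_scaleC mult.commute)
      then have "(\<Sum>k<N. (norm (\<Sum>n<N. \<zeta> k ^ n *\<^sub>C b n))\<^sup>2) = N * (\<Sum>n<N. (norm (of_real r ^ n *\<^sub>C b n))\<^sup>2)"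
        using discrete_Parseval[of N "\<lambda>n. of_real r ^ n *\<^sub>C b n"] by simp
      then show ?thesis
        by (simp add: L2_set_def real_sqrt_mult)
    qed
    have pointwise: "norm (q N (\<zeta> k)) \<le> norm (p N (\<zeta> k)) + e" for k
    proof -
      have "\<zeta> k \<in> \<bbbD>" "cmod (\<zeta> k) \<le> r"
        using \<zeta>[of k] r by auto
      then show ?thesis
        using near[of "\<zeta> k"] le[of "\<zeta> k"] norm_triangle_ineq2[of "q N (\<zeta> k)" "g (\<zeta> k)"]
          norm_triangle_ineq3[of "p N (\<zeta> k)" "h (\<zeta> k)"]
        unfolding dist_norm by linarith
    qed
    have "sqrt N * L2_set (\<lambda>n. norm (of_real r ^ n *\<^sub>C c n)) {..<N} = L2_set (\<lambda>k. norm (q N (\<zeta> k))) {..<N}"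
      by (simp add: samples q_def)
    also have "\<dots> \<le> L2_set (\<lambda>k. norm (p N (\<zeta> k)) + e) {..<N}"
      by (rule L2_set_mono) (use pointwise in auto)
    also have "\<dots> \<le> L2_set (\<lambda>k. norm (p N (\<zeta> k))) {..<N} + L2_set (\<lambda>k. e) {..<N}"
      by (rule L2_set_triangle_ineq)
    also have "\<dots> = sqrt N * (L2_set (\<lambda>n. norm (of_real r ^ n *\<^sub>C d n)) {..<N} + e)"
      using e by (simp add: samples p_def L2_set_constant distrib_left)
    finally have "L2_set (\<lambda>n. norm (of_real r ^ n *\<^sub>C c n)) {..<N} \<le> L2_set (\<lambda>n. norm (of_real r ^ n *\<^sub>C d n)) {..<N} + e"
      using N by simp
    also have "L2_set (\<lambda>n. norm (of_real r ^ n *\<^sub>C d n)) {..<N} \<le> L2_set (\<lambda>n. norm (d n)) {..<N}"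
      by (rule L2_set_mono)
        (use r in \<open>auto simp: norm_scaleC norm_power intro!: mult_left_le_one_le power_le_one\<close>)
    also have "\<dots> \<le> D"
      unfolding L2_set_def using D[of N] \<open>0 \<le> D\<close> real_sqrt_le_mono[OF D[of N]] by simp
    also have "L2_set (\<lambda>n. norm (of_real r ^ n *\<^sub>C c n)) {..<M} \<le> L2_set (\<lambda>n. norm (of_real r ^ n *\<^sub>C c n)) {..<N}"
      unfolding L2_set_def using N by (intro real_sqrt_le_mono sum_mono2) auto
    finally show "L2_set (\<lambda>n. norm (of_real r ^ n *\<^sub>C c n)) {..<M} \<le> D + e"
      by simp
  qed
  \<comment> \<open>Let the radius tend to \<open>1\<close>.\<close>
  have "(\<lambda>k. \<Sum>n<M. ((1 - inverse (real (Suc (Suc k)))) ^ n * norm (c n))\<^sup>2) \<longlonglongrightarrow> (\<Sum>n<M. ((1 - 0) ^ n * norm (c n))\<^sup>2)"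
    by (intro tendsto_intros LIMSEQ_Suc[OF LIMSEQ_inverse_real_of_nat])
  moreover have "(\<Sum>n<M. ((1 - inverse (real (Suc (Suc k)))) ^ n * norm (c n))\<^sup>2) \<le> D\<^sup>2" for k
  proof -
    define r where "r = 1 - inverse (real (Suc (Suc k)))"
    have r: "0 < r" "r < 1"
      by (auto simp: r_def field_simps)
    have "sqrt (\<Sum>n<M. (r ^ n * norm (c n))\<^sup>2) \<le> D"
      using radius[OF r] r by (simp add: L2_set_def norm_scaleC norm_power)
    then show ?thesis
      unfolding r_def[symmetric] using \<open>0 \<le> D\<close> by (simp add: real_sqrt_le_iff' sqrt_le_D)
  qed
  ultimately show ?thesis
    by (intro LIMSEQ_le_const2) auto
qed

section \<open>Multiplication operators\<close>

lemma hardy_fun_sums: "z \<in> \<bbbD> \<Longrightarrow> (\<lambda>n. z ^ n *\<^sub>C hardy_coeff h n) sums hardy_fun h z"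
  using hardy_coeff(2)[of h] by (simp add: has_taylor_coeffs_def)

lemma hardy_fun_outside: "z \<notin> \<bbbD> \<Longrightarrow> hardy_fun h z = 0"
  using hardy_fun[of h] by simp

lemma hardy_eqI: "(\<And>z. z \<in> \<bbbD> \<Longrightarrow> hardy_fun h z = hardy_fun k z) \<Longrightarrow> h = k"
  unfolding hardy_fun_inject[symmetric]
proof
  fix z
  assume "\<And>z. z \<in> \<bbbD> \<Longrightarrow> hardy_fun h z = hardy_fun k z"
  then show "hardy_fun h z = hardy_fun k z"
    by (cases "z \<in> \<bbbD>") (simp_all only: hardy_fun_outside not_False_eq_True)
qed

lemma schur_contraction: "schur F \<Longrightarrow> z \<in> \<bbbD> \<Longrightarrow> contraction (F z)"
  unfolding schur_def by blast

lemma schur_derivative: "schur F \<Longrightarrow> z \<in> \<bbbD> \<Longrightarrow> \<exists>F'. (F has_derivative (\<lambda>w. w *\<^sub>C F')) (at z)"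
  unfolding schur_def by (elim conjE) (rule bspec)

lemma schur_weakly_holomorphic:
  assumes "schur F"
  shows "(\<lambda>z. cinner (F z x) y) holomorphic_on \<bbbD>"
proof -
  have "(\<lambda>z. cinner (F z x) y) field_differentiable at z" if "z \<in> \<bbbD>" for z
  proof -
    from schur_derivative[OF assms that]
    obtain F' where F': "(F has_derivative (\<lambda>w. w *\<^sub>C F')) (at z)" ..
    have "((\<lambda>z. cinner (F z x) y) has_derivative (\<lambda>w. cinner ((w *\<^sub>C F') x) y)) (at z)"
      by (intro bounded_linear.has_derivative[OF bounded_linear_cinner_left]
          bounded_linear.has_derivative[OF bounded_linear_eval] F')
    moreover have "(\<lambda>w. cinner ((w *\<^sub>C F') x) y) = (*) (cinner (F' x) y)"
      by (simp add: fun_eq_iff cblinfun_evals cinner_scaleC_left mult.commute)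
    ultimately have "((\<lambda>z. cinner (F z x) y) has_field_derivative cinner (F' x) y) (at z)"
      unfolding has_field_derivative_def by simp
    then show ?thesis
      unfolding field_differentiable_def by blast
  qed
  then show ?thesis
    by (simp add: holomorphic_on_def field_differentiable_at_within)
qed

text \<open>The product \<open>F h\<close> is weakly holomorphic and so has Taylor coefficients; they are square summable because
  \<open>F h\<close> is pointwise no larger than \<open>h\<close>.\<close>

lemma schur_mult_hardy:
  fixes F :: "complex \<Rightarrow> 'a::complex_hilbert \<Rightarrow>\<^sub>C\<^sub>L 'b::complex_hilbert"
  assumes F: "schur F"
  obtains k :: "'b hardy" where "\<And>z. z \<in> \<bbbD> \<Longrightarrow> hardy_fun k z = F z (hardy_fun h z)" "norm k \<le> norm h"
proof -
  define p where "p N z = (\<Sum>n<N. z ^ n *\<^sub>C hardy_coeff h n)" for N z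
  have F_le: "norm (F z x) \<le> norm x" if "z \<in> \<bbbD>" for z x
    using schur_contraction[OF F that] by (simp add: contraction_iff)
  \<comment> \<open>A locally uniform limit of the functions with a Taylor polynomial in place of \<open>h\<close>.\<close>
  have "(\<lambda>z. cinner (F z (hardy_fun h z)) y) holomorphic_on \<bbbD>" for y
  proof (rule holomorphic_uniform_sequence)
    show "(\<lambda>z. cinner (F z (p N z)) y) holomorphic_on \<bbbD>" for N
      unfolding p_def linear_sum[OF cblinfun_linear] cinner_sum_left cblinfun_scaleC cinner_scaleC_left
      by (intro holomorphic_intros schur_weakly_holomorphic F)
    fix x :: complex assume "x \<in> \<bbbD>"
    then obtain r where r: "cmod x < r" "r < 1"
      using dense by auto
    then have r0: "0 < r"
      using norm_ge_zero[of x] by linarith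
    define d where "d = r - cmod x"
    have sub: "cball x d \<subseteq> cball 0 r"
      by (simp add: d_def cball_subset_cball_iff)
    have "uniform_limit (cball 0 r) (\<lambda>N z. cinner (F z (p N z)) y) (\<lambda>z. cinner (F z (hardy_fun h z)) y) sequentially"
    proof (rule uniform_limitI)
      fix e :: real assume e: "e > 0"
      define e' where "e' = e / (2 * norm y + 1)"
      have e': "e' > 0"
        using e by (simp add: e'_def add_nonneg_pos)
      have "\<forall>\<^sub>F N in sequentially. \<forall>z\<in>cball 0 r. dist (p N z) (hardy_fun h z) < e'"
        unfolding p_def by (rule uniform_limitD[OF taylor_uniform_limit[OF hardy_coeff(2) r0 r(2)] e'])
      then show "\<forall>\<^sub>F N in sequentially. \<forall>z\<in>cball 0 r.
          dist (cinner (F z (p N z)) y) (cinner (F z (hardy_fun h z)) y) < e"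
      proof eventually_elim
        case (elim N)
        show ?case
        proof
          fix z :: complex assume z: "z \<in> cball 0 r"
          define v where "v = p N z - hardy_fun h z"
          have v: "norm v < e'"
            using elim z by (simp add: v_def dist_norm)
          have "cinner (F z (p N z)) y = cinner (F z (hardy_fun h z)) y + cinner (F z v) y"
            by (simp add: v_def cblinfun_diff flip: cinner_add_left)
          then have "dist (cinner (F z (p N z)) y) (cinner (F z (hardy_fun h z)) y) = cmod (cinner (F z v) y)"
            by (simp add: dist_norm)
          also have "\<dots> \<le> 2 * (norm (F z v) * norm y)"
            by (rule norm_cinner_le)
          also have "\<dots> \<le> norm v * (2 * norm y)"
            using mult_right_mono[OF F_le[of z v] norm_ge_zero[of y]] z r by simp
          also have "\<dots> \<le> e' * (2 * norm y)"
            using v by (intro mult_right_mono) auto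
          also have "\<dots> < e' * (2 * norm y + 1)"
            using e' by simp
          also have "\<dots> = e"
            by (simp add: e'_def add_nonneg_eq_0_iff)
          finally show "dist (cinner (F z (p N z)) y) (cinner (F z (hardy_fun h z)) y) < e" .
        qed
      qed
    qed
    then have "uniform_limit (cball x d) (\<lambda>N z. cinner (F z (p N z)) y) (\<lambda>z. cinner (F z (hardy_fun h z)) y) sequentially"
      by (rule uniform_limit_on_subset[OF _ sub])
    moreover have "0 < d" "cball x d \<subseteq> \<bbbD>"
      using r sub by (auto simp: d_def)
    ultimately show "\<exists>d. 0 < d \<and> cball x d \<subseteq> \<bbbD> \<and> uniform_limit (cball x d)
        (\<lambda>N z. cinner (F z (p N z)) y) (\<lambda>z. cinner (F z (hardy_fun h z)) y) sequentially"
      by blast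
  qed simp
  moreover have "\<exists>B. \<forall>z. cmod z \<le> r \<longrightarrow> norm (F z (hardy_fun h z)) \<le> B" if r: "0 < r" "r < 1" for r
  proof -
    obtain B where B: "\<And>z. cmod z \<le> r \<Longrightarrow> norm (hardy_fun h z) \<le> B"
      using taylor_bounded[OF hardy_coeff(2) r] by blast
    have "norm (F z (hardy_fun h z)) \<le> B" if "cmod z \<le> r" for z
      using order_trans[OF F_le B[OF that]] that r by simp
    then show ?thesis by blast
  qed
  ultimately obtain c where c: "has_taylor_coeffs (\<lambda>z. F z (hardy_fun h z)) c"
    using weakly_holomorphic_taylor[of "\<lambda>z. F z (hardy_fun h z)"] by blast
  have c_le: "(\<Sum>n<M. (norm (c n))\<^sup>2) \<le> (norm h)\<^sup>2" for M
    by (rule taylor_coeffs_norm_mono[OF c hardy_coeff(2)]) (auto intro: F_le sum_norm_hardy_coeff_le)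
  have "square_summable c"
    unfolding square_summable_def
  proof (rule bounded_imp_summable)
    show "(\<Sum>n\<le>M. (norm (c n))\<^sup>2) \<le> (norm h)\<^sup>2" for M
      using c_le[of "Suc M"] by (simp add: lessThan_Suc_atMost)
  qed simp
  then obtain k where k: "hardy_coeff k = c"
    using hardy_coeff_exists by blast
  show thesis
  proof (rule that)
    show "hardy_fun k z = F z (hardy_fun h z)" if "z \<in> \<bbbD>" for z
      using hardy_fun_sums[OF that, of k] c that unfolding has_taylor_coeffs_def k
      by (metis sums_unique2)
    have "(norm k)\<^sup>2 \<le> (norm h)\<^sup>2"
      unfolding norm_hardy_square[of k]
      by (rule suminf_le_const[OF norm_hardy_coeff_summable]) (simp add: k c_le)
    then show "norm k \<le> norm h"
      by (rule power2_le_imp_le) simp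
  qed
qed

lemma mult_op_contraction:
  fixes F :: "complex \<Rightarrow> 'a::complex_hilbert \<Rightarrow>\<^sub>C\<^sub>L 'b::complex_hilbert"
  assumes F: "schur F"
  shows mult_op_apply: "z \<in> \<bbbD> \<Longrightarrow> hardy_fun (mult_op F h) z = F z (hardy_fun h z)"
    and contraction_mult_op: "contraction (mult_op F)"
proof -
  define M where "M h = Hardy (\<lambda>z. if z \<in> \<bbbD> then F z (hardy_fun h z) else 0)" for h
  have M: "(\<forall>z\<in>\<bbbD>. hardy_fun (M h) z = F z (hardy_fun h z)) \<and> norm (M h) \<le> norm h" for h
  proof -
    obtain k where k: "\<And>z. z \<in> \<bbbD> \<Longrightarrow> hardy_fun k z = F z (hardy_fun h z)" "norm k \<le> norm h"
      using schur_mult_hardy[OF F] by blast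
    have "(\<lambda>z. if z \<in> \<bbbD> then F z (hardy_fun h z) else 0) = hardy_fun k"
      using k(1) hardy_fun_outside[of _ k] by (intro ext) auto
    then have "M h = k"
      by (simp add: M_def hardy_fun_inverse)
    with k show ?thesis by simp
  qed
  have "M (h + k) = M h + M k" "M (a *\<^sub>C h) = a *\<^sub>C M h" for h k a
    by (auto intro!: hardy_eqI simp: M plus_hardy.rep_eq scaleC_hardy.rep_eq cblinfun_add cblinfun_scaleC)
  moreover from this have "bounded_linear M"
    using M by (intro bounded_linear_intro[where K = 1]) (auto simp: scaleR_scaleC)
  ultimately have apply_M: "cblinfun_apply (mult_op F) = M"
    unfolding mult_op_def M_def[abs_def, symmetric] by (simp add: CBlinfun_inverse)
  show "hardy_fun (mult_op F h) z = F z (hardy_fun h z)" if "z \<in> \<bbbD>"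
    using M that by (simp add: apply_M)
  show "contraction (mult_op F)"
    using M by (simp add: contraction_iff apply_M)
qed

section \<open>Kernel functions\<close>

text \<open>The function \<open>z \<mapsto> (1 - z cnj w)\<^sup>-\<^sup>1 y\<close>, that is, the reproducing kernel of \<open>H\<^sup>2\<close> at \<open>w\<close> applied to \<open>y\<close>.\<close>

definition szego :: "complex \<Rightarrow> 'a::complex_hilbert \<Rightarrow> 'a hardy"
  where "szego w y = (SOME k. hardy_coeff k = (\<lambda>n. cnj w ^ n *\<^sub>C y))"

lemma hardy_coeff_szego:
  assumes "w \<in> \<bbbD>"
  shows "hardy_coeff (szego w y) = (\<lambda>n. cnj w ^ n *\<^sub>C y)"
proof -
  have "summable (\<lambda>n. (cmod w ^ 2) ^ n * (norm y)\<^sup>2)"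
    using assms by (intro summable_mult2 summable_geometric) (simp add: abs_square_less_1)
  then have "square_summable (\<lambda>n. cnj w ^ n *\<^sub>C y)"
    by (simp add: square_summable_def norm_scaleC norm_power power_mult_distrib power_mult[symmetric] mult.commute)
  then show ?thesis
    unfolding szego_def by (rule someI_ex[OF hardy_coeff_exists])
qed

lemma inner_szego:
  assumes "w \<in> \<bbbD>"
  shows "h \<bullet> szego w y = hardy_fun h w \<bullet> y"
proof -
  have "(\<lambda>n. (w ^ n *\<^sub>C hardy_coeff h n) \<bullet> y) sums (hardy_fun h w \<bullet> y)"
    by (rule bounded_linear.sums[OF bounded_linear_inner_left hardy_fun_sums[OF assms]])
  then show ?thesis
    by (simp add: inner_hardy_def hardy_coeff_szego[OF assms] inner_scaleC_left sums_iff)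
qed

text \<open>Adjoints of multiplication operators act on kernel functions pointwise. This is the reason for
  carrying out the main argument on the side of the adjoints.\<close>

lemma cadjoint_mult_op_szego:
  assumes F: "schur F" and w: "w \<in> \<bbbD>"
  shows "cadjoint (mult_op F) (szego w y) = szego w (cadjoint (F w) y)"
proof (rule eq_if_inner_eq)
  fix h
  have "cadjoint (mult_op F) (szego w y) \<bullet> h = mult_op F h \<bullet> szego w y"
    unfolding inner_commute[of "mult_op F h"] by (rule cadjoint_inner'[symmetric])
  also have "\<dots> = h \<bullet> szego w (cadjoint (F w) y)"
    unfolding inner_szego[OF w] mult_op_apply[OF F w] by (rule cadjoint_inner)
  also have "\<dots> = szego w (cadjoint (F w) y) \<bullet> h"
    by (rule inner_commute)
  finally show "cadjoint (mult_op F) (szego w y) \<bullet> h = szego w (cadjoint (F w) y) \<bullet> h" .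
qed

lemma hardy_fun_szego:
  assumes "w \<in> \<bbbD>" "z \<in> \<bbbD>"
  shows "hardy_fun (szego w y) z = inverse (1 - z * cnj w) *\<^sub>C y"
proof -
  have "cmod (z * cnj w) < 1"
    using assms mult_strict_mono[of "cmod z" 1 "cmod w" 1] by (simp add: norm_mult)
  then have "(\<lambda>n. (z * cnj w) ^ n) sums inverse (1 - z * cnj w)"
    using geometric_sums[of "z * cnj w"] by (simp add: inverse_eq_divide)
  then have "(\<lambda>n. (z * cnj w) ^ n *\<^sub>C y) sums (inverse (1 - z * cnj w) *\<^sub>C y)"
    by (rule bounded_linear.sums[rotated])
      (rule bounded_linear_intro[where K = "norm y"],
        auto simp: scaleC_add_left scaleR_scaleC scaleC_scaleC norm_scaleC scaleR_conv_of_real)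
  moreover have "(\<lambda>n. (z * cnj w) ^ n *\<^sub>C y) sums hardy_fun (szego w y) z"
    using hardy_fun_sums[OF assms(2), of "szego w y"]
    by (simp add: hardy_coeff_szego[OF assms(1)] scaleC_scaleC power_mult_distrib)
  ultimately show ?thesis
    by (rule sums_unique2[symmetric])
qed

lemma norm_szego_zero: "norm (szego 0 x) = norm x"
  by (simp add: norm_eq_sqrt_inner inner_szego hardy_fun_szego)

lemma norm_szego_pair:
  assumes z: "z \<in> \<bbbD>"
  shows "(norm (szego 0 a + szego z b))\<^sup>2 = (norm (a + b))\<^sup>2 + (1 / (1 - (cmod z)\<^sup>2) - 1) * (norm b)\<^sup>2"
proof -
  have "1 - z * cnj z = of_real (1 - (cmod z)\<^sup>2)"
    by (simp only: of_real_diff of_real_1 complex_norm_square)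
  then have scale: "inverse (1 - z * cnj z) *\<^sub>C b = (1 / (1 - (cmod z)\<^sup>2)) *\<^sub>R b"
    by (simp only: scaleR_scaleC of_real_divide of_real_1 inverse_eq_divide)
  have "szego z b \<bullet> szego z b = (1 / (1 - (cmod z)\<^sup>2)) * (norm b)\<^sup>2"
    unfolding inner_szego[OF z] hardy_fun_szego[OF z z] scale by (simp add: power2_norm_eq_inner[of b])
  moreover have "szego 0 a \<bullet> szego z b = a \<bullet> b" "szego 0 a \<bullet> szego 0 a = (norm a)\<^sup>2"
    using z by (simp_all add: inner_szego hardy_fun_szego power2_norm_eq_inner)
  ultimately show ?thesis
    unfolding power2_norm_eq_inner[of "szego 0 a + szego z b"] power2_norm_eq_inner[of "a + b"]
    by (simp add: inner_add_left inner_add_right inner_commute power2_norm_eq_inner algebra_simps)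
qed

lemma defect_sq_szego_zero:
  assumes "schur F"
  shows "defect_sq (cadjoint (mult_op F)) (szego 0 x) = defect_sq (cadjoint (F 0)) x"
  by (simp add: defect_sq_def cadjoint_mult_op_szego assms norm_szego_zero)

definition szego_span :: "'a::complex_hilbert hardy set"
  where "szego_span = span {szego w y | w y. w \<in> \<bbbD>}"

text \<open>A function orthogonal to all kernel functions vanishes at every point of the disc.\<close>

lemma szego_span_dense: "closure szego_span = (UNIV :: 'a::complex_hilbert hardy set)"
proof (rule UNIV_eq_I[symmetric])
  fix g :: "'a hardy"
  have linear: "linear (\<lambda>p. p \<bullet> g)" "linear (\<lambda>p :: 'a hardy. p)"
    by (auto intro!: linearI simp: inner_simps)
  have bound: "\<bar>p \<bullet> g\<bar> \<le> norm g * norm p" for p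
    using Cauchy_Schwarz_ineq2[of p g] by (simp add: mult.commute)
  have sub: "subspace szego_span"
    by (simp add: szego_span_def)
  obtain x where x: "x \<in> closure ((\<lambda>p. p) ` szego_span)" "\<And>p. p \<in> szego_span \<Longrightarrow> p \<bullet> g = p \<bullet> x"
    by (rule Riesz_factored[OF sub linear(2,1) bound norm_ge_zero]) blast
  have "g = x"
  proof (rule hardy_eqI, rule eq_if_inner_eq)
    fix w :: complex and y :: 'a assume w: "w \<in> \<bbbD>"
    have "szego w y \<in> szego_span"
      unfolding szego_span_def using w by (intro span_base) blast
    from x(2)[OF this] show "hardy_fun g w \<bullet> y = hardy_fun x w \<bullet> y"
      by (simp add: inner_commute[of "szego w y"] inner_szego[OF w])
  qed
  with x(1) show "g \<in> closure szego_span"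
    by simp
qed

section \<open>Pairs of Hardy functions\<close>

text \<open>The unitary identification of \<open>H\<^sup>2 \<times> H\<^sup>2\<close> with the Hardy space of the product.\<close>

definition hardy_pair :: "'a::complex_hilbert hardy \<Rightarrow> 'b::complex_hilbert hardy \<Rightarrow> ('a \<times> 'b) hardy"
  where "hardy_pair h k = (SOME l. hardy_coeff l = (\<lambda>n. (hardy_coeff h n, hardy_coeff k n)))"

lemma hardy_coeff_pair: "hardy_coeff (hardy_pair h k) = (\<lambda>n. (hardy_coeff h n, hardy_coeff k n))"
proof -
  have "square_summable (\<lambda>n. (hardy_coeff h n, hardy_coeff k n))"
    unfolding square_summable_def norm_prod_def
    by (simp add: summable_add norm_hardy_coeff_summable)
  then show ?thesis
    unfolding hardy_pair_def by (rule someI_ex[OF hardy_coeff_exists])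
qed

lemma norm_hardy_pair: "(norm (hardy_pair h k))\<^sup>2 = (norm h)\<^sup>2 + (norm k)\<^sup>2"
  unfolding norm_hardy_square hardy_coeff_pair norm_prod_def
  by (simp add: suminf_add norm_hardy_coeff_summable)

lemma hardy_pair_add: "hardy_pair (h + h') (k + k') = hardy_pair h k + hardy_pair h' k'"
  unfolding hardy_coeff_inject[symmetric] by (simp add: hardy_coeff_pair hardy_coeff_add)

lemma hardy_pair_diff: "hardy_pair (h - h') (k - k') = hardy_pair h k - hardy_pair h' k'"
  unfolding hardy_coeff_inject[symmetric] by (simp add: hardy_coeff_pair hardy_coeff_diff)

lemma hardy_pair_scaleR: "hardy_pair (r *\<^sub>R h) (r *\<^sub>R k) = r *\<^sub>R hardy_pair h k"
  unfolding hardy_coeff_inject[symmetric] by (simp add: hardy_coeff_pair hardy_coeff_scaleR)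

lemma hardy_pair_zero: "hardy_pair 0 0 = 0"
  using hardy_pair_scaleR[of 0 0 0] by simp

lemma hardy_pair_szego: "w \<in> \<bbbD> \<Longrightarrow> hardy_pair (szego w x) (szego w y) = szego w (x, y)"
  unfolding hardy_coeff_inject[symmetric] by (simp add: hardy_coeff_pair hardy_coeff_szego scaleC_prod_def)

section \<open>Analytic operator functions\<close>

definition op_differentiable ::
  "(complex \<Rightarrow> 'a::complex_normed_vector \<Rightarrow>\<^sub>C\<^sub>L 'b::complex_normed_vector) \<Rightarrow> complex \<Rightarrow> bool"
  where "op_differentiable F z \<longleftrightarrow> (\<exists>F'. (F has_derivative (\<lambda>w. w *\<^sub>C F')) (at z))"

lemma schurI:
  assumes "\<And>z. z \<in> \<bbbD> \<Longrightarrow> contraction (F z)" "\<And>z. z \<in> \<bbbD> \<Longrightarrow> op_differentiable F z"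
  shows "schur F"
  using assms unfolding schur_def op_differentiable_def by blast

lemma schur_op_differentiable: "schur F \<Longrightarrow> z \<in> \<bbbD> \<Longrightarrow> op_differentiable F z"
  unfolding op_differentiable_def by (rule schur_derivative)

lemma op_differentiable_const: "op_differentiable (\<lambda>_. A) z"
  unfolding op_differentiable_def by (intro exI[of _ 0]) simp

lemma op_differentiable_add:
  assumes "op_differentiable F z" "op_differentiable G z"
  shows "op_differentiable (\<lambda>z. F z + G z) z"
proof -
  obtain F' where F': "(F has_derivative (\<lambda>w. w *\<^sub>C F')) (at z)"
    using assms(1) unfolding op_differentiable_def ..
  obtain G' where G': "(G has_derivative (\<lambda>w. w *\<^sub>C G')) (at z)"
    using assms(2) unfolding op_differentiable_def ..
  have "((\<lambda>z. F z + G z) has_derivative (\<lambda>w. w *\<^sub>C (F' + G'))) (at z)"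
    using has_derivative_add[OF F' G'] by (simp add: scaleC_add_right)
  then show ?thesis
    unfolding op_differentiable_def ..
qed

lemma op_differentiable_compose:
  assumes "op_differentiable A z" "op_differentiable B z"
  shows "op_differentiable (\<lambda>z. A z o\<^sub>C B z) z"
proof -
  obtain A' where A': "(A has_derivative (\<lambda>w. w *\<^sub>C A')) (at z)"
    using assms(1) unfolding op_differentiable_def ..
  obtain B' where B': "(B has_derivative (\<lambda>w. w *\<^sub>C B')) (at z)"
    using assms(2) unfolding op_differentiable_def ..
  have "((\<lambda>z. A z o\<^sub>C B z) has_derivative (\<lambda>w. A z o\<^sub>C (w *\<^sub>C B') + (w *\<^sub>C A') o\<^sub>C B z)) (at z)"
    by (rule bounded_bilinear.FDERIV[OF bounded_bilinear_compose A' B'])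
  also have "(\<lambda>w. A z o\<^sub>C (w *\<^sub>C B') + (w *\<^sub>C A') o\<^sub>C B z) = (\<lambda>w. w *\<^sub>C (A z o\<^sub>C B' + A' o\<^sub>C B z))"
    by (intro ext cblinfun_eqI) (simp add: cblinfun_evals cblinfun_scaleC scaleC_add_right)
  finally show ?thesis
    unfolding op_differentiable_def ..
qed

lemma has_op_derivative_iff_quotient:
  fixes F :: "complex \<Rightarrow> 'a::complex_normed_vector \<Rightarrow>\<^sub>C\<^sub>L 'b::complex_normed_vector"
  shows "(F has_derivative (\<lambda>w. w *\<^sub>C F')) (at z) \<longleftrightarrow>
    ((\<lambda>w. inverse (w - z) *\<^sub>C (F w - F z)) \<longlongrightarrow> F') (at z)"
proof -
  have linear: "bounded_linear (\<lambda>w. w *\<^sub>C F')"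
    by (rule bounded_linear_intro[where K = "norm F'"])
      (auto simp: scaleC_add_left scaleR_scaleC scaleC_scaleC norm_scaleC scaleR_conv_of_real)
  have "norm (F w - F z - (w - z) *\<^sub>C F') / norm (w - z) = norm (inverse (w - z) *\<^sub>C (F w - F z) - F')"
    if "w \<noteq> z" for w
  proof -
    have "inverse (w - z) *\<^sub>C (F w - F z - (w - z) *\<^sub>C F') = inverse (w - z) *\<^sub>C (F w - F z) - F'"
      using that by (simp add: scaleC_diff_right scaleC_scaleC)
    from arg_cong[OF this, of norm] show ?thesis
      by (simp add: norm_scaleC norm_inverse divide_inverse_commute)
  qed
  then have "\<forall>\<^sub>F w in at z. norm (F w - F z - (w - z) *\<^sub>C F') / norm (w - z)
      = norm (inverse (w - z) *\<^sub>C (F w - F z) - F')"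
    by (auto simp: eventually_at_filter)
  from filterlim_cong[OF refl refl this] show ?thesis
    unfolding has_derivative_iff_norm using linear
    by (simp add: tendsto_norm_zero_iff LIM_zero_iff)
qed

text \<open>The derivative of the inverse is \<open>- G K' G\<close>, by the resolvent identity.\<close>

lemma op_differentiable_inverse:
  fixes K G :: "complex \<Rightarrow> 'a::complex_normed_vector \<Rightarrow>\<^sub>C\<^sub>L 'a"
  assumes K: "op_differentiable K z" and S: "open S" "z \<in> S"
    and left: "\<And>w. w \<in> S \<Longrightarrow> G w o\<^sub>C K w = cblinfun_id"
    and right: "\<And>w. w \<in> S \<Longrightarrow> K w o\<^sub>C G w = cblinfun_id"
  shows "op_differentiable G z"
proof -
  obtain K' where K': "(K has_derivative (\<lambda>w. w *\<^sub>C K')) (at z)"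
    using K unfolding op_differentiable_def ..
  have K_lim: "(K \<longlongrightarrow> K z) (at z)"
    using has_derivative_continuous[OF K'] by (simp add: isCont_def)
  \<comment> \<open>The resolvent identity reduces everything to the continuity of \<open>G\<close> at \<open>z\<close>, which in turn
    follows from it once \<open>G\<close> is known to be bounded near \<open>z\<close>.\<close>
  have resolvent: "G w - G z = - (G w o\<^sub>C (K w - K z) o\<^sub>C G z)" if "w \<in> S" for w
    using left[OF that] right[OF S(2)]
    by (simp add: compose.diff_left compose.diff_right compose_id)
      (simp add: cblinfun_compose_assoc compose_id)
  define g where "g = norm (G z)"
  have diff: "((\<lambda>w. norm (K w - K z)) \<longlongrightarrow> 0) (at z)"
    by (rule tendsto_norm_zero[OF LIM_zero[OF K_lim]])
  have "((\<lambda>w. norm (K w - K z) * g) \<longlongrightarrow> 0 * g) (at z)"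
    by (intro tendsto_mult diff tendsto_const)
  then have "\<forall>\<^sub>F w in at z. norm (K w - K z) * g < 1 / 2"
    by (rule order_tendstoD(2)) simp
  moreover have in_S: "\<forall>\<^sub>F w in at z. w \<in> S"
    using S by (rule eventually_at_topological[THEN iffD2, OF exI, OF conjI, OF _ conjI]) simp
  ultimately have G_le: "\<forall>\<^sub>F w in at z. norm (G w - G z) \<le> (2 * g * g) * norm (K w - K z)"
  proof eventually_elim
    case (elim w)
    have le: "norm (G w - G z) \<le> norm (G w) * (norm (K w - K z) * g)"
    proof -
      have "norm (G w - G z) \<le> norm (G w o\<^sub>C (K w - K z)) * g"
        using norm_cblinfun_compose[of "G w o\<^sub>C (K w - K z)" "G z"]
        by (simp add: resolvent[OF elim(2)] g_def)
      also have "\<dots> \<le> norm (G w) * norm (K w - K z) * g"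
        by (intro mult_right_mono norm_cblinfun_compose) (simp add: g_def)
      finally show ?thesis by (simp add: mult.assoc)
    qed
    also have "\<dots> \<le> norm (G w) * (1 / 2)"
      using elim(1) by (intro mult_left_mono) auto
    finally have "norm (G w) \<le> 2 * g"
      using norm_triangle_sub[of "G w" "G z"] by (simp add: g_def)
    then have "norm (G w) * (norm (K w - K z) * g) \<le> (2 * g) * (norm (K w - K z) * g)"
      by (intro mult_right_mono) (auto simp: g_def)
    with le show ?case by (simp add: mult_ac)
  qed
  have "((\<lambda>w. (2 * g * g) * norm (K w - K z)) \<longlongrightarrow> 0) (at z)"
    using tendsto_mult[OF tendsto_const diff] unfolding mult_zero_right .
  with G_le have "((\<lambda>w. G w - G z) \<longlongrightarrow> 0) (at z)"
    by (rule Lim_null_comparison)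
  then have G_lim: "(G \<longlongrightarrow> G z) (at z)"
    by (rule LIM_zero_cancel)
  have "((\<lambda>w. - (G w o\<^sub>C (inverse (w - z) *\<^sub>C (K w - K z)) o\<^sub>C G z)) \<longlongrightarrow> - (G z o\<^sub>C K' o\<^sub>C G z)) (at z)"
    by (rule tendsto_minus[OF compose.tendsto[OF compose.tendsto[OF G_lim
            K'[unfolded has_op_derivative_iff_quotient]] tendsto_const]])
  moreover have "\<forall>\<^sub>F w in at z. - (G w o\<^sub>C (inverse (w - z) *\<^sub>C (K w - K z)) o\<^sub>C G z)
      = inverse (w - z) *\<^sub>C (G w - G z)"
    using in_S
  proof eventually_elim
    case (elim w)
    show ?case
      unfolding resolvent[OF elim]
      by (rule cblinfun_eqI)
        (simp only: cblinfun_compose.rep_eq uminus_cblinfun.rep_eq scaleC_cblinfun.rep_eq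
          cblinfun_scaleC scaleC_minus_right)
  qed
  ultimately have "((\<lambda>w. inverse (w - z) *\<^sub>C (G w - G z)) \<longlongrightarrow> - (G z o\<^sub>C K' o\<^sub>C G z)) (at z)"
    by (rule Lim_transform_eventually)
  then show ?thesis
    unfolding op_differentiable_def has_op_derivative_iff_quotient ..
qed

lemma schur_const: "contraction A \<Longrightarrow> schur (\<lambda>_. A)"
  by (intro schurI op_differentiable_const)

lemma schur_compose:
  assumes A: "schur A" and B: "schur B"
  shows "schur (\<lambda>z. A z o\<^sub>C B z)"
proof (rule schurI)
  fix z :: complex assume z: "z \<in> \<bbbD>"
  show "contraction (A z o\<^sub>C B z)"
    by (rule contraction_compose[OF schur_contraction[OF A z] schur_contraction[OF B z]])
  show "op_differentiable (\<lambda>z. A z o\<^sub>C B z) z"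
    by (rule op_differentiable_compose[OF schur_op_differentiable[OF A z] schur_op_differentiable[OF B z]])
qed

lemma schur_blocks:
  assumes "schur \<Phi>"
  shows "schur (\<lambda>z. block11 (\<Phi> z))" "schur (\<lambda>z. block12 (\<Phi> z))"
    "schur (\<lambda>z. block21 (\<Phi> z))" "schur (\<lambda>z. block22 (\<Phi> z))"
  unfolding block11_def block12_def block21_def block22_def
  by (rule schur_compose[OF schur_compose[OF schur_const assms] schur_const]; rule contraction_block_maps)+

section \<open>The Redheffer map\<close>

text \<open>A form of the Schwarz-Pick lemma that holds uniformly in all directions. The adjoint of the
  multiplication operator is a contraction; applied to a combination of the kernel functions at \<open>0\<close> and
  \<open>z\<close>, this shows that \<open>K(z)\<^sup>* b\<close> can only be almost as long as \<open>b\<close> if it is close to \<open>K(0)\<^sup>* b\<close>.\<close>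

lemma schur_strict_contraction:
  fixes K :: "complex \<Rightarrow> 'a::complex_hilbert \<Rightarrow>\<^sub>C\<^sub>L 'b::complex_hilbert"
  assumes K: "schur K" and K0: "norm (K 0) < 1" and z: "z \<in> \<bbbD>"
  shows "norm (K z) < 1"
proof -
  define \<rho> where "\<rho> = norm (K 0)"
  define s where "s = 1 / (1 - (cmod z)\<^sup>2) - 1"
  define \<delta> where "\<delta> = (1 - \<rho>) / 2"
  define \<epsilon> where "\<epsilon> = min (1 - (\<rho> + \<delta>)\<^sup>2) (\<delta>\<^sup>2 / (s + 1))"
  have \<rho>: "0 \<le> \<rho>" "\<rho> < 1"
    using K0 by (auto simp: \<rho>_def)
  have "(cmod z)\<^sup>2 < 1"
    using z by (simp add: abs_square_less_1)
  then have s: "0 \<le> s"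
    by (simp add: s_def)
  have \<delta>: "0 < \<delta>" "\<delta> \<le> 1 / 2" "0 \<le> \<rho> + \<delta>" "\<rho> + \<delta> < 1"
    using \<rho> by (simp_all add: \<delta>_def field_simps)
  have "(\<rho> + \<delta>)\<^sup>2 < 1"
    using \<delta> by (simp add: abs_square_less_1)
  moreover have "0 < \<delta>\<^sup>2 / (s + 1)"
    using \<delta> s by simp
  moreover have "\<epsilon> \<le> 1 - (\<rho> + \<delta>)\<^sup>2"
    unfolding \<epsilon>_def by (rule min.cobounded1)
  ultimately have \<epsilon>: "0 < \<epsilon>" "\<epsilon> \<le> 1"
    using zero_le_power2[of "\<rho> + \<delta>"] by (simp add: \<epsilon>_def, linarith)
  have contraction: "norm (cadjoint (K z) b) \<le> norm b" for b
    using schur_contraction[OF K z] contraction_cadjoint[of "K z"] by (simp add: contraction_iff)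
  have bound: "(norm (cadjoint (K z) b))\<^sup>2 \<le> (1 - \<epsilon>) * (norm b)\<^sup>2" for b
  proof -
    define x where "x = norm (cadjoint (K z) b)"
    have x: "0 \<le> x" "x \<le> norm b"
      using contraction by (auto simp: x_def)
    define T where "T = cadjoint (mult_op K)"
    \<comment> \<open>With these two vectors the constant terms of \<open>v\<close> cancel, and those of \<open>T v\<close> measure the
      distance between \<open>K(z)\<^sup>* b\<close> and \<open>K(0)\<^sup>* b\<close>.\<close>
    have "T (szego 0 (- b) + szego z b) = szego 0 (- cadjoint (K 0) b) + szego z (cadjoint (K z) b)"
      using z by (simp add: T_def cblinfun_add cadjoint_mult_op_szego K cblinfun_minus)
    moreover have "norm (T (szego 0 (- b) + szego z b)) \<le> norm (szego 0 (- b) + szego z b)"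
      using contraction_mult_op[OF K] contraction_cadjoint[of "mult_op K"]
      by (simp add: T_def contraction_iff)
    ultimately have "(norm (szego 0 (- cadjoint (K 0) b) + szego z (cadjoint (K z) b)))\<^sup>2
        \<le> (norm (szego 0 (- b) + szego z b))\<^sup>2"
      by (simp add: power_mono)
    then have key: "(norm (cadjoint (K z) b - cadjoint (K 0) b))\<^sup>2 + s * x\<^sup>2 \<le> s * (norm b)\<^sup>2"
      unfolding norm_szego_pair[OF z] by (simp add: s_def x_def)
    \<comment> \<open>Either \<open>K(z)\<^sup>* b\<close> is as short as \<open>K(0)\<^sup>* b\<close> up to \<open>\<delta>\<close>, or the two vectors are far apart.\<close>
    show ?thesis
    proof (cases "x \<le> (\<rho> + \<delta>) * norm b")
      case True
      then have "x\<^sup>2 \<le> (\<rho> + \<delta>)\<^sup>2 * (norm b)\<^sup>2"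
        using x power_mono[OF True, of 2] by (simp add: power_mult_distrib)
      also have "\<dots> \<le> (1 - \<epsilon>) * (norm b)\<^sup>2"
        by (intro mult_right_mono) (auto simp: \<epsilon>_def min_def)
      finally show ?thesis by (simp add: x_def)
    next
      case False
      have "norm (cadjoint (K 0) b) \<le> \<rho> * norm b"
        using norm_cblinfun[of "cadjoint (K 0)" b] by (simp add: \<rho>_def norm_cadjoint)
      then have "\<delta> * norm b \<le> norm (cadjoint (K z) b - cadjoint (K 0) b)"
        using False norm_triangle_ineq2[of "cadjoint (K z) b" "cadjoint (K 0) b"]
        by (simp add: x_def algebra_simps)
      then have "(\<delta> * norm b)\<^sup>2 \<le> (norm (cadjoint (K z) b - cadjoint (K 0) b))\<^sup>2"
        using \<delta> by (intro power_mono) auto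
      moreover have "x\<^sup>2 \<le> (norm b)\<^sup>2"
        using x by (intro power_mono)
      ultimately have "(s + 1) * x\<^sup>2 \<le> (s + 1 - \<delta>\<^sup>2) * (norm b)\<^sup>2"
        using key by (simp add: power_mult_distrib algebra_simps)
      then have "x\<^sup>2 \<le> (s + 1 - \<delta>\<^sup>2) * (norm b)\<^sup>2 / (s + 1)"
        using s by (simp add: pos_le_divide_eq mult.commute)
      also have "\<dots> = (1 - \<delta>\<^sup>2 / (s + 1)) * (norm b)\<^sup>2"
        using s by (simp add: field_simps)
      also have "\<dots> \<le> (1 - \<epsilon>) * (norm b)\<^sup>2"
        by (intro mult_right_mono) (auto simp: \<epsilon>_def min_def)
      finally show ?thesis by (simp add: x_def)
    qed
  qed
  have "norm (cadjoint (K z)) \<le> sqrt (1 - \<epsilon>)"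
    by (rule norm_cblinfun_bound_sqrt[OF _ bound]) (simp add: \<epsilon>)
  also have "\<dots> < 1"
    using \<epsilon> by simp
  finally show ?thesis by (simp add: norm_cadjoint)
qed

text \<open>The equation \<open>x = K x + y\<close> has a unique solution by Banach's fixed point theorem.\<close>

lemma cinverse_id_minus:
  fixes K :: "'a::complex_hilbert \<Rightarrow>\<^sub>C\<^sub>L 'a"
  assumes K: "norm K < 1"
  shows "(cblinfun_id - K) o\<^sub>C cinverse (cblinfun_id - K) = cblinfun_id"
    and "cinverse (cblinfun_id - K) o\<^sub>C (cblinfun_id - K) = cblinfun_id"
proof -
  have "\<exists>!x. K x + y = x" for y
  proof (rule banach_fix_type)
    show "\<forall>x x'. dist (K x + y) (K x' + y) \<le> norm K * dist x x'"
      using norm_cblinfun[of K] by (auto simp: dist_norm simp flip: cblinfun_diff)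
  qed (use K in auto)
  then obtain G where G: "\<And>y. K (G y) + y = G y" and unique: "\<And>x y. K x + y = x \<Longrightarrow> x = G y"
    by metis
  have G_add: "G (x + y) = G x + G y" for x y
    by (rule unique[symmetric]) (use G[of x] G[of y] in \<open>simp add: cblinfun_add add_ac\<close>, metis G add.assoc add.commute add.left_commute)
  have G_scale: "G (c *\<^sub>C x) = c *\<^sub>C G x" for c x
    by (rule unique[symmetric]) (simp add: cblinfun_scaleC G flip: scaleC_add_right)
  have "bounded_linear G"
  proof (rule bounded_linear_intro[where K = "1 / (1 - norm K)"])
    show "norm (G y) \<le> norm y * (1 / (1 - norm K))" for y
    proof -
      have "norm (G y) \<le> norm (K (G y)) + norm y"
        by (subst G[symmetric]) (rule norm_triangle_ineq)
      then have "(1 - norm K) * norm (G y) \<le> norm y"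
        using norm_cblinfun[of K "G y"] by (simp add: algebra_simps)
      then show ?thesis
        using K by (simp add: pos_le_divide_eq mult.commute)
    qed
  qed (auto simp: G_add G_scale scaleR_scaleC)
  then have apply_G: "cblinfun_apply (CBlinfun G) = G"
    by (simp add: CBlinfun_inverse G_scale)
  define B where "B = CBlinfun G"
  have diff: "G x - K (G x) = x" for x
    by (subst (1) G[symmetric]) simp
  have B: "(cblinfun_id - K) o\<^sub>C B = cblinfun_id" "B o\<^sub>C (cblinfun_id - K) = cblinfun_id"
  proof -
    show "(cblinfun_id - K) o\<^sub>C B = cblinfun_id"
      by (rule cblinfun_eqI) (simp add: B_def cblinfun_evals apply_G diff)
    show "B o\<^sub>C (cblinfun_id - K) = cblinfun_id"
      by (rule cblinfun_eqI) (simp add: B_def cblinfun_evals apply_G unique[symmetric])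
  qed
  have "cinverse (cblinfun_id - K) = B"
    unfolding cinverse_def
  proof (rule the_equality)
    fix C assume C: "(cblinfun_id - K) o\<^sub>C C = cblinfun_id \<and> C o\<^sub>C (cblinfun_id - K) = cblinfun_id"
    have "C = C o\<^sub>C ((cblinfun_id - K) o\<^sub>C B)"
      by (simp only: B compose_id)
    also have "\<dots> = B"
      using C by (simp only: cblinfun_compose_assoc[symmetric] compose_id)
    finally show "C = B" .
  qed (use B in simp)
  with B show "(cblinfun_id - K) o\<^sub>C cinverse (cblinfun_id - K) = cblinfun_id"
    and "cinverse (cblinfun_id - K) o\<^sub>C (cblinfun_id - K) = cblinfun_id"
    by simp_all
qed

lemma redheffer_inverse:
  fixes \<Phi> :: "complex \<Rightarrow> 'f::complex_hilbert \<times> 'u::complex_hilbert \<Rightarrow>\<^sub>C\<^sub>L 'e::complex_hilbert \<times> 'y::complex_hilbert"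
    and F :: "complex \<Rightarrow> 'e \<Rightarrow>\<^sub>C\<^sub>L 'f"
  assumes \<Phi>: "schur \<Phi>" and F: "schur F" and strict: "norm (block11 (\<Phi> 0) o\<^sub>C F 0) < 1"
    and z: "z \<in> \<bbbD>"
  shows "(cblinfun_id - block11 (\<Phi> z) o\<^sub>C F z) o\<^sub>C cinverse (cblinfun_id - block11 (\<Phi> z) o\<^sub>C F z) = cblinfun_id"
    and "cinverse (cblinfun_id - block11 (\<Phi> z) o\<^sub>C F z) o\<^sub>C (cblinfun_id - block11 (\<Phi> z) o\<^sub>C F z) = cblinfun_id"
proof -
  have "schur (\<lambda>z. block11 (\<Phi> z) o\<^sub>C F z)"
    by (rule schur_compose[OF schur_blocks(1)[OF \<Phi>] F])
  from cinverse_id_minus[OF schur_strict_contraction[OF this strict z]]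
  show "(cblinfun_id - block11 (\<Phi> z) o\<^sub>C F z) o\<^sub>C cinverse (cblinfun_id - block11 (\<Phi> z) o\<^sub>C F z) = cblinfun_id"
    and "cinverse (cblinfun_id - block11 (\<Phi> z) o\<^sub>C F z) o\<^sub>C (cblinfun_id - block11 (\<Phi> z) o\<^sub>C F z) = cblinfun_id" .
qed

text \<open>With \<open>e = G \<Phi>\<^sub>1\<^sub>2 u\<close>, the contraction \<open>A\<close> maps \<open>(F e, u)\<close> to \<open>(e, R u)\<close>, and \<open>F\<close> does not increase norms.\<close>

lemma contraction_redheffer:
  assumes A: "contraction A" and F: "contraction F"
    and right: "(cblinfun_id - block11 A o\<^sub>C F) o\<^sub>C G = cblinfun_id"
  shows "contraction (block22 A + block21 A o\<^sub>C F o\<^sub>C G o\<^sub>C block12 A)"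
  unfolding contraction_iff
proof
  fix u
  let ?R = "block22 A + block21 A o\<^sub>C F o\<^sub>C G o\<^sub>C block12 A"
  define e where "e = G (block12 A u)"
  have "((cblinfun_id - block11 A o\<^sub>C F) o\<^sub>C G) (block12 A u) = block12 A u"
    unfolding right by (simp add: cblinfun_evals)
  then have "e - block11 A (F e) = block12 A u"
    by (simp only: e_def cblinfun_evals)
  then have "block11 A (F e) + block12 A u = e"
    by (metis add.commute diff_eq_eq)
  moreover have "block21 A (F e) + block22 A u = ?R u"
    by (simp only: e_def cblinfun_evals add.commute)
  ultimately have "A (F e, u) = (e, ?R u)"
    by (simp only: block_apply)
  moreover have "norm (A (F e, u)) \<le> norm (F e, u)"
    using A by (simp add: contraction_iff)
  ultimately have "(norm e)\<^sup>2 + (norm (?R u))\<^sup>2 \<le> (norm (F e))\<^sup>2 + (norm u)\<^sup>2"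
    by (simp add: norm_prod_def)
  moreover have "(norm (F e))\<^sup>2 \<le> (norm e)\<^sup>2"
    using F by (simp add: contraction_iff power_mono)
  ultimately have "(norm (?R u))\<^sup>2 \<le> (norm u)\<^sup>2"
    by linarith
  then show "norm (?R u) \<le> norm u"
    by (rule power2_le_imp_le) simp
qed

lemma schur_redheffer:
  assumes \<Phi>: "schur \<Phi>" and F: "schur F" and strict: "norm (block11 (\<Phi> 0) o\<^sub>C F 0) < 1"
  shows "schur (redheffer \<Phi> F)"
proof (rule schurI)
  fix z assume z: "z \<in> \<bbbD>"
  note inverse = redheffer_inverse[OF assms]
  show "contraction (redheffer \<Phi> F z)"
    unfolding redheffer_def
    by (rule contraction_redheffer[OF schur_contraction[OF \<Phi> z] schur_contraction[OF F z] inverse(1)[OF z]])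
  note blocks = schur_blocks[OF \<Phi>, THEN schur_op_differentiable, OF z]
  have K: "op_differentiable (\<lambda>z. cblinfun_id + (- cblinfun_id) o\<^sub>C (block11 (\<Phi> z) o\<^sub>C F z)) z"
    by (rule op_differentiable_add[OF op_differentiable_const op_differentiable_compose[OF op_differentiable_const
            op_differentiable_compose[OF blocks(1) schur_op_differentiable[OF F z]]]])
  have "(\<lambda>z. cblinfun_id + (- cblinfun_id) o\<^sub>C (block11 (\<Phi> z) o\<^sub>C F z))
      = (\<lambda>z. cblinfun_id - block11 (\<Phi> z) o\<^sub>C F z)"
    by (intro ext cblinfun_eqI) (simp add: cblinfun_evals)
  with K have "op_differentiable (\<lambda>z. cblinfun_id - block11 (\<Phi> z) o\<^sub>C F z) z"
    by simp
  then have G: "op_differentiable (\<lambda>z. cinverse (cblinfun_id - block11 (\<Phi> z) o\<^sub>C F z)) z"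
    by (rule op_differentiable_inverse[OF _ open_ball z inverse(2,1)])
  show "op_differentiable (redheffer \<Phi> F) z"
    unfolding redheffer_def[abs_def]
    by (rule op_differentiable_add[OF blocks(4) op_differentiable_compose[OF op_differentiable_compose[OF
              op_differentiable_compose[OF blocks(3) schur_op_differentiable[OF F z]] G] blocks(2)]])
qed

text \<open>The adjoint of a Redheffer transform is obtained by closing the feedback loop of the adjoints: the
  first component of the output of \<open>A\<^sup>*\<close> is fed back through \<open>F\<^sup>*\<close>.\<close>

lemma redheffer_adjoint:
  fixes A :: "'f::complex_hilbert \<times> 'u::complex_hilbert \<Rightarrow>\<^sub>C\<^sub>L 'e::complex_hilbert \<times> 'y::complex_hilbert"
    and F :: "'e \<Rightarrow>\<^sub>C\<^sub>L 'f"
  assumes left: "G o\<^sub>C (cblinfun_id - block11 A o\<^sub>C F) = cblinfun_id"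
  obtains x where "cadjoint A (cadjoint F x, y)
    = (x, cadjoint (block22 A + block21 A o\<^sub>C F o\<^sub>C G o\<^sub>C block12 A) y)"
proof
  define R where "R = block22 A + block21 A o\<^sub>C F o\<^sub>C G o\<^sub>C block12 A"
  \<comment> \<open>\<open>H\<^sup>* = (I - \<Phi>\<^sub>1\<^sub>1\<^sup>* F\<^sup>*)\<^sup>-\<^sup>1 \<Phi>\<^sub>2\<^sub>1\<^sup>*\<close> in the notation of the Redheffer map.\<close>
  define H where "H = block21 A o\<^sub>C (cblinfun_id + F o\<^sub>C G o\<^sub>C block11 A)"
  have GK: "G (block11 A (F e)) = G e - e" for e
  proof -
    have "(G o\<^sub>C (cblinfun_id - block11 A o\<^sub>C F)) e = e"
      unfolding left by (simp add: cblinfun_evals)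
    then show ?thesis
      by (simp add: cblinfun_evals cblinfun_diff algebra_simps)
  qed
  have eq: "H (F (block11 A x + block12 A u)) + (block21 A x + block22 A u) = H x + R u" for x u
    by (simp add: H_def R_def cblinfun_evals cblinfun_add GK cblinfun_diff)
  show "cadjoint A (cadjoint F (cadjoint H y), y) = (cadjoint H y, cadjoint R y)"
  proof (rule eq_if_inner_eq)
    fix p :: "'f \<times> 'u"
    obtain x u where p: "p = (x, u)" by (rule prod.exhaust)
    have "p \<bullet> cadjoint A (cadjoint F (cadjoint H y), y) = A p \<bullet> (cadjoint F (cadjoint H y), y)"
      by (rule cadjoint_inner[symmetric])
    also have "\<dots> = (H (F (block11 A x + block12 A u)) + (block21 A x + block22 A u)) \<bullet> y"
      by (simp add: p block_apply inner_prod_def inner_add_left flip: cadjoint_inner)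
    also have "\<dots> = p \<bullet> (cadjoint H y, cadjoint R y)"
      unfolding eq by (simp add: p inner_prod_def inner_add_left flip: cadjoint_inner)
    finally show "cadjoint A (cadjoint F (cadjoint H y), y) \<bullet> p = (cadjoint H y, cadjoint R y) \<bullet> p"
      by (simp only: inner_commute[of _ p])
  qed
qed

section \<open>Transfer of equivalence\<close>

text \<open>The preceding lemma lifted to \<open>H\<^sup>2\<close>. For a kernel function \<open>v\<close> the feedback equation is solved at one
  point, and solvability is a linear condition on \<open>v\<close>.\<close>

lemma redheffer_solution:
  fixes \<Phi> :: "complex \<Rightarrow> 'f::complex_hilbert \<times> 'u::complex_hilbert \<Rightarrow>\<^sub>C\<^sub>L 'e::complex_hilbert \<times> 'y::complex_hilbert"
  assumes \<Phi>: "schur \<Phi>" and F: "schur F" and strict: "norm (block11 (\<Phi> 0) o\<^sub>C F 0) < 1"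
    and v: "v \<in> szego_span"
  obtains f where "cadjoint (mult_op \<Phi>) (hardy_pair (cadjoint (mult_op F) f) v)
    = hardy_pair f (cadjoint (mult_op (redheffer \<Phi> F)) v)"
proof -
  define \<Psi> where "\<Psi> = cadjoint (mult_op \<Phi>)"
  define a where "a = cadjoint (mult_op F)"
  define p where "p = cadjoint (mult_op (redheffer \<Phi> F))"
  define S where "S = {v. \<exists>f. \<Psi> (hardy_pair (a f) v) = hardy_pair f (p v)}"
  have "szego_span \<subseteq> S"
    unfolding szego_span_def
  proof (rule span_minimal)
    show "{szego w y |w y. w \<in> \<bbbD>} \<subseteq> S"
    proof
      fix v :: "'y hardy" assume "v \<in> {szego w y |w y. w \<in> \<bbbD>}"
      then obtain w and y :: 'y where w: "w \<in> \<bbbD>" and v: "v = szego w y"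
        by blast
      obtain x where x: "cadjoint (\<Phi> w) (cadjoint (F w) x, y) = (x, cadjoint (redheffer \<Phi> F w) y)"
        unfolding redheffer_def by (rule redheffer_adjoint[OF redheffer_inverse(2)[OF \<Phi> F strict w]])
      have "\<Psi> (hardy_pair (a (szego w x)) v) = hardy_pair (szego w x) (p v)"
        unfolding \<Psi>_def a_def p_def v cadjoint_mult_op_szego[OF F w] hardy_pair_szego[OF w]
          cadjoint_mult_op_szego[OF \<Phi> w] cadjoint_mult_op_szego[OF schur_redheffer[OF \<Phi> F strict] w] x ..
      then show "v \<in> S"
        unfolding S_def by blast
    qed
    show "subspace S"
      unfolding subspace_def
    proof (intro conjI ballI allI)
      show "0 \<in> S"
        by (auto simp: S_def cblinfun_zero hardy_pair_zero intro!: exI[of _ 0])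
      fix v assume "v \<in> S"
      then obtain f where f: "\<Psi> (hardy_pair (a f) v) = hardy_pair f (p v)"
        by (auto simp: S_def)
      have "\<Psi> (hardy_pair (a (c *\<^sub>R f)) (c *\<^sub>R v)) = hardy_pair (c *\<^sub>R f) (p (c *\<^sub>R v))" for c
        by (simp add: cblinfun_scaleR hardy_pair_scaleR f)
      then show "c *\<^sub>R v \<in> S" for c
        unfolding S_def by blast
      fix v' assume "v' \<in> S"
      then obtain f' where f': "\<Psi> (hardy_pair (a f') v') = hardy_pair f' (p v')"
        by (auto simp: S_def)
      have "\<Psi> (hardy_pair (a (f + f')) (v + v')) = hardy_pair (f + f') (p (v + v'))"
        by (simp add: cblinfun_add hardy_pair_add f f')
      then show "v + v' \<in> S"
        unfolding S_def by blast
    qed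
  qed
  with v have "v \<in> S" by blast
  then show thesis
    using that by (auto simp: S_def \<Psi>_def a_def p_def)
qed

text \<open>The Redheffer map preserves domination with the same constant. If \<open>f\<close> and \<open>g\<close> solve the feedback
  equations for \<open>v\<close> with \<open>F\<close> and \<open>G\<close>, and \<open>h\<close> solves that for \<open>y\<close> with \<open>G\<close>, then \<open>\<Psi>\<close> maps the pair
  of \<open>(a - b) f + b w\<close> and \<open>y\<close> to the pair of \<open>w = f - g + h\<close> and \<open>(p - q) v + q y\<close>. Contractivity of \<open>\<Psi>\<close>
  yields the claim on the span of the kernel functions, and continuity everywhere.\<close>

lemma defect_dominated_redheffer:
  assumes \<Phi>: "schur \<Phi>" and F: "schur F" and G: "schur G"
    and F0: "norm (block11 (\<Phi> 0) o\<^sub>C F 0) < 1" and G0: "norm (block11 (\<Phi> 0) o\<^sub>C G 0) < 1"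
    and K: "K \<ge> 0" and dom: "defect_dominated K (cadjoint (mult_op F)) (cadjoint (mult_op G))"
  shows "defect_dominated K (cadjoint (mult_op (redheffer \<Phi> F))) (cadjoint (mult_op (redheffer \<Phi> G)))"
proof -
  define \<Psi> where "\<Psi> = cadjoint (mult_op \<Phi>)"
  define a where "a = cadjoint (mult_op F)"
  define b where "b = cadjoint (mult_op G)"
  define p where "p = cadjoint (mult_op (redheffer \<Phi> F))"
  define q where "q = cadjoint (mult_op (redheffer \<Phi> G))"
  have \<Psi>_le: "(norm (\<Psi> h))\<^sup>2 \<le> (norm h)\<^sup>2" for h
    using contraction_mult_op[OF \<Phi>] contraction_cadjoint[of "mult_op \<Phi>"]
    by (intro power_mono) (simp_all add: \<Psi>_def contraction_iff)
  define P where "P v y \<longleftrightarrow> (norm (p v - q v + q y))\<^sup>2 \<le> (norm y)\<^sup>2 + K * ((norm v)\<^sup>2 - (norm (p v))\<^sup>2)" for v y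
  have dense: "P v y" if v: "v \<in> szego_span" and y: "y \<in> szego_span" for v y
  proof -
    obtain f where f: "\<Psi> (hardy_pair (a f) v) = hardy_pair f (p v)"
      unfolding \<Psi>_def a_def p_def by (rule redheffer_solution[OF \<Phi> F F0 v])
    obtain g where g: "\<Psi> (hardy_pair (b g) v) = hardy_pair g (q v)"
      unfolding \<Psi>_def b_def q_def by (rule redheffer_solution[OF \<Phi> G G0 v])
    obtain h where h: "\<Psi> (hardy_pair (b h) y) = hardy_pair h (q y)"
      unfolding \<Psi>_def b_def q_def by (rule redheffer_solution[OF \<Phi> G G0 y])
    define w where "w = f - g + h"
    define k where "k = a f - b f"
    \<comment> \<open>The same combination of the three solved equations produces \<open>p v - q v + q y\<close> on the right.\<close>
    have "\<Psi> (hardy_pair (a f - b g + b h) (v - v + y)) = hardy_pair (f - g + h) (p v - q v + q y)"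
      unfolding hardy_pair_add hardy_pair_diff cblinfun_add cblinfun_diff f g h ..
    moreover have "a f - b g + b h = k + b w"
      by (simp add: k_def w_def cblinfun_add cblinfun_diff)
    ultimately have "\<Psi> (hardy_pair (k + b w) y) = hardy_pair w (p v - q v + q y)"
      by (simp add: w_def)
    then have "(norm w)\<^sup>2 + (norm (p v - q v + q y))\<^sup>2 \<le> (norm (k + b w))\<^sup>2 + (norm y)\<^sup>2"
      using \<Psi>_le[of "hardy_pair (k + b w) y"] by (simp add: norm_hardy_pair)
    moreover have "(norm (k + b w))\<^sup>2 \<le> (norm w)\<^sup>2 + K * ((norm f)\<^sup>2 - (norm (a f))\<^sup>2)"
      using dom by (simp add: defect_dominated_def defect_sq_def a_def b_def k_def)
    moreover have "(norm f)\<^sup>2 + (norm (p v))\<^sup>2 \<le> (norm (a f))\<^sup>2 + (norm v)\<^sup>2"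
      using \<Psi>_le[of "hardy_pair (a f) v"] by (simp add: f norm_hardy_pair)
    then have "K * ((norm f)\<^sup>2 - (norm (a f))\<^sup>2) \<le> K * ((norm v)\<^sup>2 - (norm (p v))\<^sup>2)"
      by (intro mult_left_mono K) simp
    ultimately show ?thesis
      unfolding P_def by linarith
  qed
  note continuous = continuous_intros cblinfun_continuous_on[of UNIV, THEN continuous_on_compose2]
  have extend_v: "P v y" if y: "y \<in> szego_span" for v y
  proof -
    have "closure szego_span \<subseteq> {v. P v y}"
    proof (rule closure_minimal)
      show "closed {v. P v y}"
        unfolding P_def by (intro closed_Collect_le continuous) auto
    qed (use dense y in blast)
    then show ?thesis
      unfolding szego_span_dense by blast
  qed
  have "P v y" for v y
  proof -
    have "closure szego_span \<subseteq> {y. P v y}"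
    proof (rule closure_minimal)
      show "closed {y. P v y}"
        unfolding P_def by (intro closed_Collect_le continuous) auto
    qed (use extend_v in blast)
    then show ?thesis
      unfolding szego_span_dense by blast
  qed
  then show ?thesis
    unfolding defect_dominated_def P_def defect_sq_def p_def q_def by blast
qed

text \<open>\<open>norm (C A) < 1\<close> says that the defect of \<open>A\<^sup>* C\<^sup>*\<close> at \<open>e\<close> is at least a fixed multiple of
  \<open>norm e\<^sup>2\<close>, and a comparison of the defects of \<open>A\<^sup>*\<close> and \<open>B\<^sup>*\<close> passes this on to \<open>B\<close>.\<close>

lemma strict_contraction_transfer:
  fixes C :: "'f::complex_hilbert \<Rightarrow>\<^sub>C\<^sub>L 'e::complex_hilbert" and A B :: "'a::complex_hilbert \<Rightarrow>\<^sub>C\<^sub>L 'f"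
  assumes C: "contraction C" and c: "c \<ge> 1"
    and le: "\<And>x. defect_sq (cadjoint A) x \<le> c * defect_sq (cadjoint B) x"
    and A: "norm (C o\<^sub>C A) < 1"
  shows "norm (C o\<^sub>C B) < 1"
proof -
  define \<rho> where "\<rho> = norm (C o\<^sub>C A)"
  define \<epsilon> where "\<epsilon> = (1 - \<rho>\<^sup>2) / c"
  have \<rho>: "0 \<le> \<rho>" "\<rho>\<^sup>2 < 1"
    using A by (auto simp: \<rho>_def abs_square_less_1)
  have "1 - \<rho>\<^sup>2 \<le> 1 * c"
    using c zero_le_power2[of \<rho>] by linarith
  then have \<epsilon>: "0 < \<epsilon>" "\<epsilon> \<le> 1"
    using \<rho> c by (auto simp: \<epsilon>_def pos_divide_le_eq)
  have "(norm (cadjoint (C o\<^sub>C B) e))\<^sup>2 \<le> (1 - \<epsilon>) * (norm e)\<^sup>2" for e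
  proof -
    define x where "x = cadjoint C e"
    have "norm (cadjoint A x) \<le> \<rho> * norm e"
      using norm_cblinfun[of "cadjoint (C o\<^sub>C A)" e]
      by (simp add: cadjoint_compose x_def \<rho>_def norm_cadjoint)
    then have "(norm (cadjoint A x))\<^sup>2 \<le> \<rho>\<^sup>2 * (norm e)\<^sup>2"
      using power_mono[of _ _ 2] by (fastforce simp: power_mult_distrib)
    moreover have x: "(norm x)\<^sup>2 \<le> (norm e)\<^sup>2"
      using C contraction_cadjoint[of C] by (intro power_mono) (simp_all add: x_def contraction_iff)
    moreover have "(norm e)\<^sup>2 - (norm x)\<^sup>2 \<le> c * ((norm e)\<^sup>2 - (norm x)\<^sup>2)"
      using mult_right_mono[OF c, of "(norm e)\<^sup>2 - (norm x)\<^sup>2"] x by simp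
    moreover have "(norm x)\<^sup>2 - (norm (cadjoint A x))\<^sup>2 \<le> c * ((norm x)\<^sup>2 - (norm (cadjoint B x))\<^sup>2)"
      using le[of x] by (simp add: defect_sq_def)
    \<comment> \<open>The defect of \<open>A\<^sup>* C\<^sup>*\<close> at \<open>e\<close> is that of \<open>C\<^sup>*\<close> at \<open>e\<close> plus that of \<open>A\<^sup>*\<close> at \<open>x\<close>,
      and likewise for \<open>B\<close>; as \<open>c \<ge> 1\<close>, the first summand does not spoil the comparison.\<close>
    ultimately have "(1 - \<rho>\<^sup>2) * (norm e)\<^sup>2 \<le> c * ((norm e)\<^sup>2 - (norm (cadjoint B x))\<^sup>2)"
      by (simp add: algebra_simps)
    then have "\<epsilon> * (norm e)\<^sup>2 \<le> (norm e)\<^sup>2 - (norm (cadjoint B x))\<^sup>2"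
      using c by (simp add: \<epsilon>_def pos_divide_le_eq mult.commute)
    then show ?thesis
      by (simp add: cadjoint_compose x_def algebra_simps)
  qed
  then have "norm (cadjoint (C o\<^sub>C B)) \<le> sqrt (1 - \<epsilon>)"
    by (rule norm_cblinfun_bound_sqrt[rotated]) (simp add: \<epsilon>)
  also have "\<dots> < 1"
    using \<epsilon> by simp
  finally show ?thesis by (simp add: norm_cadjoint)
qed

lemma schur_equiv_defect_dominated:
  assumes "F \<sim>\<^sub>\<infinity> G"
  obtains K where "K \<ge> 0" "defect_dominated K (cadjoint (mult_op F)) (cadjoint (mult_op G))"
    "defect_dominated K (cadjoint (mult_op G)) (cadjoint (mult_op F))"
proof -
  have prec: "mult_op F \<prec> mult_op G" "mult_op G \<prec> mult_op F" and schur: "schur F" "schur G"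
    using assms by (auto simp: schur_equiv_def schur_prec_def)
  obtain K where K: "K \<ge> 0" "defect_dominated K (cadjoint (mult_op F)) (cadjoint (mult_op G))"
    by (rule op_prec_imp_defect_dominated[OF prec])
  obtain L where L: "L \<ge> 0" "defect_dominated L (cadjoint (mult_op G)) (cadjoint (mult_op F))"
    by (rule op_prec_imp_defect_dominated[OF prec(2,1)])
  have contraction: "contraction (cadjoint (mult_op F))" "contraction (cadjoint (mult_op G))"
    using schur by (simp_all add: contraction_cadjoint contraction_mult_op)
  show thesis
  proof (rule that)
    show "0 \<le> max K L"
      using K(1) by (rule max.coboundedI1)
    show "defect_dominated (max K L) (cadjoint (mult_op F)) (cadjoint (mult_op G))"
      by (rule defect_dominated_mono[OF contraction(1) max.cobounded1 K(2)])
    show "defect_dominated (max K L) (cadjoint (mult_op G)) (cadjoint (mult_op F))"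
      by (rule defect_dominated_mono[OF contraction(2) max.cobounded2 L(2)])
  qed
qed

lemma redheffer_schur_prec:
  assumes \<Phi>: "schur \<Phi>" and F: "schur F" and G: "schur G"
    and F0: "norm (block11 (\<Phi> 0) o\<^sub>C F 0) < 1" and G0: "norm (block11 (\<Phi> 0) o\<^sub>C G 0) < 1"
    and equiv: "F \<sim>\<^sub>\<infinity> G"
  shows "redheffer \<Phi> F \<prec>\<^sub>\<infinity> redheffer \<Phi> G"
proof -
  obtain K where K: "K \<ge> 0" "defect_dominated K (cadjoint (mult_op F)) (cadjoint (mult_op G))"
    "defect_dominated K (cadjoint (mult_op G)) (cadjoint (mult_op F))"
    by (rule schur_equiv_defect_dominated[OF equiv])
  have schur: "schur (redheffer \<Phi> F)" "schur (redheffer \<Phi> G)"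
    by (rule schur_redheffer[OF \<Phi> F F0] schur_redheffer[OF \<Phi> G G0])+
  have "mult_op (redheffer \<Phi> F) \<prec> mult_op (redheffer \<Phi> G)"
    by (rule op_prec_of_defect_dominated[OF contraction_mult_op[OF schur(1)] contraction_mult_op[OF schur(2)] K(1)
          defect_dominated_redheffer[OF \<Phi> F G F0 G0 K(1,2)] defect_dominated_redheffer[OF \<Phi> G F G0 F0 K(1,3)]])
  with schur show ?thesis
    by (simp add: schur_prec_def)
qed

text \<open>On the constant functions \<open>szego 0 x\<close> the adjoints of the multiplication operators are \<open>F(0)\<^sup>*\<close> and
  \<open>G(0)\<^sup>*\<close>, so that the comparison of defects descends to the values at \<open>0\<close>.\<close>

lemma schur_equiv_strict:
  assumes \<Phi>: "schur \<Phi>" and equiv: "F \<sim>\<^sub>\<infinity> G" and F0: "norm (block11 (\<Phi> 0) o\<^sub>C F 0) < 1"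
  shows "norm (block11 (\<Phi> 0) o\<^sub>C G 0) < 1"
proof -
  have schur: "schur F" "schur G"
    using equiv by (auto simp: schur_equiv_def schur_prec_def)
  then have contraction: "contraction (cadjoint (mult_op F))" "contraction (cadjoint (mult_op G))"
    by (simp_all add: contraction_cadjoint contraction_mult_op)
  obtain K where K: "K \<ge> 0" "defect_dominated K (cadjoint (mult_op G)) (cadjoint (mult_op F))"
    by (rule schur_equiv_defect_dominated[OF equiv])
  have "contraction (block11 (\<Phi> 0))"
    by (rule schur_contraction[OF schur_blocks(1)[OF \<Phi>]]) simp
  then show ?thesis
  proof (rule strict_contraction_transfer[OF _ _ _ F0])
    show "defect_sq (cadjoint (F 0)) x \<le> (2 + 6 * K) * defect_sq (cadjoint (G 0)) x" for x
      using defect_sq_le_of_dominated[OF contraction(2,1) K, of "szego 0 x"]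
      by (simp add: defect_sq_szego_zero schur)
  qed (use K in simp)
qed

theorem theorem0p3:
  fixes \<Phi> :: "complex \<Rightarrow> 'f::complex_hilbert \<times> 'u::complex_hilbert \<Rightarrow>\<^sub>C\<^sub>L 'e::complex_hilbert \<times> 'y::complex_hilbert"
    and F\<^sub>1 F\<^sub>2 :: "complex \<Rightarrow> 'e \<Rightarrow>\<^sub>C\<^sub>L 'f"
  assumes "separable_space (euclidean :: 'u topology)"
    and "separable_space (euclidean :: 'y topology)"
    and "separable_space (euclidean :: 'e topology)"
    and "separable_space (euclidean :: 'f topology)"
    and "schur \<Phi>"
    and "schur F\<^sub>1" and "schur F\<^sub>2"
    and "F\<^sub>1 \<sim>\<^sub>\<infinity> F\<^sub>2"
  shows "(norm (block11 (\<Phi> 0) o\<^sub>C F\<^sub>1 0) < 1 \<longleftrightarrow> norm (block11 (\<Phi> 0) o\<^sub>C F\<^sub>2 0) < 1) \<and>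
    (norm (block11 (\<Phi> 0) o\<^sub>C F\<^sub>1 0) < 1 \<and> norm (block11 (\<Phi> 0) o\<^sub>C F\<^sub>2 0) < 1 \<longrightarrow>
      redheffer \<Phi> F\<^sub>1 \<sim>\<^sub>\<infinity> redheffer \<Phi> F\<^sub>2)"
proof -
  note schur = \<open>schur \<Phi>\<close> \<open>schur F\<^sub>1\<close> \<open>schur F\<^sub>2\<close>
  have equiv: "F\<^sub>1 \<sim>\<^sub>\<infinity> F\<^sub>2" "F\<^sub>2 \<sim>\<^sub>\<infinity> F\<^sub>1"
    using \<open>F\<^sub>1 \<sim>\<^sub>\<infinity> F\<^sub>2\<close> by (auto simp: schur_equiv_def)
  show ?thesis
  proof (intro conjI impI iffI)
    show "norm (block11 (\<Phi> 0) o\<^sub>C F\<^sub>2 0) < 1" if "norm (block11 (\<Phi> 0) o\<^sub>C F\<^sub>1 0) < 1"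
      by (rule schur_equiv_strict[OF schur(1) equiv(1) that])
    show "norm (block11 (\<Phi> 0) o\<^sub>C F\<^sub>1 0) < 1" if "norm (block11 (\<Phi> 0) o\<^sub>C F\<^sub>2 0) < 1"
      by (rule schur_equiv_strict[OF schur(1) equiv(2) that])
    assume "norm (block11 (\<Phi> 0) o\<^sub>C F\<^sub>1 0) < 1 \<and> norm (block11 (\<Phi> 0) o\<^sub>C F\<^sub>2 0) < 1"
    then have strict: "norm (block11 (\<Phi> 0) o\<^sub>C F\<^sub>1 0) < 1" "norm (block11 (\<Phi> 0) o\<^sub>C F\<^sub>2 0) < 1"
      by blast+
    show "redheffer \<Phi> F\<^sub>1 \<sim>\<^sub>\<infinity> redheffer \<Phi> F\<^sub>2"
      unfolding schur_equiv_def
      using redheffer_schur_prec[OF schur(1,2,3) strict equiv(1)]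
        redheffer_schur_prec[OF schur(1,3,2) strict(2,1) equiv(2)]
      by (rule conjI)
  qed
qed

end
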